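(* Let $b$ be a (possibly degenerate) symmetric bilinear form on an $n$-dimensional vector space $V$ over a field of characteristic different from $2$, with Witt index $\nu$ and rank $r$. Let $\mathcal{V}$ be a linear subspace of $\mathcal{S}_b$ consisting only of nilpotent endomorphisms, with $\dim\mathcal{V}=\binom{n-r}{2}+r(n-r)+(\nu-n+r)(n-\nu)$. Then there exists a maximal partially complete $b$-singular flag $\mathcal{F}=(F_0,\dots,F_\nu)$ of $V$ such that $F_{n-r}=\mathrm{Rad}(b)$ and $\mathcal{V}$ equals the set of all nilpotent $b$-symmetric endomorphisms of $V$ that stabilize $\mathcal{F}$.
   Context: $\mathrm{Rad}(b)=\{y\in V:\forall x\in V,\ b(x,y)=0\}$. The Witt index of $b$ is the maximal dimension of a totally singular subspace $X$ ($b(x,y)=0$ for all $x,y\in X$). An endomorphism $u$ is $b$-symmetric if $(x,y)\mapsto b(x,u(y))$ is symmetric; $\mathcal{S}_b$ is the space of these. A flag $(F_0,\dots,F_p)$ is an increasing sequence of subspaces; it is partially complete if $\dim F_i=i$ for all $i$, $b$-singular if $F_p$ is totally singular, and maximal if moreover $p$ is the Witt index of $b$. $u$ stabilizes the flag if $u(F_i)\subseteq F_i$ for all $i$. *)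

theory Defs
  imports Complex_Main "HOL-Library.Function_Algebras"
begin

text \<open>Abstract setting: the vector space V is the whole carrier type 'v,
  with scalar multiplication scale by the field 'k.  Endomorphisms of V are
  functions 'v => 'v; the space of all such functions carries the
  pointwise scalar multiplication fun_scale.\<close>

definition fun_scale :: "('k::field \<Rightarrow> 'v::ab_group_add \<Rightarrow> 'v) \<Rightarrow> 'k \<Rightarrow> ('w \<Rightarrow> 'v) \<Rightarrow> ('w \<Rightarrow> 'v)" where
  "fun_scale scale c f = (\<lambda>x. scale c (f x))"

definition bilinear_form :: "('k::field \<Rightarrow> 'v::ab_group_add \<Rightarrow> 'v) \<Rightarrow> ('v \<Rightarrow> 'v \<Rightarrow> 'k) \<Rightarrow> bool" where
  "bilinear_form scale b \<longleftrightarrow>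
     (\<forall>x. Vector_Spaces.linear scale (*) (b x)) \<and> (\<forall>y. Vector_Spaces.linear scale (*) (\<lambda>x. b x y))"

definition symmetric_form :: "('v \<Rightarrow> 'v \<Rightarrow> 'k) \<Rightarrow> bool" where
  "symmetric_form b \<longleftrightarrow> (\<forall>x y. b x y = b y x)"

definition Rad :: "('v \<Rightarrow> 'v \<Rightarrow> 'k::zero) \<Rightarrow> 'v set" where
  "Rad b = {y. \<forall>x. b x y = 0}"

definition totally_singular :: "('v \<Rightarrow> 'v \<Rightarrow> 'k::zero) \<Rightarrow> 'v set \<Rightarrow> bool" where
  "totally_singular b X \<longleftrightarrow> (\<forall>x\<in>X. \<forall>y\<in>X. b x y = 0)"

definition witt_index :: "('k::field \<Rightarrow> 'v::ab_group_add \<Rightarrow> 'v) \<Rightarrow> ('v \<Rightarrow> 'v \<Rightarrow> 'k) \<Rightarrow> nat" where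
  "witt_index scale b = (GREATEST d. \<exists>X. Modules.module.subspace scale X \<and> totally_singular b X
                                   \<and> vector_space.dim scale X = d)"

text \<open>Rank of b: dim V - dim Rad(b) (the rank of any Gram matrix of b).\<close>
definition form_rank :: "('k::field \<Rightarrow> 'v::ab_group_add \<Rightarrow> 'v) \<Rightarrow> ('v \<Rightarrow> 'v \<Rightarrow> 'k) \<Rightarrow> nat" where
  "form_rank scale b = vector_space.dim scale (UNIV :: 'v set) - vector_space.dim scale (Rad b)"

definition b_symmetric :: "('v \<Rightarrow> 'v \<Rightarrow> 'k) \<Rightarrow> ('v \<Rightarrow> 'v) \<Rightarrow> bool" where
  "b_symmetric b u \<longleftrightarrow> (\<forall>x y. b x (u y) = b y (u x))"

definition S_b :: "('k::field \<Rightarrow> 'v::ab_group_add \<Rightarrow> 'v) \<Rightarrow> ('v \<Rightarrow> 'v \<Rightarrow> 'k) \<Rightarrow> ('v \<Rightarrow> 'v) set" where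
  "S_b scale b = {u. Vector_Spaces.linear scale scale u \<and> b_symmetric b u}"

definition nilpotent_endo :: "('v::zero \<Rightarrow> 'v) \<Rightarrow> bool" where
  "nilpotent_endo u \<longleftrightarrow> (\<exists>k. (u ^^ k) = (\<lambda>_. 0))"

definition is_flag :: "('k::field \<Rightarrow> 'v::ab_group_add \<Rightarrow> 'v) \<Rightarrow> (nat \<Rightarrow> 'v set) \<Rightarrow> nat \<Rightarrow> bool" where
  "is_flag scale F p \<longleftrightarrow> (\<forall>i\<le>p. Modules.module.subspace scale (F i)) \<and> (\<forall>i<p. F i \<subseteq> F (Suc i))"

definition partially_complete_flag :: "('k::field \<Rightarrow> 'v::ab_group_add \<Rightarrow> 'v) \<Rightarrow> (nat \<Rightarrow> 'v set) \<Rightarrow> nat \<Rightarrow> bool" where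
  "partially_complete_flag scale F p \<longleftrightarrow> is_flag scale F p \<and> (\<forall>i\<le>p. vector_space.dim scale (F i) = i)"

definition singular_flag :: "('k::field \<Rightarrow> 'v::ab_group_add \<Rightarrow> 'v) \<Rightarrow> ('v \<Rightarrow> 'v \<Rightarrow> 'k) \<Rightarrow> (nat \<Rightarrow> 'v set) \<Rightarrow> nat \<Rightarrow> bool" where
  "singular_flag scale b F p \<longleftrightarrow> is_flag scale F p \<and> totally_singular b (F p)"

definition stabilizes_flag :: "('v \<Rightarrow> 'v) \<Rightarrow> (nat \<Rightarrow> 'v set) \<Rightarrow> nat \<Rightarrow> bool" where
  "stabilizes_flag u F p \<longleftrightarrow> (\<forall>i\<le>p. u ` F i \<subseteq> F i)"

end

theory Submission
  imports Defs "HOL-Computational_Algebra.Polynomial"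
begin

text \<open>
  Instead of passing to quotients \<open>X\<^sup>\<bottom> / X\<close> by a totally
  singular subspace \<open>X\<close>, one keeps the ambient space and considers subspaces \<open>V\<close> of nilpotent symmetric
  operators killing \<open>X\<close> and containing all symmetric \<open>u\<close> with \<open>u X = 0\<close> and \<open>u X\<^sup>\<bottom> \<subseteq> X\<close>.
  For an isotropic \<open>x\<close> in \<open>X\<^sup>\<bottom>\<close> outside \<open>X\<close> one compares \<open>V\<close> with the space obtained by enlarging
  \<open>X\<close> by \<open>x\<close>. If \<open>x \<otimes> y + y \<otimes> x\<close> lies in \<open>V\<close> then \<open>y\<close> is orthogonal to
  all \<open>v\<^sup>k x\<close> with \<open>v\<close> in \<open>V\<close>; this bounds the dimension of \<open>V\<close>, and when the bound is attained
  the tensors in \<open>V\<close> are exactly those with \<open>y\<close> orthogonal to \<open>P\<^sub>x = K x \<oplus> V x\<close>, so that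
  \<open>v\<^sup>k x \<in> P\<^sub>x\<close>.

  By induction it then suffices to find \<open>x\<close> with \<open>V x \<subseteq> X\<close>. One first finds \<open>x\<close> with
  \<open>b (x, v x) = 0\<close> for all \<open>v\<close> in \<open>V\<close> (over infinite fields as a last nonzero power of an operator of
  maximal nilindex, over finite fields by counting) and takes such an \<open>x\<close> with \<open>dim V x\<close> minimal. Then
  \<open>P\<^sub>x\<close> is totally singular, is a member of the flag given by the induction hypothesis, and is
  \<open>V\<close>-invariant; by minimality \<open>P\<^sub>z = P\<^sub>x\<close> for all \<open>z\<close> in \<open>P\<^sub>x\<close> outside \<open>X\<close>. If
  \<open>V x\<close> were not contained in \<open>X\<close>, operators of \<open>V\<close> of rank at most two on \<open>P\<^sub>x\<close> would contradict
  nilpotency.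
\<close>

section \<open>Finite-dimensional subspaces of arbitrary vector spaces\<close>

text \<open>The dimension in the theorem is what remains after adding up the losses of all
  enlargements. Going from \<open>X\<close> to \<open>ext X x\<close> costs at most
  \<open>dim X\<close>, and \<open>0 + 1 + ... + (\<nu> - 1)\<close> is
  \<open>\<nu> choose 2\<close>; over a maximal \<open>X\<close> only \<open>ZS X\<close> is left,
  of dimension at most \<open>\<nu> (n - \<nu>)\<close> minus
  \<open>(\<nu> - dim R) choose 2\<close>. A space of the extremal dimension has equality at every
  step and for every choice of vectors, so the induction hypothesis is available at all candidates
  at once. The obstacle is that \<open>V\<close> is only a linear space: products of its operators
  need not lie in it. What is known about products comes from rank two perturbations and from
  polarising, which controls symmetrised products only. Perturbing with both signs separates trace
  from determinant whenever 2 is invertible, with no supply of scalars, so small fields are no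
  exception. Degenerate forms fit in because a tensor is stored with a functional in place of a
  representing vector, and because the radical is exhausted first.\<close>

text \<open>
  A separate locale: \<open>Complex_Main\<close> interprets \<open>vector_space\<close> for real vector spaces without mandatory
  qualifier, so extending that locale would make the new names ambiguous.
\<close>

locale vec_space = vector_space
begin

text \<open>A space of functions between vector spaces can be infinite-dimensional, so finiteness is
  attached to subsets and not to the ambient space.\<close>

definition fin_dim :: "'b set \<Rightarrow> bool" where
  "fin_dim S \<longleftrightarrow> (\<exists>B. finite B \<and> S \<subseteq> span B)"

lemma fin_dim_subset: "fin_dim T \<Longrightarrow> S \<subseteq> T \<Longrightarrow> fin_dim S"
  unfolding fin_dim_def by blast

lemma fin_dim_independent_finite:
  assumes "fin_dim S" "B \<subseteq> S" "independent B"
  shows "finite B"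
  proof -
  obtain C where C: "finite C" "S \<subseteq> span C" using assms(1) unfolding fin_dim_def by blast
  show ?thesis using independent_span_bound[OF C(1) assms(3)] assms(2) C(2) by blast
qed

lemma fin_dim_basis:
  assumes "subspace S" "fin_dim S"
  obtains B where "B \<subseteq> S" "independent B" "finite B" "span B = S" "card B = dim S"
proof -
  obtain B where B: "B \<subseteq> S" "independent B" "S \<subseteq> span B" "card B = dim S"
    by (rule basis_exists[of S])
  have "span B = S"
    using B(1,3) assms(1) by (rule span_subspace)
  with B fin_dim_independent_finite[OF assms(2) B(1,2)] that show ?thesis by blast
qed

lemma fin_dim_dim_mono:
  assumes "subspace S" "subspace T" "fin_dim T" "S \<subseteq> T"
  shows "dim S \<le> dim T"
proof -
  obtain C where C: "C \<subseteq> T" "independent C" "finite C" "span C = T" "card C = dim T"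
    using fin_dim_basis[OF assms(2,3)] by blast
  show ?thesis
    using dim_le_card[of S C] C assms(4) by auto
qed

lemma fin_dim_dim_eq:
  assumes "subspace S" "subspace T" "fin_dim T" "S \<subseteq> T" "dim T \<le> dim S"
  shows "S = T"
proof -
  obtain B where B: "B \<subseteq> S" "independent B" "finite B" "span B = S" "card B = dim S"
    using fin_dim_basis[OF assms(1) fin_dim_subset[OF assms(3,4)]] by blast
  obtain C where C: "B \<subseteq> C" "C \<subseteq> T" "independent C" "T \<subseteq> span C"
    using maximal_independent_subset_extend[of B T] B assms(4) by blast
  have fC: "finite C" using fin_dim_independent_finite[OF assms(3) C(2,3)] .
  have "card C = dim T" using C basis_card_eq_dim by blast
  then have "C = B" using card_seteq[OF fC C(1)] B(5) assms(5) by simp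
  then show ?thesis using C B assms(4) by blast
qed

lemma dim_zero [simp]: "dim {0} = 0"
  using dim_le_card[of "{0}" "{}"] by simp

text \<open>Each further basis vector multiplies the number of elements by the size of the field.
  This serves the count over finite fields.\<close>

lemma subspace_card:
  assumes fin: "finite (UNIV :: 'a set)" and S: "subspace S" "fin_dim S"
  shows "finite S" "card S = card (UNIV :: 'a set) ^ dim S"
proof -
  have *: "finite (span B) \<and> card (span B) = card (UNIV :: 'a set) ^ card B"
    if "finite B" "independent B" for B
    using that
  proof (induction B rule: finite_induct)
    case empty
    then show ?case by simp
  next
    case (insert a B)
    have ind: "independent B" "a \<notin> span B"
      using insert.prems insert.hyps by (auto simp: independent_insert)
    note IH = insert.IH[OF ind(1)]
    let ?h = "\<lambda>(k, y). scale k a + y"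
    have img: "span (insert a B) = ?h ` (UNIV \<times> span B)"
    proof -
      have "x \<in> ?h ` (UNIV \<times> span B)" if "x - scale k a \<in> span B" for x k
        using that by (intro image_eqI[of _ _ "(k, x - scale k a)"]) auto
      moreover have "scale k a + y \<in> span (insert a B)" if "y \<in> span B" for k y
        using that span_mono[of B "insert a B"] by (auto intro!: span_add span_scale intro: span_base)
      ultimately show ?thesis by (auto simp: span_insert)
    qed
    have inj: "inj_on ?h (UNIV \<times> span B)"
    proof (rule inj_onI, clarify)
      fix k y k' y'
      assume y: "y \<in> span B" "y' \<in> span B" and eq: "scale k a + y = scale k' a + y'"
      have d: "scale (k - k') a = y' - y"
        using eq by (simp add: scale_left_diff_distrib algebra_simps)
      then have in_span: "scale (k - k') a \<in> span B" using y by (simp add: span_diff)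
      have "k = k'"
      proof (rule ccontr)
        assume "k \<noteq> k'"
        then have "scale (inverse (k - k')) (scale (k - k') a) = a" by simp
        with span_scale[OF in_span, of "inverse (k - k')"] ind(2) show False by simp
      qed
      with d show "k = k' \<and> y = y'" by simp
    qed
    show ?case
      using IH fin insert.hyps by (simp add: img card_image[OF inj] card_cartesian_product)
  qed
  obtain B where "independent B" "finite B" "span B = S" "card B = dim S"
    using fin_dim_basis[OF S] by blast
  with *[of B] show "finite S" "card S = card (UNIV :: 'a set) ^ dim S" by auto
qed

end

section \<open>Rank-nullity and spaces of linear maps\<close>

lemma vec_space_fun_scale:
  assumes "vec_space s"
  shows "vec_space (fun_scale s)"
proof -
  interpret vec_space s by fact
  show ?thesis
    by unfold_locales
      (auto simp: fun_scale_def fun_eq_iff scale_right_distrib scale_left_distrib)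
qed

lemma vec_space_mult: "vec_space ((*) :: 'k::field \<Rightarrow> 'k \<Rightarrow> 'k)"
  by unfold_locales (auto simp: algebra_simps)

lemma sum_apply_fun: "sum f A x = (\<Sum>a\<in>A. f a x)"
  by (induction A rule: infinite_finite_induct) auto

locale vec_space_pair = vs1: vec_space s1 + vs2: vec_space s2
  for s1 :: "'a::field \<Rightarrow> 'b::ab_group_add \<Rightarrow> 'b"
    and s2 :: "'a::field \<Rightarrow> 'c::ab_group_add \<Rightarrow> 'c"
begin

sublocale vector_space_pair s1 s2 by unfold_locales

lemma rank_nullity:
  assumes f: "Vector_Spaces.linear s1 s2 f" and S: "vs1.subspace S" "vs1.fin_dim S"
  shows "vs1.dim S = vs2.dim (f ` S) + vs1.dim {x \<in> S. f x = 0}"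
proof -
  interpret f: Vector_Spaces.linear s1 s2 f by fact
  let ?K = "{x \<in> S. f x = 0}"
  have K: "vs1.subspace ?K"
    using S(1) by (auto simp: vs1.subspace_def f.add f.scale)
  obtain BK where BK: "BK \<subseteq> ?K" "vs1.independent BK" "finite BK" "vs1.span BK = ?K"
      "card BK = vs1.dim ?K"
    using vs1.fin_dim_basis[OF K vs1.fin_dim_subset[OF S(2)]] by blast
  obtain B where B: "BK \<subseteq> B" "B \<subseteq> S" "vs1.independent B" "S \<subseteq> vs1.span B"
    using vs1.maximal_independent_subset_extend[of BK S] BK by blast
  have fB: "finite B" using vs1.fin_dim_independent_finite[OF S(2) B(2,3)] .
  have spB: "vs1.span B = S" using vs1.span_subspace[OF B(2,4) S(1)] .
  let ?C = "B - BK"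
  have indC: "vs1.independent ?C" using B(3) vs1.independent_mono by blast
  \<comment> \<open>Such an \<open>x\<close> has two expansions in the basis \<open>B\<close>, one
    supported on \<open>BK\<close> and one off it; uniqueness makes all coefficients zero.\<close>
  have zero: "x = 0" if x: "x \<in> vs1.span ?C" "f x = 0" for x
  proof -
    have xS: "x \<in> S" using x(1) vs1.span_mono[of ?C B] spB by blast
    then have xK: "x \<in> vs1.span BK" using BK x by blast
    have "vs1.representation B x = vs1.representation BK x"
      using B(1,3) xK vs1.representation_extend by blast
    moreover have "vs1.representation B x = vs1.representation ?C x"
      using B(3) x(1) vs1.representation_extend[of B x ?C] by blast
    moreover have "vs1.representation BK x v = 0" if "v \<notin> BK" for v
      using vs1.representation_ne_zero that by blast
    moreover have "vs1.representation ?C x v = 0" if "v \<in> BK" for v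
      using vs1.representation_ne_zero[of ?C x v] that by blast
    ultimately have "vs1.representation B x v = 0" for v
      by (cases "v \<in> BK") metis+
    then have "(\<Sum>v | vs1.representation B x v \<noteq> 0. s1 (vs1.representation B x v) v) = 0"
      by simp
    then show "x = 0"
      using vs1.sum_nonzero_representation_eq[OF B(3)] xS spB by auto
  qed
  have inj: "inj_on f (vs1.span ?C)"
    using f.inj_on_iff_eq_0[OF vs1.subspace_span] zero by blast
  have ind: "vs2.independent (f ` ?C)"
    using f.independent_injective_image[OF indC inj] .
  have "f ` S = vs2.span (f ` B)" using f.span_image spB by simp
  also have "\<dots> = vs2.span (f ` ?C)"
  proof (rule antisym)
    have "f v \<in> vs2.span (f ` ?C)" if "v \<in> B" for v
    proof (cases "v \<in> BK")
      case True
      then have "f v = 0" using BK(1) by blast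
      then show ?thesis by (simp add: vs2.span_zero)
    qed (use that in \<open>auto intro: vs2.span_base\<close>)
    then show "vs2.span (f ` B) \<subseteq> vs2.span (f ` ?C)"
      by (intro vs2.span_minimal) auto
    show "vs2.span (f ` ?C) \<subseteq> vs2.span (f ` B)"
      by (intro vs2.span_mono) auto
  qed
  finally have "vs2.dim (f ` S) = card (f ` ?C)"
    using vs2.dim_span_eq_card_independent[OF ind] by simp
  also have "\<dots> = card ?C"
    using inj vs1.span_superset by (intro card_image) (rule inj_on_subset)
  also have "\<dots> = card B - card BK" using B(1) BK(3) card_Diff_subset by blast
  finally have "vs2.dim (f ` S) + card BK = card B"
    using card_mono[OF fB B(1)] by simp
  moreover have "card B = vs1.dim S" using vs1.basis_card_eq_dim[OF B(2,4,3)] .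
  ultimately show ?thesis using BK(5) by simp
qed

text \<open>The maps \<open>?e c w\<close>, sending \<open>z\<close> to its
  \<open>c\<close>-coordinate times \<open>w\<close>, are the matrix units and span all linear
  maps.\<close>

lemma fin_dim_linear_maps:
  assumes "finite B1" "vs1.independent B1" "vs1.span B1 = UNIV"
    and "finite B2" "vs2.span B2 = UNIV"
  shows "vec_space.fin_dim (fun_scale s2) {f. Vector_Spaces.linear s1 s2 f}"
proof -
  interpret F: vec_space "fun_scale s2 :: 'a \<Rightarrow> ('b \<Rightarrow> 'c) \<Rightarrow> _"
    using vs2.vec_space_axioms by (rule vec_space_fun_scale)
  let ?e = "\<lambda>c w z. s2 (vs1.representation B1 z c) w"
  let ?E = "(\<lambda>(c, w). ?e c w) ` (B1 \<times> B2)"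
  have elem: "?e c w \<in> F.span ?E" if c: "c \<in> B1" for c w
  proof -
    have "vs2.subspace {w. ?e c w \<in> F.span ?E}"
    proof (rule vs2.subspaceI)
      have "?e c 0 = 0" by (auto simp: fun_eq_iff)
      then show "0 \<in> {w. ?e c w \<in> F.span ?E}" using F.span_zero by simp
    next
      fix x y assume "x \<in> {w. ?e c w \<in> F.span ?E}" "y \<in> {w. ?e c w \<in> F.span ?E}"
      moreover have "?e c (x + y) = ?e c x + ?e c y"
        by (auto simp: fun_eq_iff vs2.scale_right_distrib)
      ultimately show "x + y \<in> {w. ?e c w \<in> F.span ?E}" using F.span_add by simp
    next
      fix k x assume "x \<in> {w. ?e c w \<in> F.span ?E}"
      moreover have "?e c (s2 k x) = fun_scale s2 k (?e c x)"
        by (auto simp: fun_eq_iff fun_scale_def mult.commute)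
      ultimately show "s2 k x \<in> {w. ?e c w \<in> F.span ?E}" using F.span_scale by simp
    qed
    moreover have "B2 \<subseteq> {w. ?e c w \<in> F.span ?E}"
      using c by (auto intro!: F.span_base image_eqI[of _ _ "(c, _)"])
    ultimately have "vs2.span B2 \<subseteq> {w. ?e c w \<in> F.span ?E}" by (intro vs2.span_minimal)
    then show ?thesis using assms(5) by blast
  qed
  have "f \<in> F.span ?E" if f: "Vector_Spaces.linear s1 s2 f" for f
  proof -
    interpret f: Vector_Spaces.linear s1 s2 f by fact
    have "f = (\<Sum>c\<in>B1. ?e c (f c))"
    proof
      fix z
      have "z = (\<Sum>c\<in>B1. s1 (vs1.representation B1 z c) c)"
        using vs1.sum_representation_eq[OF assms(2) _ assms(1)] assms(3) by auto
      then have "f z = f (\<Sum>c\<in>B1. s1 (vs1.representation B1 z c) c)" by simp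
      then show "f z = (\<Sum>c\<in>B1. ?e c (f c)) z" by (simp add: f.sum f.scale sum_apply_fun)
    qed
    then show ?thesis using elem F.span_sum[of B1 "\<lambda>c. ?e c (f c)"] by simp
  qed
  moreover have "finite ?E" using assms by auto
  ultimately show ?thesis unfolding F.fin_dim_def by blast
qed

end

context vec_space
begin

text \<open>A projection along a complement replaces the quotient map modulo \<open>S\<close>. On
  \<open>S + T\<close> it has the same image as on \<open>T\<close>, which reduces the dimension of
  a sum to rank-nullity.\<close>

lemma linear_with_kernel:
  assumes "subspace S"
  obtains p where "Vector_Spaces.linear scale scale p" "\<And>x. p x = 0 \<longleftrightarrow> x \<in> S"
proof -
  interpret VV: vec_space_pair scale scale using vec_space_axioms by (simp add: vec_space_pair_def)
  obtain B where B: "B \<subseteq> S" "independent B" "S \<subseteq> span B" "card B = dim S"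
    by (rule basis_exists[of S])
  have spB: "span B = S" using span_subspace[OF B(1,3) assms] .
  let ?C = "extend_basis B"
  have C: "independent ?C" "span ?C = UNIV" "B \<subseteq> ?C"
    using extend_basis_superset[OF B(2)] independent_extend_basis[OF B(2)] span_extend_basis[OF B(2)]
    by auto
  define p where "p = VV.construct ?C (\<lambda>c. if c \<in> B then 0 else c)"
  have lin: "Vector_Spaces.linear scale scale p" unfolding p_def by (rule VV.linear_construct[OF C(1)])
  interpret p: Vector_Spaces.linear scale scale p by fact
  have basis: "p c = (if c \<in> B then 0 else c)" if "c \<in> ?C" for c
    unfolding p_def using VV.construct_basis[OF C(1) that] .
  then have "p c = 0" if "c \<in> B" for c using that C(3) by auto
  then have pB: "p x = 0" if "x \<in> S" for x
    using p.eq_0_on_span[of B x] that spB by blast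
  have pC: "p x = x" if "x \<in> span (?C - B)" for x
  proof -
    have id: "Vector_Spaces.linear scale scale (\<lambda>x. x)"
      by (simp add: Vector_Spaces.linear_iff vector_space_axioms)
    show ?thesis by (rule VV.linear_eq_on[OF lin id that]) (use basis in auto)
  qed
  have "x \<in> S" if x: "p x = 0" for x
  proof -
    have "x \<in> span (B \<union> (?C - B))" using C by (simp add: Un_absorb1)
    then obtain y z where yz: "x = y + z" "y \<in> span B" "z \<in> span (?C - B)"
      unfolding span_Un by blast
    then have "p x = z" using pB pC spB by (simp add: p.add)
    then show ?thesis using x yz spB by simp
  qed
  with lin pB that show ?thesis by blast
qed

lemma fin_dim_dim_sum:
  assumes "subspace S" "subspace T" "fin_dim {x + y |x y. x \<in> S \<and> y \<in> T}"
  shows "dim {x + y |x y. x \<in> S \<and> y \<in> T} + dim (S \<inter> T) = dim S + dim T"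
proof -
  interpret VV: vec_space_pair scale scale using vec_space_axioms by (simp add: vec_space_pair_def)
  let ?ST = "{x + y |x y. x \<in> S \<and> y \<in> T}"
  obtain p where p: "Vector_Spaces.linear scale scale p" "\<And>x. p x = 0 \<longleftrightarrow> x \<in> S"
    using linear_with_kernel[OF assms(1)] by blast
  interpret p: Vector_Spaces.linear scale scale p by fact
  have sub: "S \<subseteq> ?ST" "T \<subseteq> ?ST"
    using subspace_0[OF assms(1)] subspace_0[OF assms(2)] by force+
  have "p (x + y) = p y" if "x \<in> S" for x y
    using p(2) that by (simp add: p.add)
  then have "p ` ?ST \<subseteq> p ` T" by auto
  then have img: "p ` ?ST = p ` T" using image_mono[OF sub(2)] by (rule antisym)
  have "{x \<in> ?ST. p x = 0} = S" "{x \<in> T. p x = 0} = S \<inter> T"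
    using p(2) sub by auto
  then show ?thesis
    using VV.rank_nullity[OF p(1) subspace_sums[OF assms(1,2)] assms(3)]
      VV.rank_nullity[OF p(1) assms(2) fin_dim_subset[OF assms(3) sub(2)]] img by simp
qed

end

section \<open>Annihilators in the dual space\<close>

locale fd_space = finite_dimensional_vector_space
begin

sublocale vec_space scale by unfold_locales

lemma fin_dim [simp]: "fin_dim S"
  unfolding fin_dim_def using finite_Basis span_Basis by blast

definition ann :: "'b set \<Rightarrow> ('b \<Rightarrow> 'a) set" where
  "ann A = {f. Vector_Spaces.linear scale (*) f \<and> (\<forall>a\<in>A. f a = 0)}"

lemma fin_dim_dual: "vec_space.fin_dim (fun_scale (*)) {f. Vector_Spaces.linear scale (*) f}"
proof -
  interpret vec_space_pair scale "(*) :: 'a \<Rightarrow> 'a \<Rightarrow> 'a"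
    using vec_space_axioms vec_space_mult by (simp add: vec_space_pair_def)
  have "vs2.span {1} = UNIV"
    by (auto simp: vs2.span_singleton)
  then show ?thesis
    using fin_dim_linear_maps[OF finite_Basis independent_Basis span_Basis, of "{1}"] by simp
qed

lemma fin_dim_endo: "vec_space.fin_dim (fun_scale scale) {f. Vector_Spaces.linear scale scale f}"
proof -
  interpret VV: vec_space_pair scale scale using vec_space_axioms by (simp add: vec_space_pair_def)
  show ?thesis
    using VV.fin_dim_linear_maps[OF finite_Basis independent_Basis span_Basis finite_Basis span_Basis] .
qed

lemma subspace_ann: "module.subspace (fun_scale (*)) (ann A)"
proof -
  interpret F: vec_space "fun_scale (*) :: 'a \<Rightarrow> ('b \<Rightarrow> 'a) \<Rightarrow> _"
    using vec_space_mult by (rule vec_space_fun_scale)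
  show ?thesis
    by (rule F.subspaceI) (auto simp: ann_def Vector_Spaces.linear_iff vector_space_axioms vec_space_mult[unfolded vec_space_def] fun_scale_def algebra_simps)
qed

lemma ann_separates:
  assumes "subspace A" "x \<notin> A"
  obtains f where "f \<in> ann A" "f x = 1"
proof -
  interpret vec_space_pair scale "(*) :: 'a \<Rightarrow> 'a \<Rightarrow> 'a"
    using vec_space_axioms vec_space_mult by (simp add: vec_space_pair_def)
  obtain B where B: "B \<subseteq> A" "independent B" "A \<subseteq> span B" "card B = dim A"
    by (rule basis_exists[of A])
  have spB: "span B = A" using span_subspace[OF B(1,3) assms(1)] .
  then have ind: "independent (insert x B)"
    using independent_insertI[of x B] assms(2) B(2) by simp
  obtain f where f: "Vector_Spaces.linear scale (*) f" "\<forall>y\<in>insert x B. f y = (if y = x then 1 else 0)"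
    using linear_independent_extend[OF ind, of "\<lambda>y. if y = x then 1 else 0"] by blast
  interpret f: Vector_Spaces.linear scale "(*)" f by fact
  have "x \<notin> B" using spB assms(2) span_base by blast
  then have "f y = 0" if "y \<in> B" for y using f(2) that by auto
  then have "f a = 0" if "a \<in> A" for a
    using f.eq_0_on_span[of B a] that spB by blast
  then show ?thesis using f that[of f] by (auto simp: ann_def)
qed

lemma dim_ann:
  assumes A: "subspace A"
  shows "vector_space.dim (fun_scale (*)) (ann A) + dim A = dim UNIV"
proof -
  interpret F: vec_space "fun_scale (*) :: 'a \<Rightarrow> ('b \<Rightarrow> 'a) \<Rightarrow> _"
    using vec_space_mult by (rule vec_space_fun_scale)
  interpret FV: vec_space_pair "fun_scale (*) :: 'a \<Rightarrow> ('b \<Rightarrow> 'a) \<Rightarrow> _" scale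
    by unfold_locales
  interpret VK: vec_space_pair scale "(*) :: 'a \<Rightarrow> 'a \<Rightarrow> 'a"
    using vec_space_axioms vec_space_mult by (simp add: vec_space_pair_def)
  obtain B where B: "B \<subseteq> A" "independent B" "A \<subseteq> span B" "card B = dim A"
    by (rule basis_exists[of A])
  have spB: "span B = A" using span_subspace[OF B(1,3) A] .
  let ?C = "extend_basis B"
  have C: "independent ?C" "span ?C = UNIV" "B \<subseteq> ?C"
    using extend_basis_superset[OF B(2)] independent_extend_basis[OF B(2)] span_extend_basis[OF B(2)]
    by auto
  have fC: "finite ?C" using finiteI_independent[OF C(1)] .
  \<comment> \<open>\<open>h f\<close> has the values of \<open>f\<close> as its coordinates in the
    basis \<open>?C\<close>; this identifies \<open>ann A\<close> with the span of the basis vectors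
    outside \<open>B\<close>.\<close>
  define h where "h f = (\<Sum>c\<in>?C. scale (f c) c)" for f :: "'b \<Rightarrow> 'a"
  have h: "Vector_Spaces.linear (fun_scale (*)) scale h"
    unfolding Vector_Spaces.linear_iff using F.vector_space_axioms vector_space_axioms
    by (auto simp: h_def fun_scale_def scale_left_distrib sum.distrib scale_sum_right)
  have ker: "{f \<in> ann A. h f = 0} = {0}"
  proof -
    have "f = 0" if f: "f \<in> ann A" "h f = 0" for f
    proof -
      interpret f: Vector_Spaces.linear scale "(*)" f using f by (simp add: ann_def)
      have "f c = 0" if "c \<in> ?C" for c
        using f(2) C(1) fC that independent_explicit[of ?C] unfolding h_def by blast
      then have "f x = 0" for x using f.eq_0_on_span[of ?C x] C(2) by auto
      then show ?thesis by auto
    qed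
    moreover have "0 \<in> ann A" using F.subspace_0[OF subspace_ann] .
    ultimately show ?thesis by (auto simp: h_def)
  qed
  have "h ` ann A = span (?C - B)"
  proof (rule antisym)
    show "h ` ann A \<subseteq> span (?C - B)"
    proof clarify
      fix f assume f: "f \<in> ann A"
      have "scale (f c) c \<in> span (?C - B)" if "c \<in> ?C" for c
      proof (cases "c \<in> B")
        case True
        then have "f c = 0" using f B(1) by (auto simp: ann_def)
        then show ?thesis by (simp add: span_zero)
      qed (use that in \<open>auto intro: span_scale span_base\<close>)
      then show "h f \<in> span (?C - B)" unfolding h_def by (rule span_sum)
    qed
    show "span (?C - B) \<subseteq> h ` ann A"
    proof (rule span_minimal)
      show "subspace (h ` ann A)" using FV.linear_subspace_image[OF h subspace_ann] .
      show "?C - B \<subseteq> h ` ann A"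
      proof
        fix c assume c: "c \<in> ?C - B"
        obtain f where f: "Vector_Spaces.linear scale (*) f" "\<forall>y\<in>?C. f y = (if y = c then 1 else 0)"
          using VK.linear_independent_extend[OF C(1), of "\<lambda>y. if y = c then 1 else 0"] by blast
        interpret f: Vector_Spaces.linear scale "(*)" f by fact
        have "f y = 0" if "y \<in> B" for y using f(2) that c C(3) by auto
        then have "f a = 0" if "a \<in> A" for a
          using f.eq_0_on_span[of B a] that spB by blast
        then have "f \<in> ann A" using f by (simp add: ann_def)
        moreover have "h f = (\<Sum>y\<in>?C. if y = c then c else 0)"
          unfolding h_def by (rule sum.cong) (use f(2) in auto)
        then have "h f = c" using c fC by simp
        ultimately show "c \<in> h ` ann A" by blast
      qed
    qed
  qed
  then have "dim (h ` ann A) = card (?C - B)"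
    using dim_span_eq_card_independent[of "?C - B"] independent_mono[OF C(1)] by auto
  also have "\<dots> = card ?C - card B"
    using C(3) fC by (intro card_Diff_subset) (auto intro: finite_subset)
  finally have "dim (h ` ann A) + dim A = card ?C"
    using B(4) card_mono[OF fC C(3)] by simp
  moreover have "card ?C = dim UNIV" using basis_card_eq_dim[of ?C UNIV] C by simp
  moreover have "F.fin_dim (ann A)"
    using fin_dim_dual by (rule F.fin_dim_subset) (auto simp: ann_def)
  ultimately show ?thesis
    using FV.rank_nullity[OF h subspace_ann, of A] ker by simp
qed

end

section \<open>Nilpotent perturbations of rank two\<close>

text \<open>For the 2x2 matrices \<open>A\<close>, \<open>A'\<close> the hypotheses read
  \<open>(I + s A') (I - s A) = I\<close>. Hence the polynomial
  \<open>det (I - s A) = 1 - s tr A + s^2 det A\<close> is constant, and its value at 0 is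
  1.\<close>

lemma det_identity_plus_unit:
  fixes a b c d a' b' c' d' :: "'k::field poly"
  defines "s \<equiv> [:0, 1:]"
  assumes "a' = a + s * (a' * a + b' * c)" "b' = b + s * (a' * b + b' * d)"
    and "c' = c + s * (c' * a + d' * c)" "d' = d + s * (c' * b + d' * d)"
  shows "a + d = s * (a * d - b * c)"
proof -
  define p q r t where "p = 1 + s * a'" and "q = s * b'" and "r = s * c'" and "t = 1 + s * d'"
  define x y z w where "x = 1 - s * a" and "y = - (s * b)" and "z = - (s * c)" and "w = 1 - s * d"
  have "p * x + q * z = 1 + s * (a' - (a + s * (a' * a + b' * c)))"
    by (simp add: p_def x_def q_def z_def algebra_simps)
  then have e11: "p * x + q * z = 1" using assms(2) by simp
  have "p * y + q * w = s * (b' - (b + s * (a' * b + b' * d)))"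
    by (simp add: p_def y_def q_def w_def algebra_simps)
  then have e12: "p * y + q * w = 0" using assms(3) by simp
  have "r * x + t * z = s * (c' - (c + s * (c' * a + d' * c)))"
    by (simp add: r_def x_def t_def z_def algebra_simps)
  then have e21: "r * x + t * z = 0" using assms(4) by simp
  have "r * y + t * w = 1 + s * (d' - (d + s * (c' * b + d' * d)))"
    by (simp add: r_def y_def t_def w_def algebra_simps)
  then have e22: "r * y + t * w = 1" using assms(5) by simp
  have "(p * t - q * r) * (x * w - y * z)
      = (p * x + q * z) * (r * y + t * w) - (p * y + q * w) * (r * x + t * z)"
    by (simp add: algebra_simps)
  then have "(p * t - q * r) * (x * w - y * z) = 1" using e11 e12 e21 e22 by simp
  then have "(x * w - y * z) dvd 1" by (metis dvd_triv_right)
  then obtain k where deg: "x * w - y * z = [:k:]" by (rule is_unit_polyE)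
  have eq: "x * w - y * z = 1 - s * (a + d - s * (a * d - b * c))"
    by (simp add: x_def y_def z_def w_def algebra_simps)
  have "poly (x * w - y * z) 0 = 1" by (simp add: eq s_def)
  with deg have "x * w - y * z = 1" by (simp add: one_pCons)
  then have "s * (a + d - s * (a * d - b * c)) = 0" using eq by simp
  then show ?thesis by (simp add: s_def)
qed

lemma ex_poly_coeff_eq:
  assumes "\<And>k. K \<le> k \<Longrightarrow> g k = (0::'k::zero)"
  obtains p where "\<And>k. coeff p k = g k"
  using coeff_Abs_poly[of K g] assms that[of "Abs_poly g"] by simp

lemma nilpotent_endo_funpow:
  assumes "nilpotent_endo u"
  obtains K where "\<And>k x. K \<le> k \<Longrightarrow> (u ^^ k) x = 0"
proof -
  obtain K where K: "(u ^^ K) = (\<lambda>_. 0)" using assms unfolding nilpotent_endo_def by blast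
  have "(u ^^ k) x = 0" if "K \<le> k" for k x
  proof -
    have "u ^^ k = (u ^^ K) \<circ> (u ^^ (k - K))" using that by (simp flip: funpow_add)
    then show ?thesis using K by simp
  qed
  then show ?thesis by (rule that)
qed

context vec_space
begin

lemma linear_funpow:
  assumes "Vector_Spaces.linear scale scale u"
  shows "Vector_Spaces.linear scale scale (u ^^ k)"
proof (induction k)
  case 0
  then show ?case by (simp add: Vector_Spaces.linear_iff vector_space_axioms)
next
  case (Suc k)
  then show ?case using assms by (simp add: Vector_Spaces.linear_iff)
qed

text \<open>
  The generating polynomials of \<open>f\<^sub>i (N\<^sup>k x\<^sub>j)\<close> for \<open>N\<close> and for a rank two perturbation \<open>N'\<close> form
  matrices with \<open>(I + s A') (I - s A) = I\<close>, so \<open>det (I - s A)\<close> is a unit among the polynomials in \<open>s\<close>.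
\<close>

lemma perturbation_recurrence:
  assumes lin: "Vector_Spaces.linear scale scale N'"
    and P: "\<And>p. p \<in> P \<Longrightarrow> N p \<in> P"
    and X: "\<And>w. w \<in> X \<Longrightarrow> N' w = 0" "\<And>w. w \<in> X \<Longrightarrow> f w = 0"
    and f: "Vector_Spaces.linear scale (*) f"
    and diff: "\<And>p. p \<in> P \<Longrightarrow> N' p - (N p + scale (f1 p) x1 + scale (f2 p) x2) \<in> X"
    and p: "p \<in> P"
  shows "f ((N' ^^ k) p) = f ((N ^^ k) p)
    + (\<Sum>j<k. f ((N' ^^ (k - 1 - j)) x1) * f1 ((N ^^ j) p) + f ((N' ^^ (k - 1 - j)) x2) * f2 ((N ^^ j) p))"
  using p
proof (induction k arbitrary: p)
  case 0
  then show ?case by simp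
next
  case (Suc k)
  interpret N': Vector_Spaces.linear scale scale "N' ^^ k" by (rule linear_funpow[OF lin])
  interpret f: Vector_Spaces.linear scale "(*)" f by fact
  define w where "w = N' p - (N p + scale (f1 p) x1 + scale (f2 p) x2)"
  have w: "w \<in> X" using diff[OF Suc.prems] by (simp add: w_def)
  have "f ((N' ^^ k) w) = 0"
  proof (cases k)
    case (Suc l)
    have "(N' ^^ l) 0 = 0"
      using linear_funpow[OF lin, of l] by (metis Vector_Spaces.linear_iff scale_zero_left)
    then show ?thesis using Suc X(1)[OF w] f.zero by (simp add: funpow_swap1)
  qed (use X(2)[OF w] in simp)
  moreover have "N' p = N p + scale (f1 p) x1 + scale (f2 p) x2 + w" by (simp add: w_def)
  ultimately have "f ((N' ^^ Suc k) p)
      = f ((N' ^^ k) (N p)) + f ((N' ^^ k) x1) * f1 p + f ((N' ^^ k) x2) * f2 p"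
    by (simp add: funpow_swap1 N'.add N'.scale f.add f.scale)
  also have "f ((N' ^^ k) (N p)) = f ((N ^^ k) (N p))
    + (\<Sum>j<k. f ((N' ^^ (k - 1 - j)) x1) * f1 ((N ^^ j) (N p)) + f ((N' ^^ (k - 1 - j)) x2) * f2 ((N ^^ j) (N p)))"
    by (rule Suc.IH[OF P[OF Suc.prems]])
  finally show ?case
    by (simp add: sum.lessThan_Suc_shift funpow_swap1 add.commute add.left_commute del: sum.lessThan_Suc)
qed

text \<open>\<open>N'\<close> and both functionals vanish on \<open>X\<close>, so the perturbation
  needs to have rank two only on \<open>P\<close> and modulo \<open>X\<close>.\<close>

lemma rank_two_perturbation_step:
  assumes lin: "Vector_Spaces.linear scale scale N'"
    and nil: "nilpotent_endo N" "nilpotent_endo N'"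
    and P: "\<And>p. p \<in> P \<Longrightarrow> N p \<in> P" "x1 \<in> P" "x2 \<in> P"
    and X: "\<And>w. w \<in> X \<Longrightarrow> N' w = 0" "\<And>w. w \<in> X \<Longrightarrow> f1 w = 0" "\<And>w. w \<in> X \<Longrightarrow> f2 w = 0"
    and f: "Vector_Spaces.linear scale (*) f1" "Vector_Spaces.linear scale (*) f2"
    and diff: "\<And>p. p \<in> P \<Longrightarrow> N' p - (N p + scale (f1 p) x1 + scale (f2 p) x2) \<in> X"
    and coeff: "\<And>k. coeff a k = f1 ((N ^^ k) x1)" "\<And>k. coeff b k = f1 ((N ^^ k) x2)"
      "\<And>k. coeff c k = f2 ((N ^^ k) x1)" "\<And>k. coeff d k = f2 ((N ^^ k) x2)"
  shows "a + d = [:0, 1:] * (a * d - b * c)"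
proof -
  obtain K where K: "\<And>k x. K \<le> k \<Longrightarrow> (N' ^^ k) x = 0"
    using nilpotent_endo_funpow[OF nil(2)] by blast
  have ex: "\<exists>q. \<forall>k. coeff q k = f ((N' ^^ k) x)" if "Vector_Spaces.linear scale (*) f" for f x
  proof -
    interpret f: Vector_Spaces.linear scale "(*)" f by fact
    show ?thesis using ex_poly_coeff_eq[of K "\<lambda>k. f ((N' ^^ k) x)"] K by (metis f.zero)
  qed
  obtain a' where a': "\<And>k. coeff a' k = f1 ((N' ^^ k) x1)" using ex[OF f(1)] by blast
  obtain b' where b': "\<And>k. coeff b' k = f1 ((N' ^^ k) x2)" using ex[OF f(1)] by blast
  obtain c' where c': "\<And>k. coeff c' k = f2 ((N' ^^ k) x1)" using ex[OF f(2)] by blast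
  obtain d' where d': "\<And>k. coeff d' k = f2 ((N' ^^ k) x2)" using ex[OF f(2)] by blast
  \<comment> \<open>The sum in \<open>perturbation_recurrence\<close> is the coefficient of degree
    \<open>k - 1\<close> of a product of generating polynomials; the factor \<open>[:0, 1:]\<close>
    makes up for the shift.\<close>
  have rec: "g' = g + [:0, 1:] * (h1 * g1 + h2 * g2)"
    if g': "\<And>k. coeff g' k = h ((N' ^^ k) p)" and g: "\<And>k. coeff g k = h ((N ^^ k) p)"
      and h1: "\<And>k. coeff h1 k = h ((N' ^^ k) x1)" and h2: "\<And>k. coeff h2 k = h ((N' ^^ k) x2)"
      and g1: "\<And>k. coeff g1 k = f1 ((N ^^ k) p)" and g2: "\<And>k. coeff g2 k = f2 ((N ^^ k) p)"
      and p: "p \<in> P" and h: "Vector_Spaces.linear scale (*) h" "\<And>w. w \<in> X \<Longrightarrow> h w = 0"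
    for g' g h1 h2 g1 g2 :: "'a poly" and h p
  proof (rule poly_eqI)
    fix k
    have r: "coeff g' k = coeff g k + (\<Sum>j<k. coeff h1 (k - 1 - j) * coeff g1 j + coeff h2 (k - 1 - j) * coeff g2 j)"
      unfolding g' g h1 h2 g1 g2
      using perturbation_recurrence[OF lin P(1) X(1) h(2) h(1) diff p, of k] by simp
    show "coeff g' k = coeff (g + [:0, 1:] * (h1 * g1 + h2 * g2)) k"
    proof (cases k)
      case 0
      then show ?thesis using r by simp
    next
      case (Suc l)
      have "coeff (h1 * g1 + h2 * g2) l = (\<Sum>j\<le>l. coeff h1 (l - j) * coeff g1 j + coeff h2 (l - j) * coeff g2 j)"
        by (simp add: mult.commute[of h1] mult.commute[of h2] coeff_mult sum.distrib mult.commute)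
      then show ?thesis using r Suc by (simp add: lessThan_Suc_atMost)
    qed
  qed
  show ?thesis
  proof (rule det_identity_plus_unit)
    show "a' = a + [:0, 1:] * (a' * a + b' * c)"
      by (rule rec[OF a' coeff(1) a' b' coeff(1) coeff(3) P(2) f(1) X(2)])
    show "b' = b + [:0, 1:] * (a' * b + b' * d)"
      by (rule rec[OF b' coeff(2) a' b' coeff(2) coeff(4) P(3) f(1) X(2)])
    show "c' = c + [:0, 1:] * (c' * a + d' * c)"
      by (rule rec[OF c' coeff(3) c' d' coeff(1) coeff(3) P(2) f(2) X(3)])
    show "d' = d + [:0, 1:] * (c' * b + d' * d)"
      by (rule rec[OF d' coeff(4) c' d' coeff(2) coeff(4) P(3) f(2) X(3)])
  qed
qed

text \<open>Passing from \<open>U\<close> to \<open>- U\<close> changes the sign of the matrix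
  \<open>A\<close>, hence of its trace but not of its determinant. So the trace equals both
  \<open>s det A\<close> and its negative, and both sides vanish as 2 is invertible.\<close>

lemma rank_two_perturbation:
  assumes char: "(2::'a) \<noteq> 0"
    and lin: "Vector_Spaces.linear scale scale N" "Vector_Spaces.linear scale scale U"
    and nil: "nilpotent_endo N" "nilpotent_endo (N + U)" "nilpotent_endo (N - U)"
    and P: "\<And>p. p \<in> P \<Longrightarrow> N p \<in> P" "x1 \<in> P" "x2 \<in> P"
    and X: "subspace X" "\<And>w. w \<in> X \<Longrightarrow> N w = 0" "\<And>w. w \<in> X \<Longrightarrow> U w = 0"
      "\<And>w. w \<in> X \<Longrightarrow> f1 w = 0" "\<And>w. w \<in> X \<Longrightarrow> f2 w = 0"
    and f: "Vector_Spaces.linear scale (*) f1" "Vector_Spaces.linear scale (*) f2"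
    and diff: "\<And>p. p \<in> P \<Longrightarrow> U p - (scale (f1 p) x1 + scale (f2 p) x2) \<in> X"
  obtains a b c d where "\<And>k. coeff a k = f1 ((N ^^ k) x1)" "\<And>k. coeff b k = f1 ((N ^^ k) x2)"
      "\<And>k. coeff c k = f2 ((N ^^ k) x1)" "\<And>k. coeff d k = f2 ((N ^^ k) x2)"
      "a + d = 0" "a * d = b * c"
proof -
  obtain K where K: "\<And>k x. K \<le> k \<Longrightarrow> (N ^^ k) x = 0"
    using nilpotent_endo_funpow[OF nil(1)] by blast
  have ex: "\<exists>q. \<forall>k. coeff q k = f ((N ^^ k) x)" if "Vector_Spaces.linear scale (*) f" for f x
  proof -
    interpret f: Vector_Spaces.linear scale "(*)" f by fact
    show ?thesis using ex_poly_coeff_eq[of K "\<lambda>k. f ((N ^^ k) x)"] K by (metis f.zero)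
  qed
  obtain a where a: "\<And>k. coeff a k = f1 ((N ^^ k) x1)" using ex[OF f(1)] by blast
  obtain b where b: "\<And>k. coeff b k = f1 ((N ^^ k) x2)" using ex[OF f(1)] by blast
  obtain c where c: "\<And>k. coeff c k = f2 ((N ^^ k) x1)" using ex[OF f(2)] by blast
  obtain d where d: "\<And>k. coeff d k = f2 ((N ^^ k) x2)" using ex[OF f(2)] by blast
  have l1: "Vector_Spaces.linear scale scale (N + U)" "Vector_Spaces.linear scale scale (N - U)"
    using lin by (auto simp: Vector_Spaces.linear_iff algebra_simps)
  have m: "Vector_Spaces.linear scale (*) (\<lambda>x. - f1 x)" "Vector_Spaces.linear scale (*) (\<lambda>x. - f2 x)"
    using f by (auto simp: Vector_Spaces.linear_iff)
  have plus: "a + d = [:0, 1:] * (a * d - b * c)"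
    by (rule rank_two_perturbation_step[OF l1(1) nil(1,2) P _ X(4,5) f _ a b c d])
      (use X diff in \<open>auto simp: algebra_simps\<close>)
  have "- a + - d = [:0, 1:] * ((- a) * (- d) - (- b) * (- c))"
  proof (rule rank_two_perturbation_step[OF l1(2) nil(1,3) P, where X = X and ?f1.0 = "\<lambda>x. - f1 x" and ?f2.0 = "\<lambda>x. - f2 x"])
    fix p assume "p \<in> P"
    from subspace_neg[OF X(1) diff[OF this]]
    show "(N - U) p - (N p + scale (- f1 p) x1 + scale (- f2 p) x2) \<in> X"
      by (simp add: algebra_simps)
  qed (use X m a b c d in auto)
  then have neg: "- (a + d) = [:0, 1:] * (a * d - b * c)" by simp
  then have "(a + d) + (a + d) = 0" using plus by (metis add.left_inverse)
  then have "smult 2 (a + d) = 0"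
    by (metis one_add_one smult_1_left smult_add_left)
  then have s: "a + d = 0" using char by simp
  then have "a * d - b * c = 0" using plus by simp
  with s show ?thesis using that[OF a b c d] by simp
qed

end

section \<open>Symmetric forms and symmetric tensors\<close>

locale sym_form = fd_space scale Basis
  for scale :: "'k::field \<Rightarrow> 'v::ab_group_add \<Rightarrow> 'v" (infixr \<open>*s\<close> 75) and Basis +
  fixes b :: "'v \<Rightarrow> 'v \<Rightarrow> 'k"
  assumes bilinear: "bilinear_form scale b"
    and symmetric: "symmetric_form b"
    and char: "(2::'k) \<noteq> 0"
begin

sublocale E: vec_space "fun_scale scale :: 'k \<Rightarrow> ('v \<Rightarrow> 'v) \<Rightarrow> 'v \<Rightarrow> 'v"
  by (rule vec_space_fun_scale[OF vec_space_axioms])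

sublocale D: vec_space "fun_scale (*) :: 'k \<Rightarrow> ('v \<Rightarrow> 'k) \<Rightarrow> 'v \<Rightarrow> 'k"
  by (rule vec_space_fun_scale[OF vec_space_mult])

lemma pair_EV: "vec_space_pair (fun_scale scale :: 'k \<Rightarrow> ('v \<Rightarrow> 'v) \<Rightarrow> 'v \<Rightarrow> 'v) scale"
  using E.vec_space_axioms vec_space_axioms by (simp add: vec_space_pair_def)

lemma pair_ED: "vec_space_pair (fun_scale scale :: 'k \<Rightarrow> ('v \<Rightarrow> 'v) \<Rightarrow> 'v \<Rightarrow> 'v)
    (fun_scale (*) :: 'k \<Rightarrow> ('v \<Rightarrow> 'k) \<Rightarrow> 'v \<Rightarrow> 'k)"
  using E.vec_space_axioms D.vec_space_axioms by (simp add: vec_space_pair_def)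

lemma pair_VD: "vec_space_pair scale (fun_scale (*) :: 'k \<Rightarrow> ('v \<Rightarrow> 'k) \<Rightarrow> 'v \<Rightarrow> 'k)"
  using vec_space_axioms D.vec_space_axioms by (simp add: vec_space_pair_def)

abbreviation R :: "'v set" where "R \<equiv> Rad b"

abbreviation S :: "('v \<Rightarrow> 'v) set" where "S \<equiv> S_b scale b"

abbreviation lf :: "('v \<Rightarrow> 'k) \<Rightarrow> bool" where "lf \<equiv> Vector_Spaces.linear scale (*)"

abbreviation ts :: "'v set \<Rightarrow> bool" where "ts \<equiv> totally_singular b"

definition perp :: "'v set \<Rightarrow> 'v set" where
  "perp X = {z. \<forall>w\<in>X. b w z = 0}"

lemma form_linear: "lf (b x)" "lf (\<lambda>x. b x y)"
  using bilinear by (auto simp: bilinear_form_def)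

lemma form_add [simp]: "b (x + y) z = b x z + b y z" "b z (x + y) = b z x + b z y"
  using form_linear(1)[of z] form_linear(2)[of z] by (auto simp: Vector_Spaces.linear_iff)

lemma form_scale [simp]: "b (c *s x) z = c * b x z" "b z (c *s x) = c * b z x"
  using form_linear(1)[of z] form_linear(2)[of z] by (auto simp: Vector_Spaces.linear_iff)

lemma form_zero [simp]: "b 0 z = 0" "b z 0 = 0"
  using form_scale(1)[of 0 0 z] form_scale(2)[of z 0 0] by auto

lemma form_minus [simp]: "b (- x) z = - b x z" "b z (- x) = - b z x"
  using form_scale(1)[of "-1" x z] form_scale(2)[of z "-1" x] by auto

lemma form_diff [simp]: "b (x - y) z = b x z - b y z" "b z (x - y) = b z x - b z y"
  using form_add(1)[of x "- y" z] form_add(2)[of z x "- y"] by auto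

lemma form_commute: "b x y = b y x"
  using symmetric by (simp add: symmetric_form_def)

lemma double_eq_zero: "(c::'k) + c = 0 \<Longrightarrow> c = 0"
  using char by (metis mult_2 mult_eq_0_iff)

lemma lfD:
  assumes "lf f"
  shows "f (x + y) = f x + f y" "f (c *s x) = c * f x" "f 0 = 0" "f (x - y) = f x - f y" "f (- x) = - f x"
proof -
  interpret f: Vector_Spaces.linear scale "(*)" f by fact
  show "f (x + y) = f x + f y" "f (c *s x) = c * f x" "f 0 = 0" "f (x - y) = f x - f y" "f (- x) = - f x"
    by (simp_all add: f.add f.scale f.diff f.neg)
qed

lemma lfI: "(\<And>x y. f (x + y) = f x + f y) \<Longrightarrow> (\<And>c x. f (c *s x) = c * f x) \<Longrightarrow> lf f"
  using vector_space_axioms vec_space_mult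
  by (simp add: Vector_Spaces.linear_iff vec_space_def)

lemma annD: "f \<in> ann A \<Longrightarrow> lf f" "f \<in> ann A \<Longrightarrow> a \<in> A \<Longrightarrow> f a = 0"
  by (auto simp: ann_def)

lemma ann_antimono: "A \<subseteq> A' \<Longrightarrow> ann A' \<subseteq> ann A"
  by (auto simp: ann_def)

lemma ann_span: "ann (span A) = ann A"
proof -
  have "f x = 0" if f: "f \<in> ann A" "x \<in> span A" for f x
  proof -
    interpret f: Vector_Spaces.linear scale "(*)" f using annD(1)[OF f(1)] .
    show ?thesis using f.eq_0_on_span[of A x] f annD(2) by blast
  qed
  then show ?thesis using ann_antimono[OF span_superset[of A]] by (auto simp: ann_def)
qed

lemma fin_dim_ann: "D.fin_dim (ann A)"
  using fin_dim_dual by (rule D.fin_dim_subset) (auto simp: ann_def)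

lemma S_linear: "u \<in> S \<Longrightarrow> Vector_Spaces.linear scale scale u"
  by (simp add: S_b_def)

lemma S_add: "u \<in> S \<Longrightarrow> u (x + y) = u x + u y"
  and S_scale: "u \<in> S \<Longrightarrow> u (c *s x) = c *s u x"
  by (auto simp: S_b_def Vector_Spaces.linear_iff)

lemma S_zero: "u \<in> S \<Longrightarrow> u 0 = 0"
  using S_scale[of u 0 0] by simp

lemma S_minus: "u \<in> S \<Longrightarrow> u (- x) = - u x"
  using S_scale[of u "-1" x] by simp

lemma S_diff: "u \<in> S \<Longrightarrow> u (x - y) = u x - u y"
  using S_add[of u x "- y"] by (simp add: S_minus)

lemma S_sym: "u \<in> S \<Longrightarrow> b x (u y) = b (u x) y"
  unfolding S_b_def b_symmetric_def using form_commute by force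

lemma SI:
  assumes "\<And>x y. u (x + y) = u x + u y" "\<And>c x. u (c *s x) = c *s u x" "\<And>x y. b x (u y) = b y (u x)"
  shows "u \<in> S"
  using assms vector_space_axioms by (simp add: S_b_def Vector_Spaces.linear_iff b_symmetric_def)

lemma S_pow_sym: "u \<in> S \<Longrightarrow> b x ((u ^^ k) y) = b ((u ^^ k) x) y"
proof (induction k arbitrary: x)
  case (Suc k)
  have "b x ((u ^^ Suc k) y) = b (u x) ((u ^^ k) y)" using S_sym[OF Suc.prems] by simp
  also have "\<dots> = b ((u ^^ k) (u x)) y" using Suc by blast
  finally show ?case by (simp add: funpow_swap1)
qed simp

lemma S_pow_add: "u \<in> S \<Longrightarrow> (u ^^ k) (x + y) = (u ^^ k) x + (u ^^ k) y"
  and S_pow_scale: "u \<in> S \<Longrightarrow> (u ^^ k) (c *s x) = c *s (u ^^ k) x"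
  using linear_funpow[OF S_linear, of u k] by (auto simp: Vector_Spaces.linear_iff)

lemma S_pow_zero: "u \<in> S \<Longrightarrow> (u ^^ k) 0 = 0"
  using S_pow_scale[of u k 0 0] by simp

lemma subspace_S: "E.subspace S"
proof (rule E.subspaceI)
  show "0 \<in> S" by (rule SI) auto
next
  fix u v assume u: "u \<in> S" and v: "v \<in> S"
  show "u + v \<in> S"
  proof (rule SI)
    fix x y show "b x ((u + v) y) = b y ((u + v) x)"
      using S_sym[OF u, of x y] form_commute[of y "u x"] S_sym[OF v, of x y] form_commute[of y "v x"]
      by simp
  qed (simp_all add: S_add[OF u] S_scale[OF u] S_add[OF v] S_scale[OF v] scale_right_distrib)
next
  fix c u assume u: "u \<in> S"
  show "fun_scale scale c u \<in> S"
  proof (rule SI)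
    fix x y show "b x (fun_scale scale c u y) = b y (fun_scale scale c u x)"
      using S_sym[OF u, of x y] form_commute[of y "u x"] by (simp add: fun_scale_def)
  qed (simp_all add: fun_scale_def S_add[OF u] S_scale[OF u] scale_right_distrib mult.commute)
qed

lemma fin_dim_S: "E.fin_dim A" if "A \<subseteq> S"
  by (rule E.fin_dim_subset[OF fin_dim_endo]) (use that S_linear in blast)

lemma subspace_R: "subspace R"
  by (rule subspaceI) (auto simp: Rad_def)

lemma R_form: "x \<in> R \<Longrightarrow> b x z = 0" "x \<in> R \<Longrightarrow> b z x = 0"
  using form_commute by (auto simp: Rad_def)

lemma R_I: "(\<And>z. b x z = 0) \<Longrightarrow> x \<in> R"
  using form_commute by (auto simp: Rad_def)

lemma S_R: "u \<in> S \<Longrightarrow> x \<in> R \<Longrightarrow> u x \<in> R"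
  by (rule R_I) (simp add: S_sym[symmetric] R_form)

lemma subspace_perp: "subspace (perp X)"
  by (rule subspaceI) (auto simp: perp_def)

lemma perpD: "z \<in> perp X \<Longrightarrow> w \<in> X \<Longrightarrow> b w z = 0" "z \<in> perp X \<Longrightarrow> w \<in> X \<Longrightarrow> b z w = 0"
  using form_commute by (auto simp: perp_def)

lemma R_perp: "R \<subseteq> perp X"
  by (auto simp: perp_def R_form)

lemma ts_perp: "ts X \<Longrightarrow> X \<subseteq> perp X"
  by (auto simp: totally_singular_def perp_def)

lemma perp_antimono: "X \<subseteq> Y \<Longrightarrow> perp Y \<subseteq> perp X"
  by (auto simp: perp_def)

lemma tsD: "ts X \<Longrightarrow> x \<in> X \<Longrightarrow> y \<in> X \<Longrightarrow> b x y = 0"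
  by (auto simp: totally_singular_def)

lemma linear_form_map: "Vector_Spaces.linear scale (fun_scale (*)) b"
  using vector_space_axioms D.vector_space_axioms
  by (auto simp: Vector_Spaces.linear_iff fun_scale_def fun_eq_iff)

text \<open>As a map into the dual, \<open>b\<close> has kernel \<open>R\<close>; by rank-nullity
  its range, contained in \<open>ann R\<close>, has the full dimension of
  \<open>ann R\<close>.\<close>

lemma represent:
  assumes "f \<in> ann R"
  obtains y where "f = b y"
proof -
  interpret VD: vec_space_pair scale "fun_scale (*) :: 'k \<Rightarrow> ('v \<Rightarrow> 'k) \<Rightarrow> 'v \<Rightarrow> 'k" by (rule pair_VD)
  have sub: "range b \<subseteq> ann R" using form_linear by (auto simp: ann_def R_form)
  have "{x \<in> UNIV. b x = 0} = R" by (auto simp: fun_eq_iff R_form intro: R_I)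
  then have "dim UNIV = D.dim (range b) + dim R"
    using VD.rank_nullity[OF linear_form_map subspace_UNIV fin_dim] by simp
  then have "D.dim (ann R) \<le> D.dim (range b)" using dim_ann[OF subspace_R] by simp
  then have "range b = ann R"
    using D.fin_dim_dim_eq[OF VD.linear_subspace_image[OF linear_form_map subspace_UNIV] subspace_ann
        fin_dim_ann sub] by simp
  with assms that show ?thesis by blast
qed

lemma represent_perp:
  assumes "f \<in> ann Y" "R \<subseteq> Y"
  obtains y where "f = b y" "y \<in> perp Y"
proof -
  obtain y where "f = b y" using represent ann_antimono[OF assms(2)] assms(1) by blast
  then show ?thesis using that[of y] annD(2)[OF assms(1)] form_commute by (auto simp: perp_def)
qed

lemma perp_perp:
  assumes "subspace X" "R \<subseteq> X"
  shows "perp (perp X) = X"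
proof (rule antisym)
  show "perp (perp X) \<subseteq> X"
  proof (rule ccontr, clarsimp simp: subset_iff)
    fix x assume x: "x \<in> perp (perp X)" "x \<notin> X"
    obtain f where f: "f \<in> ann X" "f x = 1" using ann_separates[OF assms(1) x(2)] by blast
    obtain y where "f = b y" "y \<in> perp X" using represent_perp[OF f(1) assms(2)] by blast
    then show False using f(2) perpD(1)[OF x(1)] by simp
  qed
  show "X \<subseteq> perp (perp X)" using form_commute by (auto simp: perp_def)
qed

lemma dim_perp:
  assumes "subspace X" "R \<subseteq> X"
  shows "dim (perp X) + dim X = dim UNIV + dim R"
proof -
  interpret VD: vec_space_pair scale "fun_scale (*) :: 'k \<Rightarrow> ('v \<Rightarrow> 'k) \<Rightarrow> 'v \<Rightarrow> 'k" by (rule pair_VD)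
  have "b ` perp X = ann X"
  proof
    show "b ` perp X \<subseteq> ann X" using form_linear by (auto simp: ann_def perpD)
    show "ann X \<subseteq> b ` perp X" using represent_perp assms(2) by blast
  qed
  moreover have "{x \<in> perp X. b x = 0} = R"
    using R_perp by (auto simp: fun_eq_iff R_form intro: R_I)
  ultimately have "dim (perp X) = D.dim (ann X) + dim R"
    using VD.rank_nullity[OF linear_form_map subspace_perp[of X] fin_dim] by simp
  then show ?thesis using dim_ann[OF assms(1)] by simp
qed

section \<open>Symmetric operators killing a subspace\<close>

definition NS :: "'v set \<Rightarrow> ('v \<Rightarrow> 'v) set" where
  "NS X = {u \<in> S. nilpotent_endo u \<and> (\<forall>w\<in>X. u w = 0)}"

text \<open>A symmetric operator killing \<open>X\<close> preserves \<open>perp X\<close>. For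
  totally singular \<open>X\<close>, \<open>ZS X\<close> is the kernel of the induced action on
  \<open>perp X\<close> modulo \<open>X\<close>.\<close>

definition ZS :: "'v set \<Rightarrow> ('v \<Rightarrow> 'v) set" where
  "ZS X = {u \<in> S. (\<forall>w\<in>X. u w = 0) \<and> (\<forall>z\<in>perp X. u z \<in> X)}"

lemma S_kill_range:
  assumes "u \<in> S" "\<And>w. w \<in> X \<Longrightarrow> u w = 0"
  shows "u z \<in> perp X"
  using assms by (auto simp: perp_def S_sym)

lemma NS_D: "u \<in> NS X \<Longrightarrow> u \<in> S" "u \<in> NS X \<Longrightarrow> nilpotent_endo u" "u \<in> NS X \<Longrightarrow> w \<in> X \<Longrightarrow> u w = 0"
  "u \<in> NS X \<Longrightarrow> u z \<in> perp X"
  by (auto simp: NS_def intro: S_kill_range)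

lemma ZS_D: "u \<in> ZS X \<Longrightarrow> u \<in> S" "u \<in> ZS X \<Longrightarrow> w \<in> X \<Longrightarrow> u w = 0"
  "u \<in> ZS X \<Longrightarrow> z \<in> perp X \<Longrightarrow> u z \<in> X" "u \<in> ZS X \<Longrightarrow> u z \<in> perp X"
  by (auto simp: ZS_def intro: S_kill_range)

lemma subspace_ZS: "subspace X \<Longrightarrow> E.subspace (ZS X)"
  using subspace_S unfolding E.subspace_def subspace_def
  by (auto simp: ZS_def fun_scale_def)

text \<open>On \<open>perp X\<close> modulo \<open>X\<close> the operators \<open>u\<close> and
  \<open>u + t\<close> agree, and therefore so do their powers.\<close>

lemma NS_add_ZS:
  assumes X: "subspace X" and u: "u \<in> NS X" and t: "t \<in> ZS X"
  shows "u + t \<in> NS X"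
proof -
  define v where "v = u + t"
  have v: "v z = u z + t z" for z by (simp add: v_def)
  have S: "v \<in> S"
    unfolding v_def using E.subspace_add[OF subspace_S NS_D(1)[OF u] ZS_D(1)[OF t]] .
  have kill: "v w = 0" if "w \<in> X" for w
    using that NS_D(3)[OF u] ZS_D(2)[OF t] by (simp add: v)
  obtain K where K: "\<And>k x. K \<le> k \<Longrightarrow> (u ^^ k) x = 0"
    using nilpotent_endo_funpow[OF NS_D(2)[OF u]] by blast
  have pow: "(u ^^ k) z \<in> perp X" if "z \<in> perp X" for k z
    using that NS_D(4)[OF u] by (cases k) auto
  have mod: "(v ^^ k) z - (u ^^ k) z \<in> X" if z: "z \<in> perp X" for k z
  proof (induction k)
    case 0
    then show ?case using subspace_0[OF X] by simp
  next
    case (Suc k)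
    define w where "w = (v ^^ k) z - (u ^^ k) z"
    have w: "w \<in> X" using Suc by (simp add: w_def)
    have "(v ^^ k) z = (u ^^ k) z + w" by (simp add: w_def)
    then have "(v ^^ Suc k) z = v ((u ^^ k) z) + v w"
      using S_add[OF S] by simp
    then have "(v ^^ Suc k) z - (u ^^ Suc k) z = t ((u ^^ k) z)"
      using kill[OF w] by (simp add: v)
    then show ?case using ZS_D(3)[OF t pow[OF z]] by simp
  qed
  \<comment> \<open>One application leads into \<open>perp X\<close>, the next \<open>K\<close> into
    \<open>X\<close>, and the last one kills \<open>X\<close>.\<close>
  have "(v ^^ (K + 2)) z = 0" for z
  proof -
    have p: "v z \<in> perp X" by (rule S_kill_range[OF S kill])
    have "(v ^^ K) (v z) \<in> X" using mod[OF p, of K] K[of K] by simp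
    then have "v ((v ^^ K) (v z)) = 0" by (rule kill)
    then show ?thesis by (simp add: funpow_swap1)
  qed
  then have "nilpotent_endo v" unfolding nilpotent_endo_def by (intro exI[of _ "K + 2"]) (auto simp: fun_eq_iff)
  then show ?thesis using S kill unfolding v_def by (simp add: NS_def)
qed

lemma ZS_subset_NS:
  assumes "subspace X"
  shows "ZS X \<subseteq> NS X"
proof
  fix t assume t: "t \<in> ZS X"
  have "(0::'v \<Rightarrow> 'v) \<in> NS X"
    using E.subspace_0[OF subspace_S] by (auto simp: NS_def nilpotent_endo_def fun_eq_iff intro!: exI[of _ 1])
  from NS_add_ZS[OF assms this t] show "t \<in> NS X" by simp
qed

text \<open>The operator attached to a vector and a functional. For a non-degenerate form it is the
  symmetrised tensor \<open>x \<otimes> y + y \<otimes> x\<close> with \<open>f = b y\<close>; for \<open>x\<close> in the radical the second term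
  vanishes, so no representing vector is needed.\<close>

definition is_T :: "'v \<Rightarrow> ('v \<Rightarrow> 'k) \<Rightarrow> ('v \<Rightarrow> 'v) \<Rightarrow> bool" where
  "is_T x f T \<longleftrightarrow> (\<exists>y. (\<forall>z. T z = f z *s x + b x z *s y) \<and> (x \<in> R \<or> f = b y))"

lemma is_T_S:
  assumes "is_T x f T" "lf f"
  shows "T \<in> S"
proof -
  obtain y where y: "\<And>z. T z = f z *s x + b x z *s y" "x \<in> R \<or> f = b y"
    using assms(1) by (auto simp: is_T_def)
  show ?thesis
  proof (rule SI)
    fix p q
    show "b p (T q) = b q (T p)"
      using y(2) by (auto simp: y(1) R_form form_commute[of p] form_commute[of q])
  qed (auto simp: y(1) lfD[OF assms(2)] algebra_simps)
qed

lemma is_T_apply: "is_T x f T \<Longrightarrow> b x z = 0 \<Longrightarrow> T z = f z *s x"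
  by (auto simp: is_T_def)

lemma is_T_add:
  assumes "is_T x f T" "is_T x g T'"
  shows "is_T x (f + g) (T + T')"
proof -
  obtain y where y: "\<And>z. T z = f z *s x + b x z *s y" "x \<in> R \<or> f = b y"
    using assms(1) by (auto simp: is_T_def)
  obtain y' where y': "\<And>z. T' z = g z *s x + b x z *s y'" "x \<in> R \<or> g = b y'"
    using assms(2) by (auto simp: is_T_def)
  show ?thesis
    unfolding is_T_def
    by (rule exI[of _ "y + y'"]) (use y y' in \<open>auto simp: algebra_simps\<close>)
qed

lemma is_T_scale:
  assumes "is_T x f T"
  shows "is_T x (fun_scale (*) c f) (fun_scale scale c T)"
proof -
  obtain y where y: "\<And>z. T z = f z *s x + b x z *s y" "x \<in> R \<or> f = b y"
    using assms(1) by (auto simp: is_T_def)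
  show ?thesis
    unfolding is_T_def
    by (rule exI[of _ "c *s y"]) (use y in \<open>auto simp: fun_scale_def algebra_simps\<close>)
qed

text \<open>Comparability with \<open>R\<close> guarantees tensors of \<open>w\<close> in
  \<open>X\<close> with \<open>f\<close> in \<open>ann X\<close>: either \<open>w\<close> is a
  radical vector, or \<open>f\<close> vanishes on \<open>R\<close> and is represented by the
  form.\<close>

definition adm :: "'v set \<Rightarrow> bool" where
  "adm X \<longleftrightarrow> subspace X \<and> ts X \<and> (X \<subseteq> R \<or> R \<subseteq> X)"

lemma adm_D: "adm X \<Longrightarrow> subspace X" "adm X \<Longrightarrow> ts X" "adm X \<Longrightarrow> X \<subseteq> R \<or> R \<subseteq> X"
  by (auto simp: adm_def)

lemma is_T_ex:
  assumes "adm Y" "w \<in> Y" "f \<in> ann Y"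
  obtains T where "is_T w f T"
proof (cases "w \<in> R")
  case True
  then show ?thesis using that[of "\<lambda>z. f z *s w"] by (auto simp: is_T_def R_form)
next
  case False
  then have "R \<subseteq> Y" using assms adm_D(3) by blast
  then obtain y where "f = b y" using represent_perp[OF assms(3)] by blast
  then show ?thesis using that[of "\<lambda>z. f z *s w + b w z *s y"] by (auto simp: is_T_def)
qed

lemma is_T_ZS:
  assumes "adm Y" "w \<in> Y" "f \<in> ann Y" "is_T w f T"
  shows "T \<in> ZS Y"
proof -
  have "T z = 0" if "z \<in> Y" for z
    using is_T_apply[OF assms(4)] tsD[OF adm_D(2)[OF assms(1)] assms(2)] that annD(2)[OF assms(3)] by simp
  moreover have "T z \<in> Y" if "z \<in> perp Y" for z
    using is_T_apply[OF assms(4)] perpD(1)[OF that assms(2)] subspace_scale[OF adm_D(1)] assms(1,2) by simp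
  ultimately show ?thesis using is_T_S[OF assms(4) annD(1)[OF assms(3)]] by (simp add: ZS_def)
qed

text \<open>For nonradical \<open>x\<close> the vector \<open>y\<close> is only determined up to
  \<open>R\<close>, so \<open>f\<close> does not determine \<open>T\<close>. Recovering
  \<open>f\<close> linearly from \<open>T\<close> is enough for comparing dimensions.\<close>

lemma is_T_linear_retract:
  assumes x: "x \<noteq> 0"
  obtains \<phi> where "Vector_Spaces.linear (fun_scale scale) (fun_scale (*)) \<phi>"
    "\<And>f T. is_T x f T \<Longrightarrow> \<phi> T = f"
proof -
  have "\<exists>\<phi>. Vector_Spaces.linear (fun_scale scale) (fun_scale (*)) \<phi> \<and> (\<forall>f T. is_T x f T \<longrightarrow> \<phi> T = f)"
  proof (cases "x \<in> R")
    case True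
    obtain h where h: "h \<in> ann {0}" "h x = 1" using ann_separates[of "{0}" x] x by auto
    note lh = lfD[OF annD(1)[OF h(1)]]
    let ?p = "\<lambda>(T :: 'v \<Rightarrow> 'v) z. h (T z)"
    have "Vector_Spaces.linear (fun_scale scale) (fun_scale (*)) ?p"
      using E.vector_space_axioms D.vector_space_axioms
      by (auto simp: Vector_Spaces.linear_iff fun_scale_def lh fun_eq_iff)
    moreover have "?p T = f" if "is_T x f T" for f T
      using is_T_apply[OF that] R_form(1)[OF True] lh h(2) by (auto simp: fun_eq_iff)
    ultimately show ?thesis by blast
  next
    case False
    then obtain x' where "b x x' \<noteq> 0" using R_I by blast
    then have "b x (inverse (b x x') *s x') = 1" by simp
    then obtain e where e: "b x e = 1" by blast
    \<comment> \<open>For \<open>T = x \<otimes> y + y \<otimes> x\<close> the vector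
      \<open>T e\<close> is \<open>y\<close> plus \<open>b y e\<close> times \<open>x\<close>, and
      \<open>b e (T e)\<close> is twice \<open>b y e\<close>; the subtraction leaves
      \<open>y\<close>.\<close>
    let ?p = "\<lambda>T. b (T e - (b e (T e) / 2) *s x)"
    have "Vector_Spaces.linear (fun_scale scale) (fun_scale (*)) ?p"
      using E.vector_space_axioms D.vector_space_axioms
      by (auto simp: Vector_Spaces.linear_iff fun_scale_def fun_eq_iff add_divide_distrib algebra_simps)
    moreover have "?p T = f" if T: "is_T x f T" for f T
    proof -
      obtain y where y: "\<And>z. T z = f z *s x + b x z *s y" "f = b y"
        using T False unfolding is_T_def by blast
      have "T e = b y e *s x + y" using y e by simp
      moreover have "b e (T e) = b y e + b y e"
        using calculation e by (simp add: form_commute)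
      ultimately have "T e - (b e (T e) / 2) *s x = y"
        using char by (simp flip: mult_2)
      then show ?thesis using y by simp
    qed
    ultimately show ?thesis by blast
  qed
  then show ?thesis using that by blast
qed


section \<open>Enlarging the totally singular subspace by one vector\<close>

text \<open>
  A \<open>level\<close> models a space of nilpotent symmetric operators on the quotient of \<open>perp X\<close> by \<open>X\<close>, and \<open>nxt\<close>
  the passage to the quotient by one further isotropic vector. The last condition in \<open>cand\<close> forces the
  radical to be exhausted first.
\<close>

definition level :: "'v set \<Rightarrow> ('v \<Rightarrow> 'v) set \<Rightarrow> bool" where
  "level X V \<longleftrightarrow> adm X \<and> E.subspace V \<and> ZS X \<subseteq> V \<and> V \<subseteq> NS X"

definition cand :: "'v set \<Rightarrow> 'v \<Rightarrow> bool" where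
  "cand X x \<longleftrightarrow> x \<in> perp X \<and> x \<notin> X \<and> b x x = 0 \<and> (R \<subseteq> X \<or> x \<in> R)"

definition ext :: "'v set \<Rightarrow> 'v \<Rightarrow> 'v set" where
  "ext X x = span (insert x X)"

definition stab :: "('v \<Rightarrow> 'v) set \<Rightarrow> 'v \<Rightarrow> ('v \<Rightarrow> 'v) set" where
  "stab V x = {u \<in> V. u x = 0}"

definition orb :: "('v \<Rightarrow> 'v) set \<Rightarrow> 'v \<Rightarrow> 'v set" where
  "orb V x = (\<lambda>u. u x) ` V"

definition reach :: "('v \<Rightarrow> 'v) set \<Rightarrow> 'v \<Rightarrow> 'v set" where
  "reach V x = span (insert x (orb V x))"

definition nxt :: "'v set \<Rightarrow> ('v \<Rightarrow> 'v) set \<Rightarrow> 'v \<Rightarrow> ('v \<Rightarrow> 'v) set" where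
  "nxt X V x = {u + t |u t. u \<in> stab V x \<and> t \<in> ZS (ext X x)}"

text \<open>Tensors with \<open>x\<close> are recorded by their functionals so that they can be
  compared with \<open>ann (reach V x)\<close> inside the dual space.\<close>

definition tens :: "'v set \<Rightarrow> ('v \<Rightarrow> 'v) set \<Rightarrow> 'v \<Rightarrow> ('v \<Rightarrow> 'k) set" where
  "tens X V x = {f \<in> ann (ext X x). \<exists>T\<in>V. is_T x f T}"

lemma span_id: "subspace Y \<Longrightarrow> span Y = Y"
  by (rule span_subspace) (auto intro: span_base)

lemma levelD:
  assumes "level X V"
  shows "adm X" "E.subspace V" "ZS X \<subseteq> V" "V \<subseteq> NS X" "subspace X" "ts X" "V \<subseteq> S"
  using assms adm_D NS_D(1) by (auto simp: level_def)

lemma level_apply: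
  assumes "level X V" "u \<in> V"
  shows "u \<in> S" "nilpotent_endo u" "w \<in> X \<Longrightarrow> u w = 0" "u z \<in> perp X"
  using assms NS_D levelD(4)[OF assms(1)] by blast+

lemma candD:
  assumes "cand X x"
  shows "x \<in> perp X" "x \<notin> X" "b x x = 0" "R \<subseteq> X \<or> x \<in> R"
  using assms by (auto simp: cand_def)

lemma cand_nonzero: "subspace X \<Longrightarrow> cand X x \<Longrightarrow> x \<noteq> 0"
  using candD(2) subspace_0 by blast

lemma subspace_ext: "subspace (ext X x)"
  by (simp add: ext_def)

lemma ext_superset: "X \<subseteq> ext X x" "x \<in> ext X x"
  using span_superset[of "insert x X"] by (auto simp: ext_def)

lemma ext_mem: "subspace X \<Longrightarrow> p \<in> ext X x \<longleftrightarrow> (\<exists>c. p - c *s x \<in> X)"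
  by (simp add: ext_def span_breakdown_eq span_id)

lemma ext_least: "subspace Y \<Longrightarrow> X \<subseteq> Y \<Longrightarrow> x \<in> Y \<Longrightarrow> ext X x \<subseteq> Y"
  unfolding ext_def by (rule span_minimal) auto

lemma ext_elim:
  assumes "subspace X" "p \<in> ext X x"
  obtains c w where "p = c *s x + w" "w \<in> X"
proof -
  obtain c where "p - c *s x \<in> X" using assms ext_mem by blast
  then show ?thesis using that[of c "p - c *s x"] by simp
qed

lemma dim_ext:
  assumes "subspace X" "x \<notin> X"
  shows "dim (ext X x) = Suc (dim X)"
  using assms by (simp add: ext_def dim_insert span_id)

lemma adm_ext:
  assumes X: "adm X" and x: "cand X x"
  shows "adm (ext X x)"
proof -
  have "b p q = 0" if pq: "p \<in> ext X x" "q \<in> ext X x" for p q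
  proof -
    obtain c w where p: "p = c *s x + w" "w \<in> X" using ext_elim[OF adm_D(1)[OF X] pq(1)] .
    obtain d v where q: "q = d *s x + v" "v \<in> X" using ext_elim[OF adm_D(1)[OF X] pq(2)] .
    show ?thesis
      using p q candD(3)[OF x] perpD[OF candD(1)[OF x]] tsD[OF adm_D(2)[OF X]] by simp
  qed
  moreover have "ext X x \<subseteq> R \<or> R \<subseteq> ext X x"
    using adm_D(3)[OF X] candD(4)[OF x] ext_least[OF subspace_R, of X x] ext_superset(1)[of X x] by blast
  ultimately show ?thesis using subspace_ext by (auto simp: adm_def totally_singular_def)
qed

lemma S_kill_ext:
  assumes "u \<in> S" "\<And>w. w \<in> X \<Longrightarrow> u w = 0" "u x = 0" "subspace X" "p \<in> ext X x"
  shows "u p = 0"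
proof -
  obtain c w where "p = c *s x + w" "w \<in> X" using ext_elim[OF assms(4,5)] .
  then show ?thesis using assms(1-3) by (simp add: S_add S_scale)
qed

lemma linear_eval: "Vector_Spaces.linear (fun_scale scale) scale (\<lambda>u. u (x::'v))"
  using E.vector_space_axioms vector_space_axioms
  by (auto simp: Vector_Spaces.linear_iff fun_scale_def)

lemma subspace_stab: "E.subspace V \<Longrightarrow> E.subspace (stab V x)"
  by (auto simp: E.subspace_def stab_def fun_scale_def)

lemma subspace_orb:
  assumes "E.subspace V"
  shows "subspace (orb V x)"
proof -
  interpret EV: vec_space_pair "fun_scale scale :: 'k \<Rightarrow> ('v \<Rightarrow> 'v) \<Rightarrow> 'v \<Rightarrow> 'v" scale by (rule pair_EV)
  show ?thesis unfolding orb_def using EV.linear_subspace_image[OF linear_eval assms] .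
qed

lemma dim_orb_stab:
  assumes "E.subspace V" "V \<subseteq> S"
  shows "E.dim V = dim (orb V x) + E.dim (stab V x)"
proof -
  interpret EV: vec_space_pair "fun_scale scale :: 'k \<Rightarrow> ('v \<Rightarrow> 'v) \<Rightarrow> 'v \<Rightarrow> 'v" scale by (rule pair_EV)
  show ?thesis
    using EV.rank_nullity[OF linear_eval assms(1) fin_dim_S[OF assms(2)], of x]
    by (simp add: orb_def stab_def)
qed

lemma subspace_reach: "subspace (reach V x)"
  by (simp add: reach_def)

lemma reach_mem: "E.subspace V \<Longrightarrow> p \<in> reach V x \<longleftrightarrow> (\<exists>c. \<exists>u\<in>V. p = c *s x + u x)"
proof -
  assume V: "E.subspace V"
  have "p \<in> reach V x \<longleftrightarrow> (\<exists>c. p - c *s x \<in> orb V x)"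
    using subspace_orb[OF V, of x] by (simp add: reach_def span_breakdown_eq span_id)
  also have "\<dots> \<longleftrightarrow> (\<exists>c. \<exists>u\<in>V. p = c *s x + u x)"
    by (auto simp: orb_def image_iff algebra_simps)
  finally show ?thesis .
qed

lemma reach_superset: "x \<in> reach V x" "u \<in> V \<Longrightarrow> u x \<in> reach V x"
  using span_superset[of "insert x (orb V x)"] by (auto simp: reach_def orb_def)

text \<open>Since \<open>u\<close> kills \<open>w\<close>, the vector \<open>c *s x + w\<close> is
  multiplied by \<open>c\<close> under \<open>u\<close>. For nonzero \<open>c\<close> nilpotency
  would make it zero and put \<open>x\<close> into \<open>X\<close>.\<close>

lemma nilpotent_eigen:
  assumes u: "u \<in> NS X" and w: "w \<in> X" and eq: "u x = c *s x + w" and x: "x \<notin> X" "subspace X"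
  shows "c = 0"
proof (rule ccontr)
  assume c: "c \<noteq> 0"
  have S: "u \<in> S" using NS_D(1)[OF u] .
  have step: "u (c *s x + w) = c *s (c *s x + w)"
    using NS_D(3)[OF u w] by (simp add: S_add[OF S] S_scale[OF S] eq)
  have pow: "(u ^^ k) (c *s x + w) = (c ^ k) *s (c *s x + w)" for k
    by (induction k) (simp_all add: S_scale[OF S] step mult.commute)
  obtain K where "(u ^^ K) (c *s x + w) = 0"
    using nilpotent_endo_funpow[OF NS_D(2)[OF u]] by blast
  then have "c *s x + w = 0" using pow c by simp
  then have "c *s x = - w" by (simp add: eq_neg_iff_add_eq_0)
  then have "c *s x \<in> X" using subspace_neg[OF x(2) w] by simp
  then have "inverse c *s (c *s x) \<in> X" by (rule subspace_scale[OF x(2)])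
  then show False using c x by simp
qed

lemma orb_avoid:
  assumes "level X V" "x \<notin> X"
  shows "x \<notin> orb V x"
proof
  assume "x \<in> orb V x"
  then obtain u where "u \<in> V" "u x = x" by (auto simp: orb_def)
  then have "(1::'k) = 0"
    using nilpotent_eigen[of u X 0 x 1] levelD[OF assms(1)] assms(2) subspace_0 by auto
  then show False by simp
qed

lemma dim_reach:
  assumes "level X V" "x \<notin> X"
  shows "dim (reach V x) = Suc (dim (orb V x))"
  using orb_avoid[OF assms] subspace_orb[OF levelD(2)[OF assms(1)], of x]
  by (simp add: reach_def dim_insert span_id)

text \<open>The tensor of \<open>w\<close> with a functional that is 1 at \<open>x\<close> does it.
  Subtracting such a \<open>t\<close> turns an operator sending \<open>x\<close> into
  \<open>X\<close> into one killing \<open>x\<close>.\<close>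

lemma ZS_reach:
  assumes X: "adm X" and x: "x \<in> perp X" "x \<notin> X" and w: "w \<in> X"
  obtains t where "t \<in> ZS X" "t x = w"
proof -
  obtain f where f: "f \<in> ann X" "f x = 1" using ann_separates[OF adm_D(1)[OF X] x(2)] .
  obtain T where T: "is_T w f T" using is_T_ex[OF X w f(1)] .
  have "T x = w" using is_T_apply[OF T] perpD(1)[OF x(1) w] f(2) by simp
  with is_T_ZS[OF X w f(1) T] that show ?thesis by blast
qed

lemma orb_superset:
  assumes "level X V" "x \<in> perp X" "x \<notin> X"
  shows "X \<subseteq> orb V x"
proof
  fix w assume "w \<in> X"
  then obtain t where "t \<in> ZS X" "t x = w" using ZS_reach[OF levelD(1)[OF assms(1)] assms(2,3)] by blast
  then show "w \<in> orb V x" using levelD(3)[OF assms(1)] by (auto simp: orb_def)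
qed

lemma ext_subset_reach:
  assumes "level X V" "x \<in> perp X" "x \<notin> X"
  shows "ext X x \<subseteq> reach V x"
  using orb_superset[OF assms] span_superset[of "insert x (orb V x)"]
  by (intro ext_least[OF subspace_reach]) (auto simp: reach_def)

text \<open>Perturb \<open>v\<close> by \<open>T\<close> on the whole space. The diagonal entries
  have coefficients \<open>f ((v ^^ k) x)\<close> and \<open>b x ((v ^^ k) y)\<close>; for
  nonradical \<open>x\<close> they agree by symmetry, for radical \<open>x\<close> the second is
  zero, so trace zero kills the first. The determinant identity then makes the product of the
  off-diagonal entries zero, and one of these polynomials vanishes.\<close>

lemma tensor_annihilates:
  assumes V: "level X V" and T: "T \<in> V" "is_T x f T" and f: "lf f" and v: "v \<in> V"
  shows "f ((v ^^ k) x) = 0"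
    and "f = b y \<Longrightarrow> x \<notin> R \<Longrightarrow> (\<forall>k. b x ((v ^^ k) x) = 0) \<or> (\<forall>k. b y ((v ^^ k) y) = 0)"
proof -
  have S: "v \<in> S" "T \<in> S" using level_apply(1)[OF V] T v by auto
  obtain y0 where y: "\<And>z. T z = f z *s x + b x z *s y0" "x \<in> R \<or> f = b y0"
    using T(2) unfolding is_T_def by blast
  have nil: "nilpotent_endo v" "nilpotent_endo (v + T)" "nilpotent_endo (v - T)"
    using level_apply(2)[OF V] v E.subspace_add[OF levelD(2)[OF V] v T(1)]
      E.subspace_diff[OF levelD(2)[OF V] v T(1)] by auto
  obtain p q r s where pqrs: "\<And>k. coeff p k = f ((v ^^ k) x)" "\<And>k. coeff q k = f ((v ^^ k) y0)"
      "\<And>k. coeff r k = b x ((v ^^ k) x)" "\<And>k. coeff s k = b x ((v ^^ k) y0)"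
      "p + s = 0" "p * s = q * r"
    by (rule rank_two_perturbation[OF char S_linear[OF S(1)] S_linear[OF S(2)] nil,
          where P = UNIV and X = "{0}" and ?f1.0 = f and ?f2.0 = "b x" and ?x1.0 = x and ?x2.0 = y0])
      (auto simp: y(1) S_zero[OF S(1)] S_zero[OF S(2)] lfD[OF f] f form_linear)
  have p0: "p = 0"
  proof (cases "x \<in> R")
    case True
    then have "s = 0" using pqrs(4) by (intro poly_eqI) (simp add: R_form)
    then show ?thesis using pqrs(5) by simp
  next
    case False
    then have "f = b y0" using y(2) by blast
    then have "p = s"
      using pqrs(1,4) by (intro poly_eqI) (simp add: S_pow_sym[OF S(1), of x] form_commute)
    then have "coeff p k + coeff p k = 0" for k using pqrs(5) by (metis coeff_0 coeff_add)
    then have "coeff p k = 0" for k by (rule double_eq_zero)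
    then show ?thesis by (intro poly_eqI) simp
  qed
  then show "f ((v ^^ k) x) = 0" using pqrs(1)[of k] by simp
  assume fy: "f = b y" and xR: "x \<notin> R"
  have byy: "b y = b y0" using fy y(2) xR by simp
  have "q * r = 0" using pqrs(6) p0 by simp
  then have "q = 0 \<or> r = 0" by simp
  then show "(\<forall>k. b x ((v ^^ k) x) = 0) \<or> (\<forall>k. b y ((v ^^ k) y) = 0)"
  proof
    assume "q = 0"
    then have "b y0 ((v ^^ k) y0) = 0" for k using pqrs(2)[of k] fy byy by simp
    moreover have "b y ((v ^^ k) y) = b y0 ((v ^^ k) y0)" for k
      using byy S_pow_sym[OF S(1), of _ k] form_commute by metis
    ultimately show ?thesis by simp
  next
    assume "r = 0"
    then show ?thesis using pqrs(3) by (metis coeff_0)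
  qed
qed

lemma tens_subset:
  assumes "level X V"
  shows "tens X V x \<subseteq> ann (reach V x)"
proof
  fix f assume "f \<in> tens X V x"
  then obtain T where f: "f \<in> ann (ext X x)" "T \<in> V" "is_T x f T" by (auto simp: tens_def)
  have "f x = 0" using annD(2)[OF f(1)] ext_superset(2) by blast
  moreover have "f (u x) = 0" if "u \<in> V" for u
    using tensor_annihilates(1)[OF assms f(2,3) annD(1)[OF f(1)] that, of 1] by simp
  ultimately have "f \<in> ann (insert x (orb V x))" using annD(1)[OF f(1)] by (auto simp: ann_def orb_def)
  then show "f \<in> ann (reach V x)" by (simp add: reach_def ann_span)
qed

text \<open>Modulo \<open>X\<close>, \<open>t\<close> maps \<open>perp (ext X x)\<close> into the
  line of \<open>x\<close>, and a tensor with \<open>x\<close> cancels this. For nonradical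
  \<open>x\<close> one direction \<open>e\<close> of \<open>perp X\<close> remains, which a multiple
  of \<open>x \<otimes> x\<close> corrects.\<close>

lemma ZS_ext_decompose:
  assumes X: "adm X" and x: "cand X x" and t: "t \<in> ZS (ext X x)"
  obtains f T where "f \<in> ann (ext X x)" "is_T x f T" "t - T \<in> ZS X" "(t - T) x = 0"
proof -
  note witness = that
  note sX = adm_D(1)[OF X] and aX = adm_ext[OF X x]
  note xx = ext_superset(2)[of x X]
  obtain h where h: "h \<in> ann X" "h x = 1" using ann_separates[OF sX candD(2)[OF x]] .
  note lh = lfD[OF annD(1)[OF h(1)]]
  have S: "t \<in> S" using ZS_D(1)[OF t] .
  have ext_h: "p - h p *s x \<in> X" if p0: "p \<in> ext X x" for p
  proof -
    obtain c w where p: "p = c *s x + w" "w \<in> X" using ext_elim[OF sX p0] .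
    then have "h p = c" using lh h annD(2)[OF h(1)] by simp
    then show ?thesis using p by simp
  qed
  \<comment> \<open>On \<open>ext X x\<close> the functional \<open>h\<close> reads off the
    coefficient of \<open>x\<close> modulo \<open>X\<close>.\<close>
  define f0 where "f0 = (\<lambda>z. h (t z))"
  have f0: "f0 \<in> ann (ext X x)"
    using lh ZS_D(2)[OF t] by (auto simp: ann_def f0_def S_add[OF S] S_scale[OF S] intro!: lfI)
  obtain T0 where T0: "is_T x f0 T0" using is_T_ex[OF aX xx f0] .
  have ZT: "T \<in> ZS (ext X x)" if "f \<in> ann (ext X x)" "is_T x f T" for f T
    using is_T_ZS[OF aX xx that] .
  have s0: "t z - T0 z \<in> X" if "z \<in> perp (ext X x)" for z
    using ext_h[OF ZS_D(3)[OF t that]] is_T_apply[OF T0 perpD(1)[OF that xx]] by (simp add: f0_def)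
  have main: ?thesis if f: "f \<in> ann (ext X x)" "is_T x f T" "\<And>z. z \<in> perp X \<Longrightarrow> t z - T z \<in> X" for f T
  proof -
    have "t - T \<in> S" using E.subspace_diff[OF subspace_S S ZS_D(1)[OF ZT[OF f(1,2)]]] .
    moreover have "(t - T) w = 0" if "w \<in> ext X x" for w
      using ZS_D(2)[OF t that] ZS_D(2)[OF ZT[OF f(1,2)] that] by simp
    ultimately have "t - T \<in> ZS X" "(t - T) x = 0"
      using f(3) ext_superset(1)[of X x] ext_superset(2)[of x X] by (auto simp: ZS_def)
    then show ?thesis using witness f by blast
  qed
  show ?thesis
  proof (cases "x \<in> R")
    case True
    have "z \<in> perp (ext X x)" if "z \<in> perp X" for z
    proof -
      have "b p z = 0" if p: "p \<in> ext X x" for p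
      proof -
        obtain c w where "p = c *s x + w" "w \<in> X" using ext_elim[OF sX p] .
        then show ?thesis using R_form(1)[OF True] perpD(1)[OF \<open>z \<in> perp X\<close>] by simp
      qed
      then show ?thesis by (simp add: perp_def)
    qed
    then show ?thesis using main[OF f0 T0] s0 by blast
  next
    case False
    then have RX: "R \<subseteq> X" using candD(4)[OF x] by blast
    have "x \<notin> perp (perp X)" using perp_perp[OF sX RX] candD(2)[OF x] by simp
    then obtain e0 where e0: "e0 \<in> perp X" "b e0 x \<noteq> 0" by (auto simp: perp_def)
    define e where "e = inverse (b e0 x) *s e0"
    have e: "e \<in> perp X" "b x e = 1"
      using e0 subspace_scale[OF subspace_perp] form_commute[of x e0] by (auto simp: e_def)
    define s where "s = t - T0"
    have sZ: "s \<in> S" unfolding s_def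
      using E.subspace_diff[OF subspace_S S ZS_D(1)[OF ZT[OF f0 T0]]] .
    have sk: "s w = 0" if "w \<in> ext X x" for w
      using ZS_D(2)[OF t that] ZS_D(2)[OF ZT[OF f0 T0] that] by (simp add: s_def)
    have "s e \<in> perp (perp (ext X x))"
    proof -
      have "b z (s e) = 0" if "z \<in> perp (ext X x)" for z
      proof -
        have "s z \<in> X" using s0[OF that] by (simp add: s_def)
        then show ?thesis using S_sym[OF sZ, of z e] perpD(1)[OF e(1)] by simp
      qed
      then show ?thesis by (simp add: perp_def)
    qed
    then have "s e \<in> ext X x" using perp_perp[OF subspace_ext] RX ext_superset(1)[of X x] by blast
    then obtain c w where cw: "s e = c *s x + w" "w \<in> X" using ext_elim[OF sX] by blast
    \<comment> \<open>The error left is \<open>c * b x z\<close> times \<open>x\<close>. In the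
      symmetrised tensor of \<open>x\<close> with \<open>k *s x\<close> the two terms coincide,
      hence the half.\<close>
    define k where "k = c / 2"
    have half: "c = k + k" using char by (simp add: k_def flip: mult_2)
    define f1 where "f1 = fun_scale (*) k (b x)"
    have "b x \<in> ann (ext X x)"
      using form_linear tsD[OF adm_D(2)[OF aX] xx] by (simp add: ann_def)
    then have f1: "f1 \<in> ann (ext X x)" unfolding f1_def by (rule D.subspace_scale[OF subspace_ann])
    define T1 where "T1 = (\<lambda>z. (c * b x z) *s x)"
    have "T1 z = (k * b x z) *s x + (k * b x z) *s x" for z
      unfolding T1_def half by (simp only: distrib_right scale_left_distrib)
    then have "T1 z = f1 z *s x + b x z *s (k *s x)" for z
      by (simp add: f1_def fun_scale_def mult.commute)
    moreover have "f1 = b (k *s x)" by (auto simp: f1_def fun_scale_def)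
    ultimately have T1: "is_T x f1 T1" unfolding is_T_def by (intro exI[of _ "k *s x"]) simp
    have "t z - (T0 + T1) z \<in> X" if z: "z \<in> perp X" for z
    proof -
      define z' where "z' = z - b x z *s e"
      have z': "z' \<in> perp X" "b x z' = 0"
        using z e subspace_diff[OF subspace_perp] subspace_scale[OF subspace_perp] by (auto simp: z'_def)
      have "b p z' = 0" if p: "p \<in> ext X x" for p
      proof -
        obtain c w where "p = c *s x + w" "w \<in> X" using ext_elim[OF sX p] .
        then show ?thesis using z'(2) perpD(1)[OF z'(1)] by simp
      qed
      then have z'': "z' \<in> perp (ext X x)" by (simp add: perp_def)
      have "z = z' + b x z *s e" by (simp add: z'_def)
      then have "s z = s z' + b x z *s s e" by (metis S_add[OF sZ] S_scale[OF sZ])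
      then have "s z - T1 z = s z' + b x z *s w"
        using cw by (simp add: T1_def algebra_simps)
      moreover have "s z' \<in> X" using s0[OF z''] by (simp add: s_def)
      ultimately have "s z - T1 z \<in> X"
        using subspace_add[OF sX] subspace_scale[OF sX cw(2)] by simp
      then show ?thesis by (simp add: s_def algebra_simps)
    qed
    then show ?thesis using main[OF _ is_T_add[OF T0 T1]] D.subspace_add[OF subspace_ann f0 f1] by blast
  qed
qed

lemma stab_NS_ext:
  assumes "level X V" "u \<in> stab V x"
  shows "u \<in> NS (ext X x)"
proof -
  have u: "u \<in> V" "u x = 0" using assms(2) by (auto simp: stab_def)
  show ?thesis
    using level_apply[OF assms(1) u(1)] S_kill_ext[OF level_apply(1)[OF assms(1) u(1)] _ u(2) levelD(5)[OF assms(1)]]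
    by (auto simp: NS_def)
qed

lemma level_nxt:
  assumes V: "level X V" and x: "cand X x"
  shows "level (ext X x) (nxt X V x)"
proof -
  have "E.subspace (nxt X V x)"
    unfolding nxt_def
    by (rule E.subspace_sums[OF subspace_stab[OF levelD(2)[OF V]] subspace_ZS[OF subspace_ext]])
  moreover have "ZS (ext X x) \<subseteq> nxt X V x"
    using E.subspace_0[OF subspace_stab[OF levelD(2)[OF V], of x]] unfolding nxt_def by force
  moreover have "nxt X V x \<subseteq> NS (ext X x)"
    using NS_add_ZS[OF subspace_ext stab_NS_ext[OF V]] by (auto simp: nxt_def)
  ultimately show ?thesis using adm_ext[OF levelD(1)[OF V] x] by (simp add: level_def)
qed

lemma nxt_decompose:
  assumes V: "level X V" and x: "cand X x" and v: "v \<in> nxt X V x"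
  obtains u f T where "u \<in> stab V x" "f \<in> ann (ext X x)" "is_T x f T" "v = u + T"
proof -
  obtain u t where ut: "v = u + t" "u \<in> stab V x" "t \<in> ZS (ext X x)" using v by (auto simp: nxt_def)
  obtain f T where T: "f \<in> ann (ext X x)" "is_T x f T" "t - T \<in> ZS X" "(t - T) x = 0"
    using ZS_ext_decompose[OF levelD(1)[OF V] x ut(3)] .
  have "t - T \<in> stab V x" using T levelD(3)[OF V] by (auto simp: stab_def)
  then have "u + (t - T) \<in> stab V x" using E.subspace_add[OF subspace_stab[OF levelD(2)[OF V]] ut(2)] by blast
  moreover have "v = (u + (t - T)) + T" using ut by simp
  ultimately show ?thesis using that T by blast
qed

lemma subspace_tens:
  assumes "level X V"
  shows "D.subspace (tens X V x)"
proof (rule D.subspaceI)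
  have "is_T x 0 0" unfolding is_T_def by (rule exI[of _ 0]) (auto simp: fun_eq_iff)
  then show "0 \<in> tens X V x"
    using D.subspace_0[OF subspace_ann] E.subspace_0[OF levelD(2)[OF assms]] by (auto simp: tens_def)
next
  fix f g assume "f \<in> tens X V x" "g \<in> tens X V x"
  then obtain T U where "f \<in> ann (ext X x)" "g \<in> ann (ext X x)" "T \<in> V" "U \<in> V" "is_T x f T" "is_T x g U"
    by (auto simp: tens_def)
  then show "f + g \<in> tens X V x"
    using D.subspace_add[OF subspace_ann] is_T_add E.subspace_add[OF levelD(2)[OF assms]]
    unfolding tens_def by blast
next
  fix c f assume "f \<in> tens X V x"
  then obtain T where "f \<in> ann (ext X x)" "T \<in> V" "is_T x f T"
    by (auto simp: tens_def)
  then show "fun_scale (*) c f \<in> tens X V x"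
    using D.subspace_scale[OF subspace_ann] is_T_scale E.subspace_scale[OF levelD(2)[OF assms]]
    unfolding tens_def by blast
qed

text \<open>\<open>nxt\<close> is the sum of \<open>stab V x\<close> and the space \<open>W\<close>
  of tensors with \<open>x\<close>. The retraction \<open>\<phi>\<close> maps \<open>W\<close> onto
  \<open>ann (ext X x)\<close> and \<open>stab V x \<inter> W\<close> onto \<open>tens\<close>, with
  one common kernel that cancels from the count.\<close>

lemma dim_level_step:
  assumes V: "level X V" and x: "cand X x"
  shows "E.dim (nxt X V x) + D.dim (tens X V x) + dim (orb V x) + dim X + 1 = E.dim V + dim UNIV"
proof -
  interpret ED: vec_space_pair "fun_scale scale :: 'k \<Rightarrow> ('v \<Rightarrow> 'v) \<Rightarrow> 'v \<Rightarrow> 'v"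
    "fun_scale (*) :: 'k \<Rightarrow> ('v \<Rightarrow> 'k) \<Rightarrow> 'v \<Rightarrow> 'k" by (rule pair_ED)
  note aX = adm_ext[OF levelD(1)[OF V] x] and xx = ext_superset(2)[of x X]
  note sV = subspace_stab[OF levelD(2)[OF V], of x]
  let ?A = "ann (ext X x)"
  define W where "W = {T. \<exists>f\<in>?A. is_T x f T}"
  have x0: "x \<noteq> 0" using cand_nonzero[OF levelD(5)[OF V] x] .
  have zero: "is_T x 0 0" unfolding is_T_def by (rule exI[of _ 0]) (auto simp: fun_eq_iff)
  have sW: "E.subspace W"
  proof (rule E.subspaceI)
    show "0 \<in> W" using zero D.subspace_0[OF subspace_ann] by (auto simp: W_def)
  next
    fix T U assume "T \<in> W" "U \<in> W"
    then show "T + U \<in> W" unfolding W_def using is_T_add D.subspace_add[OF subspace_ann] by blast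
  next
    fix c T assume "T \<in> W"
    then show "fun_scale scale c T \<in> W"
      unfolding W_def using is_T_scale D.subspace_scale[OF subspace_ann] by blast
  qed
  have W_ZS: "W \<subseteq> ZS (ext X x)" using is_T_ZS[OF aX xx] by (auto simp: W_def)
  then have W_S: "W \<subseteq> S" using ZS_D(1) by blast
  have nxt_eq: "nxt X V x = {u + T |u T. u \<in> stab V x \<and> T \<in> W}"
  proof
    show "nxt X V x \<subseteq> {u + T |u T. u \<in> stab V x \<and> T \<in> W}"
    proof
      fix v assume v: "v \<in> nxt X V x"
      obtain u f T where "u \<in> stab V x" "f \<in> ?A" "is_T x f T" "v = u + T"
        using nxt_decompose[OF V x v] .
      then show "v \<in> {u + T |u T. u \<in> stab V x \<and> T \<in> W}" unfolding W_def by blast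
    qed
    show "{u + T |u T. u \<in> stab V x \<and> T \<in> W} \<subseteq> nxt X V x"
      using W_ZS unfolding nxt_def by blast
  qed
  obtain \<phi> where \<phi>: "Vector_Spaces.linear (fun_scale scale) (fun_scale (*)) \<phi>" "\<And>f T. is_T x f T \<Longrightarrow> \<phi> T = f"
    using is_T_linear_retract[OF x0] by blast
  have imgW: "\<phi> ` W = ?A"
  proof
    show "\<phi> ` W \<subseteq> ?A" using \<phi>(2) by (auto simp: W_def)
    show "?A \<subseteq> \<phi> ` W"
    proof
      fix f assume f: "f \<in> ?A"
      obtain T where T: "is_T x f T" using is_T_ex[OF aX xx f] .
      then have "T \<in> W" using f by (auto simp: W_def)
      then show "f \<in> \<phi> ` W" using \<phi>(2)[OF T] by blast
    qed
  qed
  have Wx: "T x = 0" if "T \<in> W" for T using W_ZS ZS_D(2) xx that by blast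
  have imgWV: "\<phi> ` (stab V x \<inter> W) = tens X V x"
  proof
    show "\<phi> ` (stab V x \<inter> W) \<subseteq> tens X V x" using \<phi>(2) by (auto simp: W_def stab_def tens_def)
    show "tens X V x \<subseteq> \<phi> ` (stab V x \<inter> W)"
    proof
      fix f assume "f \<in> tens X V x"
      then obtain T where T: "f \<in> ?A" "T \<in> V" "is_T x f T" by (auto simp: tens_def)
      then have W: "T \<in> W" by (auto simp: W_def)
      then have "T \<in> stab V x \<inter> W" using T Wx by (auto simp: stab_def)
      then show "f \<in> \<phi> ` (stab V x \<inter> W)" using \<phi>(2)[OF T(3)] by blast
    qed
  qed
  \<comment> \<open>The kernel stems from the radical: for nonradical \<open>x\<close> it consists
    of maps \<open>b x z *s y\<close> with \<open>y\<close> in \<open>R\<close>, which lie in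
    \<open>ZS X\<close>.\<close>
  have K0: "{T \<in> W. \<phi> T = 0} \<subseteq> stab V x"
  proof clarify
    fix T assume T: "T \<in> W" "\<phi> T = 0"
    then have T0: "is_T x 0 T" using \<phi>(2) by (auto simp: W_def)
    then obtain y where y: "\<And>z. T z = b x z *s y" "x \<in> R \<or> 0 = b y" by (auto simp: is_T_def)
    have "T \<in> ZS X"
    proof (cases "x \<in> R")
      case True
      then have "T = 0" using y by (auto simp: fun_eq_iff R_form)
      then show ?thesis using E.subspace_0[OF subspace_ZS[OF levelD(5)[OF V]]] by simp
    next
      case False
      then have "y \<in> R" using y(2) by (auto intro!: R_I simp: fun_eq_iff)
      moreover have "R \<subseteq> X" using candD(4)[OF x] False by blast
      ultimately have "T z \<in> X" for z using y(1) subspace_scale[OF levelD(5)[OF V]] by auto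
      moreover have "T w = 0" if "w \<in> X" for w using y(1) perpD(2)[OF candD(1)[OF x] that] by simp
      ultimately show ?thesis using T(1) W_S by (auto simp: ZS_def)
    qed
    then show "T \<in> stab V x" using levelD(3)[OF V] Wx[OF T(1)] by (auto simp: stab_def)
  qed
  then have ker: "{T \<in> stab V x \<inter> W. \<phi> T = 0} = {T \<in> W. \<phi> T = 0}" by blast
  have 1: "E.dim W = D.dim ?A + E.dim {T \<in> W. \<phi> T = 0}"
    using ED.rank_nullity[OF \<phi>(1) sW fin_dim_S[OF W_S]] imgW by simp
  have "stab V x \<inter> W \<subseteq> S" using W_S by blast
  then have 2: "E.dim (stab V x \<inter> W) = D.dim (tens X V x) + E.dim {T \<in> W. \<phi> T = 0}"
    using ED.rank_nullity[OF \<phi>(1) E.subspace_inter[OF sV sW] fin_dim_S] imgWV ker by simp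
  have "nxt X V x \<subseteq> S" using levelD(7)[OF level_nxt[OF V x]] .
  then have 3: "E.dim (nxt X V x) + E.dim (stab V x \<inter> W) = E.dim (stab V x) + E.dim W"
    using E.fin_dim_dim_sum[OF sV sW] fin_dim_S unfolding nxt_eq by blast
  have 4: "E.dim V = dim (orb V x) + E.dim (stab V x)" using dim_orb_stab[OF levelD(2,7)[OF V]] .
  have 5: "D.dim ?A + dim X + 1 = dim UNIV"
    using dim_ann[OF subspace_ext, of X x] dim_ext[OF levelD(5)[OF V] candD(2)[OF x]] by simp
  show ?thesis using 1 2 3 4 5 by linarith
qed

lemma dim_ann_reach:
  assumes "level X V" "cand X x"
  shows "D.dim (ann (reach V x)) + dim (orb V x) + 1 = dim UNIV"
  using dim_ann[OF subspace_reach, of V x] dim_reach[OF assms(1) candD(2)[OF assms(2)]] by simp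

text \<open>Bounding \<open>tens\<close> by \<open>ann (reach V x)\<close> makes
  \<open>dim (orb V x)\<close> cancel from \<open>dim_level_step\<close>, so the loss does not
  depend on the orbit.\<close>

lemma dim_level_le:
  assumes V: "level X V" and x: "cand X x"
  shows "E.dim V \<le> E.dim (nxt X V x) + dim X"
  using D.fin_dim_dim_mono[OF subspace_tens[OF V] subspace_ann fin_dim_ann tens_subset[OF V], of x]
    dim_level_step[OF V x] dim_ann_reach[OF V x] by linarith

lemma tens_eq:
  assumes V: "level X V" and x: "cand X x" and dims: "E.dim (nxt X V x) + dim X \<le> E.dim V"
  shows "tens X V x = ann (reach V x)"
  using D.fin_dim_dim_eq[OF subspace_tens[OF V] subspace_ann fin_dim_ann tens_subset[OF V], of x]
    dim_level_step[OF V x] dim_ann_reach[OF V x] dims by linarith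

lemma level_ZS: "adm X \<Longrightarrow> level X (ZS X)"
  using subspace_ZS adm_D(1) ZS_subset_NS by (auto simp: level_def)

text \<open>This is \<open>dim_level_step\<close> for the smallest level \<open>ZS X\<close>: its
  orbit contains \<open>X\<close>, and its tensors contain those of \<open>x\<close> with every
  \<open>y\<close> in \<open>X\<close>, counted modulo \<open>R\<close>.\<close>

lemma dim_ZS_step:
  assumes X: "adm X" and x: "cand X x"
  shows "E.dim (ZS (ext X x)) + 3 * dim X + 1 \<le> E.dim (ZS X) + dim UNIV + dim (X \<inter> R)"
proof -
  interpret VD: vec_space_pair scale "fun_scale (*) :: 'k \<Rightarrow> ('v \<Rightarrow> 'k) \<Rightarrow> 'v \<Rightarrow> 'k" by (rule pair_VD)
  note V = level_ZS[OF X]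
  have "E.dim (ZS (ext X x)) \<le> E.dim (nxt X (ZS X) x)"
    using E.fin_dim_dim_mono[OF subspace_ZS[OF subspace_ext] levelD(2)[OF level_nxt[OF V x]]
        fin_dim_S[OF levelD(7)[OF level_nxt[OF V x]]] levelD(3)[OF level_nxt[OF V x]]] .
  moreover have "dim X \<le> dim (orb (ZS X) x)"
    using dim_subset[OF orb_superset[OF V candD(1,2)[OF x]]] .
  moreover have "dim X = D.dim (b ` X) + dim (X \<inter> R)"
  proof -
    have "{y \<in> X. b y = 0} = X \<inter> R" by (auto simp: fun_eq_iff R_form intro: R_I)
    then show ?thesis using VD.rank_nullity[OF linear_form_map adm_D(1)[OF X] fin_dim] by simp
  qed
  moreover have "D.dim (b ` X) \<le> D.dim (tens X (ZS X) x)"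
  proof (rule D.fin_dim_dim_mono[OF VD.linear_subspace_image[OF linear_form_map adm_D(1)[OF X]] subspace_tens[OF V]])
    show "D.fin_dim (tens X (ZS X) x)"
      using fin_dim_ann by (rule D.fin_dim_subset) (auto simp: tens_def)
    show "b ` X \<subseteq> tens X (ZS X) x"
    proof clarify
      fix y assume y: "y \<in> X"
      let ?T = "\<lambda>z. b y z *s x + b x z *s y"
      have T: "is_T x (b y) ?T" unfolding is_T_def by blast
      have xy: "b x y = 0" "b y x = 0" using perpD[OF candD(1)[OF x] y] by auto
      have "b y \<in> ann (insert x X)"
        using form_linear xy tsD[OF adm_D(2)[OF X] y] by (auto simp: ann_def)
      then have "b y \<in> ann (ext X x)" by (simp add: ext_def ann_span)
      moreover have "?T \<in> ZS X"
        using is_T_S[OF T form_linear(1)] tsD[OF adm_D(2)[OF X] y] perpD[OF candD(1)[OF x]]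
          perpD(1)[OF _ y] subspace_scale[OF adm_D(1)[OF X] y] by (auto simp: ZS_def)
      ultimately show "b y \<in> tens X (ZS X) x" using T unfolding tens_def by blast
    qed
  qed
  ultimately show ?thesis using dim_level_step[OF V x] by linarith
qed

end

lemma choose_two_add: "(m + k) choose 2 = (m choose 2) + m * k + (k choose 2)" for m k :: nat
  by (induction k) (auto simp: numeral_2_eq_2)

context sym_form
begin

section \<open>Dimension bounds and flags\<close>

abbreviation \<nu> :: nat where "\<nu> \<equiv> witt_index scale b"

lemma dim_le_witt:
  assumes "subspace X" "ts X"
  shows "dim X \<le> \<nu>"
  unfolding witt_index_def
proof (rule Greatest_le_nat)
  show "\<exists>Y. subspace Y \<and> ts Y \<and> dim Y = dim X" using assms by blast
  show "\<And>y. \<exists>X. subspace X \<and> ts X \<and> dim X = y \<Longrightarrow> y \<le> dim UNIV" using dim_subset[OF subset_UNIV] by blast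
qed

lemma witt_attained:
  obtains M where "subspace M" "ts M" "dim M = \<nu>"
proof -
  have "\<exists>X. subspace X \<and> ts X \<and> dim X = \<nu>"
    unfolding witt_index_def
  proof (rule GreatestI_nat)
    show "\<exists>Y. subspace Y \<and> ts Y \<and> dim Y = dim {0}"
      by (intro exI[of _ "{0}"]) (auto simp: totally_singular_def)
    show "\<And>y. \<exists>X. subspace X \<and> ts X \<and> dim X = y \<Longrightarrow> y \<le> dim UNIV" using dim_subset[OF subset_UNIV] by blast
  qed
  then show ?thesis using that by blast
qed

lemma ts_R: "ts R"
  by (auto simp: totally_singular_def R_form)

lemma dim_R_le: "dim R \<le> \<nu>"
  using dim_le_witt[OF subspace_R ts_R] .

lemma witt_le: "\<nu> \<le> dim UNIV"
  using witt_attained dim_subset[OF subset_UNIV] by metis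

lemma maximal_ts:
  assumes X: "adm X" and d: "dim X = \<nu>"
  shows "R \<subseteq> X" and "z \<in> perp X \<Longrightarrow> b z z = 0 \<Longrightarrow> z \<in> X"
proof -
  show RX: "R \<subseteq> X"
  proof (cases "X \<subseteq> R")
    case True
    then have "X = R" using subspace_dim_equal[OF adm_D(1)[OF X] subspace_R] dim_R_le d by simp
    then show ?thesis by simp
  qed (use adm_D(3)[OF X] in blast)
  assume z: "z \<in> perp X" "b z z = 0"
  show "z \<in> X"
  proof (rule ccontr)
    assume zX: "z \<notin> X"
    then have "cand X z" using z RX by (simp add: cand_def)
    then have "dim (ext X z) \<le> \<nu>" using dim_le_witt adm_D adm_ext[OF X] by blast
    then show False using dim_ext[OF adm_D(1)[OF X] zX] d by simp
  qed
qed

text \<open>A dimension count takes the place of Witt's extension theorem: \<open>perp X + M\<close>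
  lies in \<open>perp (X \<inter> M)\<close>, so a totally singular \<open>M\<close> of dimension
  \<open>\<nu>\<close> containing \<open>R\<close> must meet \<open>perp X\<close> outside
  \<open>X\<close>.\<close>

lemma cand_exists:
  assumes X: "adm X" and d: "dim X < \<nu>"
  obtains x where "cand X x"
proof (cases "R \<subseteq> X")
  case False
  then obtain x where "x \<in> R" "x \<notin> X" by blast
  then have "cand X x" using R_perp R_form by (auto simp: cand_def)
  then show ?thesis using that by blast
next
  case RX: True
  obtain M where M: "subspace M" "ts M" "dim M = \<nu>" by (rule witt_attained)
  have RM: "R \<subseteq> M"
  proof
    fix r assume r: "r \<in> R"
    show "r \<in> M"
    proof (rule ccontr)
      assume rM: "r \<notin> M"
      have "b p q = 0" if pq: "p \<in> ext M r" "q \<in> ext M r" for p q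
      proof -
        obtain c w where p: "p = c *s r + w" "w \<in> M" using ext_elim[OF M(1) pq(1)] .
        obtain d v where q: "q = d *s r + v" "v \<in> M" using ext_elim[OF M(1) pq(2)] .
        show ?thesis using p q R_form[OF r] tsD[OF M(2)] by simp
      qed
      then have "ts (ext M r)" by (simp add: totally_singular_def)
      then have "dim (ext M r) \<le> \<nu>" by (rule dim_le_witt[OF subspace_ext])
      then show False using dim_ext[OF M(1) rM] M(3) by simp
    qed
  qed
  have "\<not> perp X \<inter> M \<subseteq> X"
  proof
    assume sub: "perp X \<inter> M \<subseteq> X"
    have sX: "subspace X" using adm_D(1)[OF X] .
    have i: "subspace (X \<inter> M)" using subspace_inter[OF sX M(1)] .
    have "{x + y |x y. x \<in> perp X \<and> y \<in> M} \<subseteq> perp (X \<inter> M)"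
    proof clarify
      fix p q assume "p \<in> perp X" "q \<in> M"
      then have "p \<in> perp (X \<inter> M)" "q \<in> perp (X \<inter> M)"
        using perp_antimono[of "X \<inter> M" X] perp_antimono[of "X \<inter> M" M] ts_perp[OF M(2)] by auto
      then show "p + q \<in> perp (X \<inter> M)" by (rule subspace_add[OF subspace_perp])
    qed
    then have "dim {x + y |x y. x \<in> perp X \<and> y \<in> M} \<le> dim (perp (X \<inter> M))" by (rule dim_subset)
    moreover have "dim (perp X \<inter> M) \<le> dim (X \<inter> M)" using sub by (intro dim_subset) blast
    ultimately show False
      using dim_sums_Int[OF subspace_perp[of X] M(1)] dim_perp[OF sX RX] dim_perp[OF i] RX RM M(3) d
      by simp
  qed
  then obtain x where "x \<in> perp X" "x \<in> M" "x \<notin> X" by blast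
  then have "cand X x" using tsD[OF M(2)] RX by (simp add: cand_def)
  then show ?thesis using that by blast
qed

text \<open>Take the last \<open>j\<close> with \<open>(u ^^ j) a\<close> outside \<open>X\<close>.
  Moving one power across the form turns the square of this vector into
  \<open>b a ((u ^^ (2 * j)) a)\<close>, and \<open>2 * j\<close> is past the last index because
  \<open>j \<ge> 1\<close>.\<close>

lemma last_power:
  assumes X: "subspace X" and u: "u \<in> NS X" and a: "a \<in> perp X" "u a \<notin> X"
  obtains j where "1 \<le> j" "(u ^^ j) a \<notin> X" "u ((u ^^ j) a) \<in> X" "b ((u ^^ j) a) ((u ^^ j) a) = 0"
    "(u ^^ j) a \<in> perp X"
proof -
  have S: "u \<in> S" using NS_D(1)[OF u] .
  obtain K where "(u ^^ K) a = 0" using nilpotent_endo_funpow[OF NS_D(2)[OF u]] by blast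
  then have ex: "(u ^^ K) a \<in> X" using subspace_0[OF X] by simp
  define L where "L = (LEAST k. (u ^^ k) a \<in> X)"
  have L: "(u ^^ L) a \<in> X" unfolding L_def using ex by (rule LeastI)
  have least: "(u ^^ k) a \<notin> X" if "k < L" for k using not_less_Least that unfolding L_def by blast
  have aX: "a \<notin> X" using NS_D(3)[OF u] a(2) subspace_0[OF X] by auto
  have "L \<noteq> 0" using L aX by (metis funpow_0)
  moreover have "L \<noteq> 1" using L a(2) by auto
  ultimately obtain j where j: "L = Suc j" "1 \<le> j" by (cases L) auto
  have "b ((u ^^ j) a) ((u ^^ j) a) = b a ((u ^^ j) ((u ^^ j) a))"
    using S_pow_sym[OF S, of a j "(u ^^ j) a"] by simp
  also have "(u ^^ j) ((u ^^ j) a) = (u ^^ (j - 1)) ((u ^^ L) a)"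
  proof -
    have "(u ^^ j) ((u ^^ j) a) = (u ^^ (j + j)) a" by (simp add: funpow_add)
    also have "j + j = (j - 1) + L" using j by simp
    also have "(u ^^ ((j - 1) + L)) a = (u ^^ (j - 1)) ((u ^^ L) a)" by (simp only: funpow_add o_apply)
    finally show ?thesis .
  qed
  also have "b a ((u ^^ (j - 1)) ((u ^^ L) a)) = 0"
  proof (cases "j - 1")
    case 0
    then show ?thesis using perpD(2)[OF a(1) L] by simp
  next
    case (Suc i)
    then show ?thesis using NS_D(3)[OF u L] S_pow_zero[OF S] by (simp add: funpow_swap1)
  qed
  finally have iso: "b ((u ^^ j) a) ((u ^^ j) a) = 0" .
  have "(u ^^ j) a \<in> perp X" using j(2) NS_D(4)[OF u] by (cases j) auto
  then show ?thesis using that[OF j(2)] least[of j] j L iso by simp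
qed

text \<open>At the Witt index no isotropic vector of \<open>perp X\<close> is left outside
  \<open>X\<close>, so \<open>last_power\<close> leaves no nonzero action modulo
  \<open>X\<close>.\<close>

lemma maximal_NS:
  assumes X: "adm X" and d: "dim X = \<nu>"
  shows "NS X = ZS X"
proof
  show "ZS X \<subseteq> NS X" using ZS_subset_NS[OF adm_D(1)[OF X]] .
  show "NS X \<subseteq> ZS X"
  proof
    fix u assume u: "u \<in> NS X"
    have "u z \<in> X" if z: "z \<in> perp X" for z
    proof (rule ccontr)
      assume "u z \<notin> X"
      then obtain j where "(u ^^ j) z \<notin> X" "b ((u ^^ j) z) ((u ^^ j) z) = 0" "(u ^^ j) z \<in> perp X"
        using last_power[OF adm_D(1)[OF X] u z] by blast
      then show False using maximal_ts(2)[OF X d] by blast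
    qed
    then show "u \<in> ZS X" using NS_D[OF u] by (simp add: ZS_def)
  qed
qed

text \<open>For \<open>X \<subseteq> R\<close> the space \<open>ZS X\<close> consists of all linear
  maps killing \<open>X\<close> with values in \<open>X\<close>, which gives the product; the
  binomial is the cost of symmetry beyond \<open>R\<close>. An inequality suffices, and it is
  carried from \<open>{0}\<close> along \<open>ext\<close>.\<close>

definition inv_dim :: "'v set \<Rightarrow> bool" where
  "inv_dim X \<longleftrightarrow> E.dim (ZS X) + ((dim X - dim R) choose 2) \<le> dim X * (dim UNIV - dim X)"

lemma inv_dim_zero: "inv_dim {0}"
proof -
  have "ZS {0} \<subseteq> {0}" by (auto simp: ZS_def perp_def fun_eq_iff)
  then have "ZS {0} = {0}" using E.subspace_0[OF subspace_ZS[OF subspace_single_0]] by auto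
  then show ?thesis by (simp add: inv_dim_def)
qed

lemma inv_dim_ext:
  assumes X: "adm X" and x: "cand X x" and inv: "inv_dim X"
  shows "inv_dim (ext X x)"
proof -
  let ?k = "dim X" and ?n = "dim UNIV" and ?m = "dim R"
  have d: "dim (ext X x) = Suc ?k" using dim_ext[OF adm_D(1)[OF X] candD(2)[OF x]] .
  have "Suc ?k \<le> ?n" using dim_subset[OF subset_UNIV, of "ext X x"] d by simp
  then obtain l where l: "?n = Suc ?k + l" using le_Suc_ex by blast
  \<comment> \<open>Truncated subtraction covers both nested cases in a single formula.\<close>
  have cap: "dim (X \<inter> R) + (?k - ?m) = ?k"
  proof (cases "R \<subseteq> X")
    case True
    then show ?thesis using dim_subset[OF True] by (simp add: Int_absorb1)
  next
    case False
    then have "X \<subseteq> R" using adm_D(3)[OF X] by blast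
    then show ?thesis using dim_subset[of X R] by (simp add: Int_absorb2)
  qed
  have ch: "(Suc ?k - ?m) choose 2 = ((?k - ?m) choose 2) + (?k - ?m)"
    by (cases "?m \<le> ?k") (auto simp: Suc_diff_le numeral_2_eq_2)
  have "E.dim (ZS (ext X x)) + 3 * ?k + 1 \<le> E.dim (ZS X) + ?n + dim (X \<inter> R)"
    using dim_ZS_step[OF X x] .
  moreover have "E.dim (ZS X) + ((?k - ?m) choose 2) \<le> ?k * (?n - ?k)"
    using inv by (simp add: inv_dim_def)
  moreover have "?k * (?n - ?k) + ?n = Suc ?k * (?n - Suc ?k) + 2 * ?k + 1"
  proof -
    have "?n - ?k = Suc l" "?n - Suc ?k = l" using l by linarith+
    then show ?thesis using l by (simp del: dim_UNIV)
  qed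
  ultimately show ?thesis using cap ch unfolding inv_dim_def d by linarith
qed

text \<open>The reverse of \<open>dim_level_bound\<close>, with differences moved across. The term
  \<open>dim X choose 2\<close> is the loss \<open>0 + 1 + ... + (dim X - 1)\<close> already
  incurred on the way to \<open>X\<close>.\<close>

definition tight :: "'v set \<Rightarrow> ('v \<Rightarrow> 'v) set \<Rightarrow> bool" where
  "tight X V \<longleftrightarrow> \<nu> * (dim UNIV - \<nu>) + (\<nu> choose 2)
     \<le> E.dim V + (dim X choose 2) + ((\<nu> - dim R) choose 2)"

lemma dim_level_bound:
  assumes "level X V" "inv_dim X"
  shows "E.dim V + (dim X choose 2) + ((\<nu> - dim R) choose 2) \<le> \<nu> * (dim UNIV - \<nu>) + (\<nu> choose 2)"
  using assms
proof (induction "\<nu> - dim X" arbitrary: X V)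
  case 0
  have "dim X = \<nu>" using 0(1) dim_le_witt[OF levelD(5,6)[OF 0(2)]] by simp
  then have "V = ZS X" using maximal_NS[OF levelD(1)[OF 0(2)]] levelD(3,4)[OF 0(2)] by blast
  then show ?case using 0(3) \<open>dim X = \<nu>\<close> by (simp add: inv_dim_def)
next
  case (Suc i)
  have "dim X < \<nu>" using Suc.hyps(2) by simp
  then obtain x where x: "cand X x" using cand_exists[OF levelD(1)[OF Suc.prems(1)]] by blast
  have d: "dim (ext X x) = Suc (dim X)" using dim_ext[OF levelD(5)[OF Suc.prems(1)] candD(2)[OF x]] .
  have "E.dim (nxt X V x) + (dim (ext X x) choose 2) + ((\<nu> - dim R) choose 2) \<le> \<nu> * (dim UNIV - \<nu>) + (\<nu> choose 2)"
    using Suc.hyps(2) d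
    by (intro Suc.hyps(1) level_nxt[OF Suc.prems(1) x] inv_dim_ext[OF levelD(1)[OF Suc.prems(1)] x Suc.prems(2)]) simp
  moreover have "dim (ext X x) choose 2 = (dim X choose 2) + dim X" by (simp add: d numeral_2_eq_2)
  ultimately show ?case using dim_level_le[OF Suc.prems(1) x] by linarith
qed

text \<open>Equality in a sum of bounds forces equality in each of them; here this means that
  \<open>tens\<close> fills its upper bound.\<close>

lemma tight_step:
  assumes V: "level X V" and inv: "inv_dim X" and t: "tight X V" and x: "cand X x"
  shows "tight (ext X x) (nxt X V x)" and "tens X V x = ann (reach V x)"
proof -
  have d: "dim (ext X x) = Suc (dim X)" using dim_ext[OF levelD(5)[OF V] candD(2)[OF x]] .
  have c: "dim (ext X x) choose 2 = (dim X choose 2) + dim X" by (simp add: d numeral_2_eq_2)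
  show "tight (ext X x) (nxt X V x)"
    using t dim_level_le[OF V x] c unfolding tight_def by linarith
  have "E.dim (nxt X V x) + dim X \<le> E.dim V"
    using t dim_level_bound[OF level_nxt[OF V x] inv_dim_ext[OF levelD(1)[OF V] x inv]] c
    unfolding tight_def by linarith
  then show "tens X V x = ann (reach V x)" by (rule tens_eq[OF V x])
qed

text \<open>Only members from index \<open>dim X\<close> on are constrained, so a flag over
  \<open>ext X x\<close> becomes one over \<open>X\<close> by changing one value.\<close>

definition flag_from :: "'v set \<Rightarrow> (nat \<Rightarrow> 'v set) \<Rightarrow> bool" where
  "flag_from X F \<longleftrightarrow> F (dim X) = X \<and> dim X \<le> \<nu>
     \<and> (\<forall>i. dim X \<le> i \<and> i \<le> \<nu> \<longrightarrow> subspace (F i) \<and> dim (F i) = i)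
     \<and> (\<forall>i. dim X \<le> i \<and> i < \<nu> \<longrightarrow> F i \<subseteq> F (Suc i))
     \<and> ts (F \<nu>) \<and> (R \<subseteq> X \<or> F (dim R) = R)"

definition full :: "'v set \<Rightarrow> (nat \<Rightarrow> 'v set) \<Rightarrow> ('v \<Rightarrow> 'v) set" where
  "full X F = {u \<in> NS X. \<forall>i. dim X \<le> i \<and> i \<le> \<nu> \<longrightarrow> u ` F i \<subseteq> F i}"

lemma flagD:
  assumes "flag_from X F"
  shows "F (dim X) = X" "dim X \<le> \<nu>" "ts (F \<nu>)" "R \<subseteq> X \<or> F (dim R) = R"
    and "dim X \<le> i \<Longrightarrow> i \<le> \<nu> \<Longrightarrow> subspace (F i)" "dim X \<le> i \<Longrightarrow> i \<le> \<nu> \<Longrightarrow> dim (F i) = i"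
  using assms by (auto simp: flag_from_def)

lemma flag_mono:
  assumes "flag_from X F" "dim X \<le> i" "i \<le> j" "j \<le> \<nu>"
  shows "F i \<subseteq> F j"
  using assms(3,4)
proof (induction j rule: dec_induct)
  case (step j)
  have "dim X \<le> j" "j < \<nu>" using step assms(2) by auto
  then have "F j \<subseteq> F (Suc j)" using assms(1) unfolding flag_from_def by blast
  then show ?case using step by auto
qed simp

lemma flag_ts:
  assumes "flag_from X F" "dim X \<le> i" "i \<le> \<nu>"
  shows "ts (F i)"
  using flagD(3)[OF assms(1)] flag_mono[OF assms order_refl] by (auto simp: totally_singular_def)

lemma flag_adm:
  assumes F: "flag_from X F" and X: "adm X" and i: "dim X \<le> i" "i \<le> \<nu>"
  shows "adm (F i)"
proof -
  have "F i \<subseteq> R \<or> R \<subseteq> F i"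
  proof (cases "R \<subseteq> X")
    case True
    then show ?thesis using flag_mono[OF F order_refl i] flagD(1)[OF F] by auto
  next
    case False
    then have FR: "F (dim R) = R" "X \<subseteq> R" using flagD(4)[OF F] adm_D(3)[OF X] by auto
    have "dim X \<le> dim R" using dim_subset[OF FR(2)] .
    then show ?thesis
      using flag_mono[OF F i(1) _ dim_R_le] flag_mono[OF F _ _ i(2), of "dim R"] FR(1)
      by (cases "i \<le> dim R") auto
  qed
  then show ?thesis using flagD(5)[OF F i] flag_ts[OF F i] by (simp add: adm_def)
qed

lemma is_T_full:
  assumes F: "flag_from X F" and X: "adm X" and i: "dim X \<le> i" "i \<le> \<nu>"
    and w: "w \<in> F i" and f: "f \<in> ann (F i)" and T: "is_T w f T"
  shows "T \<in> full X F"
proof -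
  have Z: "T \<in> ZS (F i)" using is_T_ZS[OF flag_adm[OF F X i] w f T] .
  then have N: "T \<in> NS (F i)" using ZS_subset_NS[OF flagD(5)[OF F i]] by blast
  have "X \<subseteq> F i" using flag_mono[OF F order_refl i] flagD(1)[OF F] by simp
  then have "T \<in> NS X" using NS_D[OF N] by (auto simp: NS_def)
  moreover have "T ` F j \<subseteq> F j" if j: "dim X \<le> j" "j \<le> \<nu>" for j
  proof (cases "j \<le> i")
    case True
    then have "T z = 0" if "z \<in> F j" for z
      using flag_mono[OF F j(1) True i(2)] ZS_D(2)[OF Z] that by blast
    then show ?thesis using subspace_0[OF flagD(5)[OF F j]] by auto
  next
    case False
    then have ij: "F i \<subseteq> F j" using flag_mono[OF F i(1) _ j(2)] by simp
    have "T z \<in> F j" if "z \<in> F j" for z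
    proof -
      have "b w z = 0" using tsD[OF flag_ts[OF F j]] ij w that by blast
      then show ?thesis using is_T_apply[OF T] subspace_scale[OF flagD(5)[OF F j]] ij w by auto
    qed
    then show ?thesis by blast
  qed
  ultimately show ?thesis by (simp add: full_def)
qed

text \<open>If \<open>b w q \<noteq> 0\<close> with \<open>w\<close> in \<open>F \<nu>\<close>, the
  tensor \<open>w \<otimes> w\<close> carries \<open>q\<close> to a nonzero multiple of
  \<open>w\<close>, so \<open>w\<close> is in \<open>Q\<close>, against singularity; hence
  \<open>Q \<subseteq> F \<nu>\<close>. If \<open>q\<close> in \<open>Q\<close> lies outside
  \<open>F j\<close>, tensors with a functional that is 1 at \<open>q\<close> carry \<open>q\<close>
  to every vector of \<open>F j\<close>.\<close>

lemma invariant_in_flag: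
  assumes F: "flag_from X F" and X: "adm X" and Q: "subspace Q" "X \<subseteq> Q" "ts Q"
    and inv: "\<And>u q. u \<in> full X F \<Longrightarrow> q \<in> Q \<Longrightarrow> u q \<in> Q"
  shows "Q = F (dim Q)"
proof -
  note n = flagD(2)[OF F]
  note Fn = flag_adm[OF F X n order_refl]
  have QF: "Q \<subseteq> F \<nu>"
  proof
    fix q assume q: "q \<in> Q"
    have "b w q = 0" if w: "w \<in> F \<nu>" for w
    proof (rule ccontr)
      assume nz: "b w q \<noteq> 0"
      let ?T = "\<lambda>z. b w z *s w + b w z *s w"
      have f: "b w \<in> ann (F \<nu>)" using form_linear tsD[OF flagD(3)[OF F] w] by (simp add: ann_def)
      have T: "is_T w (b w) ?T" unfolding is_T_def by blast
      have "?T q \<in> Q" using inv[OF is_T_full[OF F X n order_refl w f T] q] .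
      then have "(b w q + b w q) *s w \<in> Q" by (simp only: scale_left_distrib)
      then have "inverse (b w q + b w q) *s ((b w q + b w q) *s w) \<in> Q" by (rule subspace_scale[OF Q(1)])
      moreover have "b w q + b w q \<noteq> 0" using double_eq_zero nz by blast
      ultimately have "w \<in> Q" by simp
      then show False using tsD[OF Q(3)] q nz by blast
    qed
    then have "q \<in> perp (F \<nu>)" by (simp add: perp_def)
    then show "q \<in> F \<nu>" using maximal_ts(2)[OF Fn flagD(6)[OF F n order_refl]] tsD[OF Q(3) q q] by blast
  qed
  define i where "i = (LEAST i. dim X \<le> i \<and> Q \<subseteq> F i)"
  have i: "dim X \<le> i" "Q \<subseteq> F i" unfolding i_def using LeastI[of "\<lambda>i. dim X \<le> i \<and> Q \<subseteq> F i" \<nu>] n QF by auto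
  have i_le: "i \<le> \<nu>" unfolding i_def using n QF by (intro Least_le) simp
  show ?thesis
  proof (cases "i = dim X")
    case True
    then have "Q = X" using i(2) flagD(1)[OF F] Q(2) by auto
    then show ?thesis using flagD(1)[OF F] by simp
  next
    case False
    then obtain j where j: "i = Suc j" "dim X \<le> j" using i(1) by (cases i) auto
    have jn: "j \<le> \<nu>" "j < i" using j i_le by auto
    have "\<not> Q \<subseteq> F j" using not_less_Least[of j "\<lambda>i. dim X \<le> i \<and> Q \<subseteq> F i"] jn(2) j(2) unfolding i_def by blast
    then obtain q where q: "q \<in> Q" "q \<notin> F j" by blast
    obtain f where f: "f \<in> ann (F j)" "f q = 1" using ann_separates[OF flagD(5)[OF F j(2) jn(1)] q(2)] .
    have "w \<in> Q" if w: "w \<in> F j" for w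
    proof -
      obtain T where T: "is_T w f T" using is_T_ex[OF flag_adm[OF F X j(2) jn(1)] w f(1)] .
      have "b w q = 0"
        using tsD[OF flagD(3)[OF F]] flag_mono[OF F j(2) jn(1) order_refl] w QF q(1) by blast
      then have "T q = w" using is_T_apply[OF T] f(2) by simp
      then show ?thesis using inv[OF is_T_full[OF F X j(2) jn(1) w f(1) T] q(1)] by simp
    qed
    then have "ext (F j) q \<subseteq> Q" using ext_least[OF Q(1)] q(1) by blast
    then have "Suc j \<le> dim Q"
      using dim_subset[of "ext (F j) q" Q] dim_ext[OF flagD(5)[OF F j(2) jn(1)] q(2)] flagD(6)[OF F j(2) jn(1)] by simp
    then have "dim (F i) \<le> dim Q" using flagD(6)[OF F i(1) i_le] j(1) by simp
    then have "Q = F i" using subspace_dim_equal[OF Q(1) flagD(5)[OF F i(1) i_le] i(2)] by simp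
    then show ?thesis using flagD(6)[OF F i(1) i_le] by simp
  qed
qed

lemma ZS_correction:
  assumes "level X V" "u \<in> V" "x \<in> perp X" "x \<notin> X" "u x \<in> X"
  obtains t where "t \<in> ZS X" "u - t \<in> stab V x"
proof -
  obtain t where t: "t \<in> ZS X" "t x = u x" using ZS_reach[OF levelD(1)[OF assms(1)] assms(3-5)] .
  then have "u - t \<in> V" using E.subspace_diff[OF levelD(2)[OF assms(1)] assms(2)] levelD(3)[OF assms(1)] by blast
  then show ?thesis using that[OF t(1)] t(2) by (simp add: stab_def)
qed

lemma stab_subset_nxt: "stab V x \<subseteq> nxt X V x"
proof
  fix u assume "u \<in> stab V x"
  moreover have "0 \<in> ZS (ext X x)" using E.subspace_0[OF subspace_ZS[OF subspace_ext]] .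
  moreover have "u = u + 0" by simp
  ultimately show "u \<in> nxt X V x" unfolding nxt_def by blast
qed

text \<open>Here \<open>reach V x\<close> is no larger than \<open>ext X x\<close>, so
  \<open>tens\<close> is everything and \<open>V\<close> contains all tensors that
  \<open>nxt\<close> adds. Corrections by \<open>ZS X\<close> do the rest, as they preserve every
  flag member.\<close>

lemma full_from_next:
  assumes V: "level X V" and x: "cand X x" and good: "orb V x \<subseteq> X"
    and tens: "tens X V x = ann (reach V x)"
    and F: "flag_from (ext X x) F" and nxt: "nxt X V x = full (ext X x) F"
  shows "flag_from X (F(dim X := X)) \<and> V = full X (F(dim X := X))"
proof
  let ?F = "F(dim X := X)"
  note sX = levelD(5)[OF V]
  have d: "dim (ext X x) = Suc (dim X)" using dim_ext[OF sX candD(2)[OF x]] .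
  have F1: "F (Suc (dim X)) = ext X x" using flagD(1)[OF F] d by simp
  have dn: "Suc (dim X) \<le> \<nu>" using flagD(2)[OF F] d by simp
  have Fi: "X \<subseteq> F i" "subspace (F i)" "dim (F i) = i" "F i \<subseteq> perp X" if "Suc (dim X) \<le> i" "i \<le> \<nu>" for i
  proof -
    have i: "dim (ext X x) \<le> i" using that d by simp
    show "X \<subseteq> F i" using flag_mono[OF F order_refl i that(2)] flagD(1)[OF F] ext_superset(1)[of X x] by auto
    then show "F i \<subseteq> perp X" using ts_perp[OF flag_ts[OF F i that(2)]] perp_antimono by blast
    show "subspace (F i)" "dim (F i) = i" using flagD(5,6)[OF F i that(2)] by auto
  qed
  have "?F i \<subseteq> ?F (Suc i)" if "dim X \<le> i" "i < \<nu>" for i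
  proof (cases "i = dim X")
    case True
    then show ?thesis using F1 ext_superset(1)[of X x] by simp
  next
    case False
    then have "Suc (dim X) \<le> i" using that by simp
    then show ?thesis using F that d False by (auto simp: flag_from_def)
  qed
  moreover have "R \<subseteq> X \<or> ?F (dim R) = R"
  proof (cases "R \<subseteq> X")
    case False
    then have "X \<subseteq> R" "x \<in> R" using adm_D(3)[OF levelD(1)[OF V]] candD(4)[OF x] by auto
    then have e: "ext X x \<subseteq> R" using ext_least[OF subspace_R] by blast
    then have "dim X \<noteq> dim R" using dim_subset[OF e] d by simp
    moreover have "F (dim R) = R"
    proof (cases "R \<subseteq> ext X x")
      case True
      then have "R = ext X x" using e by blast
      then show ?thesis using flagD(1)[OF F] by simp
    qed (use flagD(4)[OF F] in blast)
    ultimately show ?thesis by simp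
  qed simp
  moreover have "ts (?F \<nu>)" using flagD(3)[OF F] dn by simp
  ultimately show "flag_from X ?F"
    using Fi sX dn unfolding flag_from_def by (auto simp: Suc_le_eq)
  have reach_sub: "reach V x \<subseteq> ext X x"
    using good unfolding reach_def by (intro span_minimal[OF _ subspace_ext]) (use ext_superset in blast)
  \<comment> \<open>\<open>tens\<close> provides some tensor for \<open>f\<close> in
    \<open>V\<close>; another choice differs from it by \<open>b x z *s (y - y')\<close>, which lies
    in \<open>ZS X\<close>.\<close>
  have T_V: "T \<in> V" if f: "f \<in> ann (ext X x)" and T: "is_T x f T" for f T
  proof -
    have "f \<in> tens X V x" using tens ann_antimono[OF reach_sub] f by blast
    then obtain T' where T': "T' \<in> V" "is_T x f T'" by (auto simp: tens_def)
    have "T - T' \<in> ZS X"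
    proof -
      obtain y where y: "\<And>z. T z = f z *s x + b x z *s y" "x \<in> R \<or> f = b y"
        using T unfolding is_T_def by blast
      obtain y' where y': "\<And>z. T' z = f z *s x + b x z *s y'" "x \<in> R \<or> f = b y'"
        using T'(2) unfolding is_T_def by blast
      have *: "(T - T') z = b x z *s (y - y')" for z by (simp add: y(1) y'(1) algebra_simps)
      have "b x z *s (y - y') \<in> X" for z
      proof (cases "x \<in> R")
        case True
        then show ?thesis using subspace_0[OF sX] by (simp add: R_form)
      next
        case False
        then have "b y = b y'" using y(2) y'(2) by simp
        then have "y - y' \<in> R" by (intro R_I) simp
        then have "y - y' \<in> X" using candD(4)[OF x] False by blast
        then show ?thesis by (rule subspace_scale[OF sX])
      qed
      moreover have "b x w = 0" if "w \<in> X" for w using perpD(2)[OF candD(1)[OF x] that] .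
      moreover have "T - T' \<in> S"
        using E.subspace_diff[OF subspace_S is_T_S[OF T annD(1)[OF f]] is_T_S[OF T'(2) annD(1)[OF f]]] .
      ultimately show ?thesis unfolding ZS_def by (simp add: * del: minus_apply)
    qed
    then have "T' + (T - T') \<in> V" using E.subspace_add[OF levelD(2)[OF V] T'(1)] levelD(3)[OF V] by blast
    then show ?thesis by simp
  qed
  show "V = full X ?F"
  proof (intro antisym subsetI)
    fix u assume u: "u \<in> V"
    have uN: "u \<in> NS X" using levelD(4)[OF V] u by blast
    have "u x \<in> X" using good u by (auto simp: orb_def)
    then obtain t where t: "t \<in> ZS X" "u - t \<in> stab V x"
      using ZS_correction[OF V u candD(1,2)[OF x]] by blast
    have "u - t \<in> nxt X V x" using t(2) stab_subset_nxt by blast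
    then have ut: "u - t \<in> full (ext X x) F" using nxt by simp
    have "u ` F i \<subseteq> F i" if i: "Suc (dim X) \<le> i" "i \<le> \<nu>" for i
    proof clarify
      fix z assume z: "z \<in> F i"
      have "(u - t) z \<in> F i" using ut i z d by (auto simp: full_def)
      moreover have "t z \<in> F i" using Fi(1,4)[OF i] ZS_D(3)[OF t(1)] z by blast
      ultimately have "(u - t) z + t z \<in> F i" by (rule subspace_add[OF Fi(2)[OF i]])
      then show "u z \<in> F i" by simp
    qed
    moreover have "u ` X \<subseteq> X" using NS_D(3)[OF uN] subspace_0[OF sX] by auto
    ultimately show "u \<in> full X ?F" using uN by (auto simp: full_def Suc_le_eq)
  next
    fix u assume u: "u \<in> full X ?F"
    have uN: "u \<in> NS X" using u by (simp add: full_def)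
    have "u ` ?F (Suc (dim X)) \<subseteq> ?F (Suc (dim X))" using u dn unfolding full_def by (metis (mono_tags, lifting) le_SucI mem_Collect_eq order_refl)
    then have "u x \<in> ext X x" using F1 ext_superset(2)[of x X] by auto
    then obtain c w where cw: "u x = c *s x + w" "w \<in> X" using ext_elim[OF sX] by blast
    \<comment> \<open>Stability of \<open>ext X x\<close> only makes \<open>x\<close> an eigenvector
      modulo \<open>X\<close>; nilpotency removes the eigenvalue.\<close>
    have "c = 0" using nilpotent_eigen[OF uN cw(2,1) candD(2)[OF x] sX] .
    then have "u x \<in> X" using cw by simp
    then obtain t where t: "t \<in> ZS X" "t x = u x" using ZS_reach[OF levelD(1)[OF V] candD(1,2)[OF x]] by blast
    have nt: "- t \<in> ZS X" using E.subspace_neg[OF subspace_ZS[OF sX] t(1)] .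
    define s where "s = u - t"
    have s: "s z = u z - t z" for z by (simp add: s_def)
    have sN: "s \<in> NS X" using NS_add_ZS[OF sX uN nt] by (simp add: s_def)
    have "s x = 0" using t(2) by (simp add: s)
    then have "s \<in> NS (ext X x)"
      using NS_D[OF sN] S_kill_ext[OF NS_D(1)[OF sN] NS_D(3)[OF sN] _ sX] by (auto simp: NS_def)
    moreover have "s ` F i \<subseteq> F i" if i: "Suc (dim X) \<le> i" "i \<le> \<nu>" for i
    proof clarify
      fix z assume z: "z \<in> F i"
      have "u ` ?F i \<subseteq> ?F i" using u i unfolding full_def by (simp del: fun_upd_apply)
      then have "u z \<in> F i" using z i by auto
      moreover have "t z \<in> F i" using Fi(1,4)[OF i] ZS_D(3)[OF t(1)] z by blast
      ultimately show "s z \<in> F i" unfolding s by (rule subspace_diff[OF Fi(2)[OF i]])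
    qed
    ultimately have "s \<in> nxt X V x" unfolding nxt by (simp add: full_def d)
    then obtain v f T where v: "v \<in> stab V x" "f \<in> ann (ext X x)" "is_T x f T" "s = v + T"
      using nxt_decompose[OF V x] by blast
    then have "s \<in> V" using T_V E.subspace_add[OF levelD(2)[OF V]] by (auto simp: stab_def)
    then have "s + t \<in> V" using E.subspace_add[OF levelD(2)[OF V]] t(1) levelD(3)[OF V] by blast
    then show "u \<in> V" by (simp add: s_def)
  qed
qed

end

section \<open>A vector mapped into the subspace by the whole space\<close>

text \<open>The last two assumptions are the equality case and the induction hypothesis. They are
  needed for every candidate because the right one is found only later.\<close>

locale tight_level = sym_form scale Basis b
  for scale :: "'k::field \<Rightarrow> 'v::ab_group_add \<Rightarrow> 'v" (infixr \<open>*s\<close> 75) and Basis and b +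
  fixes X :: "'v set" and V :: "('v \<Rightarrow> 'v) set"
  assumes V: "level X V"
    and tens_reach: "\<And>x. cand X x \<Longrightarrow> tens X V x = ann (reach V x)"
    and next_flag: "\<And>x. cand X x \<Longrightarrow> \<exists>F. flag_from (ext X x) F \<and> nxt X V x = full (ext X x) F"
begin

text \<open>For a candidate this says that \<open>x\<close> is orthogonal to
  \<open>reach V x\<close>, that is, that \<open>b x\<close> is itself in
  \<open>tens X V x\<close>.\<close>

definition iso :: "'v \<Rightarrow> bool" where
  "iso x \<longleftrightarrow> cand X x \<and> (\<forall>u\<in>V. b x (u x) = 0)"

lemmas V_sub = levelD(2)[OF V] and V_S = level_apply(1)[OF V] and sX = levelD(5)[OF V]

lemma V_apply: "u \<in> V \<Longrightarrow> u (p + q) = u p + u q" "u \<in> V \<Longrightarrow> u (c *s p) = c *s u p"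
  "u \<in> V \<Longrightarrow> u (p - q) = u p - u q" "u \<in> V \<Longrightarrow> u 0 = 0"
  using S_add S_scale S_diff S_zero V_S by auto

lemma reach_funpow:
  assumes x: "cand X x" and v: "v \<in> V"
  shows "(v ^^ k) x \<in> reach V x"
proof (rule ccontr)
  assume "(v ^^ k) x \<notin> reach V x"
  then obtain f where f: "f \<in> ann (reach V x)" "f ((v ^^ k) x) = 1" using ann_separates[OF subspace_reach] by blast
  then obtain T where "T \<in> V" "is_T x f T" using tens_reach[OF x] by (auto simp: tens_def)
  then show False using tensor_annihilates(1)[OF V _ _ annD(1)[OF f(1)] v] f(2) by simp
qed

lemma reach_square:
  assumes "cand X x" "v \<in> V"
  shows "v (v x) \<in> reach V x"
  using reach_funpow[OF assms, of 2] by (simp add: numeral_2_eq_2)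

text \<open>Polarisation of \<open>reach_square\<close>. The single products need not send
  \<open>x\<close> into \<open>reach V x\<close>, as \<open>V\<close> is not closed under
  composition.\<close>

lemma reach_cross:
  assumes x: "cand X x" and uv: "u \<in> V" "v \<in> V"
  shows "u (v x) + v (u x) \<in> reach V x"
proof -
  have "(u + v) ((u + v) x) \<in> reach V x" using reach_square[OF x E.subspace_add[OF V_sub uv]] .
  then have "(u + v) ((u + v) x) - u (u x) - v (v x) \<in> reach V x"
    using reach_square[OF x] uv subspace_diff[OF subspace_reach] by blast
  moreover have "(u + v) ((u + v) x) - u (u x) - v (v x) = u (v x) + v (u x)"
    using uv by (simp add: V_apply)
  ultimately show ?thesis by simp
qed

lemma reach_perp: "cand X x \<Longrightarrow> reach V x \<subseteq> perp X"
  unfolding reach_def orb_def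
  using candD(1) level_apply(4)[OF V] by (intro span_minimal[OF _ subspace_perp]) auto

text \<open>For nonradical \<open>x\<close>, \<open>V\<close> contains a tensor
  \<open>x \<otimes> x\<close> because \<open>b x\<close> annihilates the reach. So
  \<open>tensor_annihilates\<close> gives \<open>b x (v (v x)) = 0\<close>, which is the square of
  \<open>v x\<close>; polarising gives the rest.\<close>

lemma reach_ts:
  assumes x: "iso x"
  shows "ts (reach V x)"
proof -
  have c: "cand X x" and z: "\<And>u. u \<in> V \<Longrightarrow> b x (u x) = 0" using x by (auto simp: iso_def)
  have sq: "b (v x) (v x) = 0" if v: "v \<in> V" for v
  proof -
    have "b x ((v ^^ 2) x) = 0"
    proof (cases "x \<in> R")
      case False
      have "b x \<in> ann (insert x (orb V x))"
        using form_linear z candD(3)[OF c] by (auto simp: ann_def orb_def)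
      then have "b x \<in> tens X V x" using tens_reach[OF c] by (simp add: reach_def ann_span)
      then obtain T where "T \<in> V" "is_T x (b x) T" by (auto simp: tens_def)
      then show ?thesis using tensor_annihilates(1)[OF V _ _ form_linear(1) v] by blast
    qed (simp add: R_form)
    then show ?thesis using S_sym[OF V_S[OF v], of x "v x"] by (simp add: numeral_2_eq_2)
  qed
  have cr: "b (u x) (v x) = 0" if uv: "u \<in> V" "v \<in> V" for u v
  proof -
    have "b ((u + v) x) ((u + v) x) = 0" by (rule sq[OF E.subspace_add[OF V_sub uv]])
    then have "b (u x) (v x) + b (u x) (v x) = 0"
      using sq[OF uv(1)] sq[OF uv(2)] form_commute[of "v x" "u x"] by simp
    then show ?thesis by (rule double_eq_zero)
  qed
  have "b p q = 0" if pq: "p \<in> reach V x" "q \<in> reach V x" for p q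
  proof -
    obtain s u where u: "u \<in> V" "p = s *s x + u x" using pq(1) reach_mem[OF V_sub] by blast
    obtain t v where v: "v \<in> V" "q = t *s x + v x" using pq(2) reach_mem[OF V_sub] by blast
    show ?thesis
      using u v z cr candD(3)[OF c] form_commute[of "u x" x] by simp
  qed
  then show ?thesis by (simp add: totally_singular_def)
qed

lemma stab_reach:
  assumes x: "cand X x" and u: "u \<in> stab V x" and p: "p \<in> reach V x"
  shows "u p \<in> reach V x"
proof -
  have uV: "u \<in> V" "u x = 0" using u by (auto simp: stab_def)
  obtain c v where v: "v \<in> V" "p = c *s x + v x" using p reach_mem[OF V_sub] by blast
  have "u p = u (v x) + v (u x)" using uV v by (simp add: V_apply)
  then show ?thesis using reach_cross[OF x uV(1) v(1)] by simp
qed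

lemma nxt_reach:
  assumes x: "iso x" and t: "t \<in> nxt X V x" and p: "p \<in> reach V x"
  shows "t p \<in> reach V x"
proof -
  have c: "cand X x" using x by (simp add: iso_def)
  obtain u f T where ut: "u \<in> stab V x" "f \<in> ann (ext X x)" "is_T x f T" "t = u + T"
    using nxt_decompose[OF V c t] .
  have "T p = f p *s x"
    using is_T_apply[OF ut(3)] tsD[OF reach_ts[OF x] reach_superset(1) p] by simp
  then show ?thesis
    using stab_reach[OF c ut(1) p] subspace_add[OF subspace_reach] subspace_scale[OF subspace_reach reach_superset(1)] ut(4)
    by simp
qed

text \<open>Expand the cube of \<open>u + v\<close> at \<open>x\<close> using
  \<open>u x = 0\<close>: of the four remaining terms, all others lie in the reach.\<close>

lemma reach_cube:
  assumes x: "cand X x" and u: "u \<in> stab V x" and v: "v \<in> V"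
  shows "v (u (v x)) \<in> reach V x"
proof -
  have uV: "u \<in> V" "u x = 0" using u by (auto simp: stab_def)
  define s where "s = u + v"
  have s: "s z = u z + v z" for z by (simp add: s_def)
  have sV: "s \<in> V" using E.subspace_add[OF V_sub uV(1) v] by (simp add: s_def)
  have 3: "s (s (s x)) \<in> reach V x" "v (v (v x)) \<in> reach V x"
    using reach_funpow[OF x sV, of 3] reach_funpow[OF x v, of 3] by (simp_all add: numeral_3_eq_3)
  have 4: "u (u (v x)) \<in> reach V x" "u (v (v x)) \<in> reach V x"
    using stab_reach[OF x u] reach_superset(2)[OF v] reach_square[OF x v] by blast+
  have "v (u (v x)) = s (s (s x)) - v (v (v x)) - u (u (v x)) - u (v (v x))"
    using uV v by (simp add: s V_apply)
  then show ?thesis using 3 4 subspace_diff[OF subspace_reach] by simp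
qed

lemma reach_cube_cross:
  assumes x: "cand X x" and u: "u \<in> stab V x" and vw: "v \<in> V" "w \<in> V"
  shows "v (u (w x)) + w (u (v x)) \<in> reach V x"
proof -
  have uV: "u \<in> V" using u by (auto simp: stab_def)
  have "(v + w) (u ((v + w) x)) - v (u (v x)) - w (u (w x)) \<in> reach V x"
    using reach_cube[OF x u] E.subspace_add[OF V_sub vw] vw subspace_diff[OF subspace_reach] by blast
  moreover have "(v + w) (u ((v + w) x)) - v (u (v x)) - w (u (w x)) = v (u (w x)) + w (u (v x))"
    using uV vw by (simp add: V_apply)
  ultimately show ?thesis by simp
qed

lemma good_candidate:
  assumes ex: "iso x0"
  obtains x where "cand X x" "orb V x \<subseteq> X"
proof -
  obtain x where x: "iso x" and min: "\<And>z. iso z \<Longrightarrow> dim (orb V x) \<le> dim (orb V z)"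
    using ex_has_least_nat[of iso x0 "\<lambda>x. dim (orb V x)"] ex by blast
  have c: "cand X x" using x by (simp add: iso_def)
  have "orb V x \<subseteq> X"
  proof (rule ccontr)
    assume bad: "\<not> orb V x \<subseteq> X"
    note perpX = candD(1)[OF c] and notX = candD(2)[OF c]
    define P where "P = reach V x"
    have sP: "subspace P" by (simp add: P_def subspace_reach)
    have tP: "ts P" unfolding P_def by (rule reach_ts[OF x])
    have eP: "ext X x \<subseteq> P" unfolding P_def by (rule ext_subset_reach[OF V perpX notX])
    have XP: "X \<subseteq> P" and xP: "x \<in> P" using eP ext_superset(1)[of X x] ext_superset(2)[of x X] by auto
    have "\<not> dim (orb V x) \<le> dim X"
      using subspace_dim_equal[OF sX subspace_orb[OF V_sub] orb_superset[OF V perpX notX]] bad by auto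
    then have dP: "dim X + 2 \<le> dim P" unfolding P_def dim_reach[OF V notX] by simp
    have de: "dim (ext X x) = Suc (dim X)" using dim_ext[OF sX notX] .
    obtain F where F: "flag_from (ext X x) F" "nxt X V x = full (ext X x) F" using next_flag[OF c] by blast
    have aE: "adm (ext X x)" using adm_ext[OF levelD(1)[OF V] c] .
    have PF: "P = F (dim P)"
      by (rule invariant_in_flag[OF F(1) aE sP eP tP]) (use nxt_reach[OF x] F(2) in \<open>auto simp: P_def\<close>)
    \<comment> \<open>\<open>H\<close> is the flag member just below \<open>P\<close>. It still
      contains \<open>ext X x\<close>, as \<open>dim P\<close> exceeds \<open>dim X\<close> by at
      least two.\<close>
    define i where "i = dim P - 1"
    define H where "H = F i"
    have i: "dim (ext X x) \<le> i" "i \<le> \<nu>" "Suc i = dim P" "dim P \<le> \<nu>"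
      using dP de dim_le_witt[OF sP tP] by (auto simp: i_def)
    have aH: "adm H" unfolding H_def by (rule flag_adm[OF F(1) aE i(1,2)])
    have sH: "subspace H" using adm_D(1)[OF aH] .
    have dH: "dim H = i" unfolding H_def using flagD(6)[OF F(1) i(1,2)] .
    have "F i \<subseteq> F (dim P)" by (rule flag_mono[OF F(1) i(1) _ i(4)]) (use i in simp)
    then have HP: "H \<subseteq> P" using PF by (simp add: H_def)
    have eH: "ext X x \<subseteq> H" unfolding H_def using flag_mono[OF F(1) order_refl i(1,2)] flagD(1)[OF F(1)] by simp
    have xH: "x \<in> H" using eH ext_superset(2)[of x X] by blast
    have "\<exists>v\<in>V. v x \<notin> H"
    proof (rule ccontr)
      assume "\<not> (\<exists>v\<in>V. v x \<notin> H)"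
      then have "P \<subseteq> H" unfolding P_def reach_def
        using xH by (intro span_minimal[OF _ sH]) (auto simp: orb_def)
      then show False using dim_subset[of P H] dH i by simp
    qed
    then obtain v0 where v0: "v0 \<in> V" "v0 x \<notin> H" by blast
    \<comment> \<open>On \<open>P\<close> the kernel of \<open>g\<close> is \<open>H\<close>, and
      \<open>v0 x\<close> spans \<open>P\<close> over \<open>H\<close>.\<close>
    obtain g where g: "g \<in> ann H" "g (v0 x) = 1" using ann_separates[OF sH v0(2)] .
    note lg = lfD[OF annD(1)[OF g(1)]]
    have gH: "g h = 0" if "h \<in> H" for h using annD(2)[OF g(1) that] .
    have vxP: "v x \<in> P" if "v \<in> V" for v unfolding P_def by (rule reach_superset(2)[OF that])
    have "ext H (v0 x) = P"
    proof (rule subspace_dim_equal[OF subspace_ext sP ext_least[OF sP HP vxP[OF v0(1)]]])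
      show "dim P \<le> dim (ext H (v0 x))" using dim_ext[OF sH v0(2)] dH i by simp
    qed
    then have split: "p - g p *s v0 x \<in> H" if p: "p \<in> P" for p
    proof -
      obtain c h where h: "p = c *s v0 x + h" "h \<in> H" using ext_elim[OF sH] \<open>ext H (v0 x) = P\<close> p by metis
      then have "g p = c" using lg gH g(2) by simp
      then show ?thesis using h by simp
    qed
    have red: "\<exists>w\<in>V. v = w + fun_scale scale (g (v x)) v0 \<and> g (w x) = 0 \<and> w x \<in> H" if v: "v \<in> V" for v
    proof -
      define w where "w = v - fun_scale scale (g (v x)) v0"
      have w: "w \<in> V" unfolding w_def using E.subspace_diff[OF V_sub v E.subspace_scale[OF V_sub v0(1)]] .
      have "w x = v x - g (v x) *s v0 x" by (simp add: w_def fun_scale_def)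
      then have "w x \<in> H" using split[OF vxP[OF v]] by simp
      then show ?thesis using w gH by (intro bexI[of _ w]) (auto simp: w_def)
    qed
    \<comment> \<open>The tensor of \<open>z\<close> with \<open>g\<close> lies in
      \<open>nxt\<close>; removing a tensor with \<open>x\<close> gives an operator of
      \<open>V\<close> itself. On the totally singular \<open>P\<close> both tensors reduce to their
      first term, so the rank there is at most two.\<close>
    have lift: "\<exists>u f. u \<in> stab V x \<and> f \<in> ann (ext X x) \<and> (\<forall>p\<in>P. u p = g p *s z - f p *s x)" if z: "z \<in> H" for z
    proof -
      obtain T where T: "is_T z g T" using is_T_ex[OF aH z g(1)] .
      have "T \<in> nxt X V x"
        unfolding F(2) by (rule is_T_full[OF F(1) aE i(1,2) z[unfolded H_def] g(1)[unfolded H_def] T])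
      then obtain u f T' where u: "u \<in> stab V x" "f \<in> ann (ext X x)" "is_T x f T'" "T = u + T'"
        using nxt_decompose[OF V c] by blast
      have "u p = g p *s z - f p *s x" if p: "p \<in> P" for p
      proof -
        have "b z p = 0" "b x p = 0" using tsD[OF tP] HP z xP p by blast+
        then have "T p = g p *s z" "T' p = f p *s x" using is_T_apply T u(3) by blast+
        moreover have "T p = u p + T' p" by (simp add: u(4))
        ultimately show ?thesis by (simp add: algebra_simps)
      qed
      then show ?thesis using u by blast
    qed
    note P_add = subspace_add[OF sP] and P_diff = subspace_diff[OF sP] and P_scale = subspace_scale[OF sP]
    \<comment> \<open>As \<open>u (v0 x)\<close> is \<open>z\<close> up to a multiple of
      \<open>x\<close>, \<open>reach_cube\<close> isolates \<open>v0 z\<close>. The part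
      \<open>w\<close> of \<open>v\<close> with \<open>g (w x) = 0\<close> is treated with the cross
      term.\<close>
    have VH: "v z \<in> P" if v: "v \<in> V" and z: "z \<in> H" for v z
    proof -
      obtain u f where u: "u \<in> stab V x" "\<And>p. p \<in> P \<Longrightarrow> u p = g p *s z - f p *s x" using lift[OF z] by blast
      have uv0: "u (v0 x) = z - f (v0 x) *s x" using u(2)[OF vxP[OF v0(1)]] g(2) by simp
      have "v0 (u (v0 x)) \<in> P" using reach_cube[OF c u(1) v0(1)] by (simp add: P_def)
      then have "v0 (u (v0 x)) + f (v0 x) *s v0 x \<in> P" using P_add P_scale vxP[OF v0(1)] by blast
      then have 0: "v0 z \<in> P" using v0(1) by (simp add: uv0 V_apply)
      obtain w where w: "w \<in> V" "v = w + fun_scale scale (g (v x)) v0" "g (w x) = 0" using red[OF v] by blast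
      have uw: "u (w x) = - (f (w x) *s x)" using u(2)[OF vxP[OF w(1)]] w(3) by simp
      have v0u: "v0 (u (w x)) = - (f (w x) *s v0 x)" using v0(1) unfolding uw by (simp add: S_minus V_S V_apply)
      have wu: "w (u (v0 x)) = w z - f (v0 x) *s w x" using w(1) unfolding uv0 by (simp add: V_apply)
      have "v0 (u (w x)) + w (u (v0 x)) \<in> P" using reach_cube_cross[OF c u(1) v0(1) w(1)] by (simp add: P_def)
      then have "v0 (u (w x)) + w (u (v0 x)) + f (w x) *s v0 x + f (v0 x) *s w x \<in> P"
        using P_add P_scale vxP[OF v0(1)] vxP[OF w(1)] by blast
      then have 1: "w z \<in> P" unfolding v0u wu by (simp add: algebra_simps)
      have "v z = w z + g (v x) *s v0 z" using w(2) by (metis plus_fun_apply fun_scale_def)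
      then show ?thesis using 0 1 P_add P_scale by simp
    qed
    have VP: "v p \<in> P" if v: "v \<in> V" and p: "p \<in> P" for v p
    proof -
      have vv: "v (v0 x) \<in> P" if v: "v \<in> V" for v
      proof -
        obtain w where w: "w \<in> V" "v = w + fun_scale scale (g (v x)) v0" "w x \<in> H" using red[OF v] by blast
        have "w (v0 x) + v0 (w x) \<in> P" using reach_cross[OF c w(1) v0(1)] by (simp add: P_def)
        then have "w (v0 x) + v0 (w x) - v0 (w x) \<in> P" using P_diff VH[OF v0(1) w(3)] by blast
        moreover have "v0 (v0 x) \<in> P" using reach_square[OF c v0(1)] by (simp add: P_def)
        moreover have "v (v0 x) = w (v0 x) + g (v x) *s v0 (v0 x)" using w(2) by (metis plus_fun_apply fun_scale_def)
        ultimately show ?thesis using P_add P_scale by simp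
      qed
      have "v p = v (p - g p *s v0 x) + g p *s v (v0 x)" using v by (simp add: V_apply)
      then show ?thesis using VH[OF v split[OF p]] vv[OF v] P_add P_scale by simp
    qed
    have PR: "R \<subseteq> X \<or> P \<subseteq> R"
    proof (cases "R \<subseteq> X")
      case False
      then have "x \<in> R" using candD(4)[OF c] by blast
      then have "P \<subseteq> R" unfolding P_def reach_def
        using S_R V_S by (intro span_minimal[OF _ subspace_R]) (auto simp: orb_def)
      then show ?thesis by simp
    qed simp
    \<comment> \<open>\<open>V\<close> preserves the totally singular \<open>P\<close>, so
      \<open>z\<close> is again \<open>iso\<close>, and minimality excludes a smaller reach.\<close>
    have Pz: "reach V z = P" if z: "z \<in> P" "z \<notin> X" for z
    proof -
      have "z \<in> perp X" using ts_perp[OF tP] perp_antimono[OF XP] z(1) by blast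
      then have cz: "cand X z" using z PR tsD[OF tP] by (auto simp: cand_def)
      then have "iso z" using VP tsD[OF tP] z(1) by (simp add: iso_def)
      then have "dim P \<le> dim (reach V z)"
        using min dim_reach[OF V z(2)] dim_reach[OF V notX] by (simp add: P_def)
      moreover have "reach V z \<subseteq> P"
        unfolding reach_def using VP z(1) by (intro span_minimal[OF _ sP]) (auto simp: orb_def)
      ultimately show ?thesis using subspace_dim_equal[OF subspace_reach sP] by blast
    qed
    \<comment> \<open>Both cases below end by producing a functional that kills \<open>z\<close> and
      all \<open>v z\<close> without vanishing on \<open>P\<close>.\<close>
    have no_ann: "f p = 0" if z: "z \<in> P" "z \<notin> X" and f: "lf f" "f z = 0" "\<And>v. v \<in> V \<Longrightarrow> f (v z) = 0"
      and p: "p \<in> P" for f z p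
    proof -
      obtain c v where "v \<in> V" "p = c *s z + v z" using p Pz[OF z] reach_mem[OF V_sub] by blast
      then show ?thesis using f by (simp add: lfD[OF f(1)])
    qed
    have nilV: "nilpotent_endo v" if "v \<in> V" for v using level_apply(2)[OF V that] .
    show False
    proof (cases "dim P = dim X + 2")
      case True
      have v0N: "v0 \<in> NS X" using levelD(4)[OF V] v0(1) by blast
      have "v0 x \<notin> X" using v0(2) eH ext_superset(1)[of X x] by blast
      then obtain j where j: "1 \<le> j" "(v0 ^^ j) x \<notin> X" "v0 ((v0 ^^ j) x) \<in> X"
        using last_power[OF sX v0N perpX] by blast
      \<comment> \<open>Modulo \<open>X\<close> the vectors \<open>q\<close>, \<open>y\<close> form
        a basis of \<open>P\<close> on which \<open>v0\<close> is a single Jordan block, so its rank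
        there is one.\<close>
      define y q where "y = (v0 ^^ j) x" and "q = (v0 ^^ (j - 1)) x"
      have yP: "y \<in> P" and qP: "q \<in> P" using reach_funpow[OF c v0(1)] by (auto simp: y_def q_def P_def)
      have v0q: "v0 q = y" using j(1) by (cases j) (auto simp: y_def q_def)
      have y: "y \<notin> X" "v0 y \<in> X" using j by (auto simp: y_def)
      have q: "q \<notin> ext X y"
      proof
        assume "q \<in> ext X y"
        then obtain c w where "q = c *s y + w" "w \<in> X" using ext_elim[OF sX] by blast
        then have "y = c *s v0 y" using v0q NS_D(3)[OF v0N] v0(1) by (simp add: V_apply)
        then show False using y subspace_scale[OF sX y(2), of c] by simp
      qed
      obtain h where h: "h \<in> ann (ext X y)" "h q = 1" using ann_separates[OF subspace_ext q] .
      note lh = lfD[OF annD(1)[OF h(1)]]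
      have hX: "h w = 0" if "w \<in> X" for w using annD(2)[OF h(1)] ext_superset(1)[of X y] that by blast
      have hy: "h y = 0" using annD(2)[OF h(1)] ext_superset(2)[of y X] by blast
      have PE: "P = ext (ext X y) q"
      proof -
        have "ext (ext X y) q \<subseteq> P" by (rule ext_least[OF sP ext_least[OF sP XP yP] qP])
        moreover have "dim (ext (ext X y) q) = dim X + 2"
          using dim_ext[OF subspace_ext q] dim_ext[OF sX y(1)] by simp
        ultimately have "ext (ext X y) q = P"
          using subspace_dim_equal[OF subspace_ext sP, of "ext X y" q] True by simp
        then show ?thesis ..
      qed
      have v0p: "v0 p - (h p *s y + 0 *s y) \<in> X" if p: "p \<in> P" for p
      proof -
        obtain c r where r: "p = c *s q + r" "r \<in> ext X y" using ext_elim[OF subspace_ext] PE p by metis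
        obtain d w where w: "r = d *s y + w" "w \<in> X" using ext_elim[OF sX r(2)] .
        have "h p = c" using r(1) lh h(2) annD(2)[OF h(1) r(2)] by simp
        then have "v0 p - (h p *s y + 0 *s y) = d *s v0 y"
          using r(1) w v0q NS_D(3)[OF v0N w(2)] v0(1) by (simp add: V_apply)
        then show ?thesis using subspace_scale[OF sX y(2)] by simp
      qed
      \<comment> \<open>Perturb \<open>v\<close> by \<open>v0\<close>, which on \<open>P\<close> is
        \<open>h\<close> times \<open>y\<close> modulo \<open>X\<close>; with zero as second
        functional the trace identity alone suffices.\<close>
      have "h (v y) = 0" if v: "v \<in> V" for v
      proof -
        have zl: "lf (\<lambda>_. 0)" by (rule lfI) auto
        obtain a' d' where pol: "\<And>k. coeff a' k = h ((v ^^ k) y)" "\<And>k. coeff d' k = (0::'k)" "a' + d' = 0"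
          by (rule rank_two_perturbation[OF char S_linear[OF V_S[OF v]] S_linear[OF V_S[OF v0(1)]] nilV[OF v]
              nilV[OF E.subspace_add[OF V_sub v v0(1)]] nilV[OF E.subspace_diff[OF V_sub v v0(1)]]
              VP[OF v] yP yP sX level_apply(3)[OF V v] level_apply(3)[OF V v0(1)] hX _ annD(1)[OF h(1)] zl v0p])
            auto
        have "d' = 0" using pol(2) by (intro poly_eqI) simp
        then have "a' = 0" using pol(3) by simp
        then show ?thesis using pol(1)[of 1] by simp
      qed
      then show False using no_ann[OF yP y(1) annD(1)[OF h(1)] hy _ qP] h(2) by simp
    next
      case False
      have "\<not> H \<subseteq> ext X x"
        using dim_subset[of H "ext X x"] dH de i False dP by auto
      then obtain z where z: "z \<in> H" "z \<notin> ext X x" by blast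
      obtain u f where u: "u \<in> stab V x" "f \<in> ann (ext X x)" "\<And>p. p \<in> P \<Longrightarrow> u p = g p *s z - f p *s x"
        using lift[OF z(1)] by blast
      have uV: "u \<in> V" using u(1) by (simp add: stab_def)
      note lf' = lfD[OF annD(1)[OF u(2)]]
      have zP: "z \<in> P" using z(1) HP by blast
      have nf: "lf (\<lambda>p. - f p)" by (rule lfI) (auto simp: lf')
      have up: "u p - (g p *s z + (- f p) *s x) \<in> {0}" if "p \<in> P" for p using u(3)[OF that] by simp
      \<comment> \<open>Compare coefficients of degrees 1 and 2 in the determinant identity; the
        constant terms of \<open>a'\<close> and \<open>b'\<close> vanish because \<open>z\<close>
        and \<open>x\<close> lie in \<open>H\<close>.\<close>
      have key: "g (v x) * f z = 0 \<and> (f z = 0 \<longrightarrow> g (v x) = 0 \<longrightarrow> g (v z) = 0)" if v: "v \<in> V" for v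
      proof -
        obtain a' b' c' d' where pol: "\<And>k. coeff a' k = g ((v ^^ k) z)" "\<And>k. coeff b' k = g ((v ^^ k) x)"
            "\<And>k. coeff c' k = - f ((v ^^ k) z)" "\<And>k. coeff d' k = - f ((v ^^ k) x)" "a' + d' = 0" "a' * d' = b' * c'"
          by (rule rank_two_perturbation[OF char S_linear[OF V_S[OF v]] S_linear[OF V_S[OF uV]] nilV[OF v]
              nilV[OF E.subspace_add[OF V_sub v uV]] nilV[OF E.subspace_diff[OF V_sub v uV]]
              VP[OF v] zP xP subspace_single_0 _ _ _ _ annD(1)[OF g(1)] nf up])
            (use v uV lg lf' in \<open>auto simp: V_apply\<close>)
        have "d' = - a'" using pol(5) by (simp add: add_eq_0_iff)
        then have sq: "- (a' * a') = b' * c'" using pol(6) by simp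
        have a0: "coeff a' 0 = 0" "coeff b' 0 = 0" using pol(1)[of 0] pol(2)[of 0] gH z(1) xH by auto
        have "coeff (b' * c') 1 = - coeff (a' * a') 1" by (simp flip: sq)
        then have 1: "coeff b' 1 * coeff c' 0 = 0" using a0 by (simp add: coeff_mult)
        have "coeff (b' * c') 2 = - coeff (a' * a') 2" by (simp flip: sq)
        then have 2: "coeff b' 1 * coeff c' 1 + coeff b' 2 * coeff c' 0 = - (coeff a' 1 * coeff a' 1)"
          using a0 by (simp add: coeff_mult numeral_2_eq_2)
        have c0: "coeff c' 0 = - f z" and b1: "coeff b' 1 = g (v x)" and a1: "coeff a' 1 = g (v z)"
          using pol(1)[of 1] pol(2)[of 1] pol(3)[of 0] by auto
        show ?thesis using 1 2 unfolding c0 b1 a1 by auto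
      qed
      have fz: "f z = 0" using key[OF v0(1)] g(2) by simp
      \<comment> \<open>By \<open>key\<close>, \<open>g (v z)\<close> vanishes wherever
        \<open>g (v x)\<close> does, so they are proportional as functionals of \<open>v\<close>,
        and the factor is read off at \<open>v0\<close>. Hence \<open>g\<close> kills
        \<open>v (z - l *s x)\<close> for all \<open>v\<close>.\<close>
      define l where "l = g (v0 z)"
      have gvz: "g (v z) = l * g (v x)" if v: "v \<in> V" for v
      proof -
        obtain w where w: "w \<in> V" "v = w + fun_scale scale (g (v x)) v0" "g (w x) = 0" using red[OF v] by blast
        have "g (w z) = 0" using key[OF w(1)] fz w(3) by blast
        moreover have "v z = w z + g (v x) *s v0 z" using w(2) by (metis plus_fun_apply fun_scale_def)
        ultimately show ?thesis using lg by (simp add: l_def)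
      qed
      define y where "y = z - l *s x"
      have yP: "y \<in> P" using zP xP P_diff P_scale by (simp add: y_def)
      have "y \<notin> X"
      proof
        assume "y \<in> X"
        then have "z \<in> ext X x" using ext_mem[OF sX] by (auto simp: y_def)
        then show False using z(2) by blast
      qed
      moreover have "g y = 0" using gH z(1) xH lg by (simp add: y_def)
      moreover have "g (v y) = 0" if "v \<in> V" for v using gvz[OF that] lg that by (simp add: y_def V_apply)
      ultimately have "g (v0 x) = 0" using no_ann[OF yP _ annD(1)[OF g(1)] _ _ vxP[OF v0(1)]] by blast
      then show False using g(2) by simp
    qed
  qed
  with c that show ?thesis by blast
qed

end

section \<open>Vectors orthogonal to their orbit, over infinite and finite fields\<close>

context sym_form
begin

text \<open>The ranges of the powers shrink strictly until they are zero. The uniform exponent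
  ensures that a maximal nilindex exists.\<close>

lemma nilpotent_index:
  assumes u: "u \<in> S" "nilpotent_endo u"
  shows "(u ^^ dim UNIV) z = 0"
proof -
  define I where "I k = range (u ^^ k)" for k
  have lin: "Vector_Spaces.linear scale scale (u ^^ k)" for k using linear_funpow[OF S_linear[OF u(1)]] .
  have sI: "subspace (I k)" for k
  proof -
    interpret k: Vector_Spaces.linear scale scale "u ^^ k" by (rule lin)
    show ?thesis unfolding I_def by (rule k.subspace_image[OF subspace_UNIV])
  qed
  have image: "I (Suc k) = u ` I k" for k by (auto simp: I_def image_image)
  have desc: "I (Suc k) \<subseteq> I k" for k by (auto simp: I_def funpow_swap1)
  obtain K where "\<And>k x. K \<le> k \<Longrightarrow> (u ^^ k) x = 0" using nilpotent_endo_funpow[OF u(2)] by blast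
  then have IK: "I k = {0}" if "K \<le> k" for k using that by (auto simp: I_def)
  have "dim (I k) + k \<le> dim UNIV \<or> I k = {0}" for k
  proof (induction k)
    case 0
    then show ?case using dim_subset[OF subset_UNIV, of "I 0"] by simp
  next
    case (Suc k)
    show ?case
    proof (cases "I (Suc k) = I k")
      case True
      have "I (k + j) = I k" for j
      proof (induction j)
        case (Suc j)
        then show ?case using image[of "k + j"] image[of k] True by simp
      qed simp
      then have "I k = {0}" using IK[of "k + K"] by simp
      then show ?thesis using True by simp
    next
      case False
      then have "dim (I (Suc k)) < dim (I k)"
        using subspace_dim_equal[OF sI sI desc] by force
      moreover have "I (Suc k) = {0}" if "I k = {0}"
        using image[of k] that S_zero[OF u(1)] by simp
      ultimately show ?thesis using Suc by auto
    qed
  qed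
  from this[of "dim UNIV"] have "I (dim UNIV) = {0}"
  proof
    assume "dim (I (dim UNIV)) + dim UNIV \<le> dim UNIV"
    then have "dim (I (dim UNIV)) \<le> dim {0}" by simp
    then show ?thesis using subspace_dim_equal[OF subspace_single_0 sI] subspace_0[OF sI] by auto
  qed
  then show ?thesis by (auto simp: I_def)
qed

text \<open>The linear coefficient is the first order variation of the power in the direction
  \<open>v\<close>; it is the only one needed later.\<close>

lemma pencil_power_poly:
  assumes u: "u \<in> S" and v: "v \<in> S"
  shows "\<exists>p. (\<forall>t. poly p t = b c (((\<lambda>z. u z + t *s v z) ^^ m) a))
    \<and> coeff p 1 = (\<Sum>i<m. b c ((u ^^ i) (v ((u ^^ (m - 1 - i)) a))))"
proof (induction m arbitrary: a)
  case 0
  show ?case by (rule exI[of _ "[:b c a:]"]) simp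
next
  case (Suc m)
  let ?N = "\<lambda>t z. u z + t *s v z"
  have SN: "?N t \<in> S" for t
  proof -
    have "?N t = u + fun_scale scale t v" by (auto simp: fun_scale_def)
    then show ?thesis using E.subspace_add[OF subspace_S u E.subspace_scale[OF subspace_S v]] by simp
  qed
  obtain p where p: "\<And>t. poly p t = b c ((?N t ^^ m) (u a))"
      "coeff p 1 = (\<Sum>i<m. b c ((u ^^ i) (v ((u ^^ (m - 1 - i)) (u a)))))"
    using Suc.IH[of "u a"] by blast
  obtain q where q: "\<And>t. poly q t = b c ((?N t ^^ m) (v a))"
    using Suc.IH[of "v a"] by blast
  have q0: "coeff q 0 = b c ((u ^^ m) (v a))" using q[of 0] by (simp add: poly_0_coeff_0)
  have "poly (p + pCons 0 q) t = b c ((?N t ^^ Suc m) a)" for t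
  proof -
    have "(?N t ^^ Suc m) a = (?N t ^^ m) (u a + t *s v a)" by (simp only: funpow_Suc_right o_apply)
    also have "\<dots> = (?N t ^^ m) (u a) + t *s (?N t ^^ m) (v a)"
      by (simp add: S_pow_add[OF SN] S_pow_scale[OF SN])
    finally show ?thesis by (simp add: p(1) q)
  qed
  moreover have "coeff (p + pCons 0 q) 1 = (\<Sum>i<Suc m. b c ((u ^^ i) (v ((u ^^ (Suc m - 1 - i)) a))))"
  proof -
    have "(u ^^ (m - 1 - i)) (u a) = (u ^^ (m - i)) a" if "i < m" for i
    proof -
      have "m - i = Suc (m - 1 - i)" using that by simp
      then show ?thesis by (simp only: funpow_Suc_right o_apply)
    qed
    then show ?thesis using p(2) q0 by simp
  qed
  ultimately show ?case by blast
qed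

end

context tight_level
begin

text \<open>With \<open>j\<close> maximal, the power \<open>Suc j\<close> of every
  \<open>u + t v\<close> sends \<open>a\<close> into \<open>X\<close>, so its pairing with
  \<open>x = (u ^^ j) a\<close> is a polynomial in \<open>t\<close> vanishing everywhere. In its
  linear coefficient a positive power of \<open>u\<close> on the left moves over to \<open>x\<close>
  and gives zero; what is left is \<open>b x (v x)\<close>.\<close>

lemma iso_exists_infinite:
  assumes inf: "infinite (UNIV :: 'k set)" and RX: "R \<subseteq> X" and ZV: "\<not> V \<subseteq> ZS X"
  obtains x where "iso x"
proof -
  define Q where "Q j \<longleftrightarrow> (\<exists>u\<in>V. \<exists>a\<in>perp X. (u ^^ j) a \<notin> X)" for j
  obtain u0 where u0: "u0 \<in> V" "u0 \<notin> ZS X" using ZV by blast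
  then obtain a0 where "a0 \<in> perp X" "u0 a0 \<notin> X"
    using V_S level_apply(3)[OF V] by (auto simp: ZS_def)
  then have Q1: "Q 1" using u0(1) by (auto simp: Q_def)
  have X_pow: "(u ^^ k) w \<in> X" if "u \<in> V" "w \<in> X" for u k w
  proof (induction k)
    case (Suc k)
    then have "u ((u ^^ k) w) = 0" using level_apply(3)[OF V that(1)] by blast
    then show ?case using subspace_0[OF sX] by simp
  qed (use that in simp)
  have bound: "j \<le> dim UNIV" if Qj: "Q j" for j
  proof (rule ccontr)
    assume j: "\<not> j \<le> dim UNIV"
    obtain u a where u: "u \<in> V" "(u ^^ j) a \<notin> X" using Qj by (auto simp: Q_def)
    have "j = dim UNIV + (j - dim UNIV)" using j by linarith
    then have "(u ^^ j) a = (u ^^ dim UNIV) ((u ^^ (j - dim UNIV)) a)" by (metis funpow_add o_apply)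
    then show False
      using nilpotent_index[OF V_S[OF u(1)] level_apply(2)[OF V u(1)]] u(2) subspace_0[OF sX] by simp
  qed
  define j where "j = (GREATEST j. Q j)"
  have Qj: "Q j" unfolding j_def by (rule GreatestI_nat[of Q 1 "dim UNIV"]) (use Q1 bound in auto)
  have j1: "1 \<le> j" unfolding j_def by (rule Greatest_le_nat[of Q 1 "dim UNIV"]) (use Q1 bound in auto)
  have "\<not> Q (Suc j)" using Greatest_le_nat[of Q "Suc j" "dim UNIV"] bound unfolding j_def by auto
  then have top: "(u ^^ Suc j) a \<in> X" if "u \<in> V" "a \<in> perp X" for u a using that unfolding Q_def by blast
  obtain u a where u: "u \<in> V" "a \<in> perp X" "(u ^^ j) a \<notin> X" using Qj by (auto simp: Q_def)
  define x where "x = (u ^^ j) a"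
  have xp: "x \<in> perp X"
    using j1 level_apply(4)[OF V u(1)] by (cases j) (auto simp: x_def)
  have ux: "(u ^^ i) x \<in> X" if "1 \<le> i" for i
  proof -
    have "(u ^^ i) x = (u ^^ (i + j)) a" by (simp add: x_def funpow_add)
    also have "i + j = (i - 1) + Suc j" using that by simp
    also have "(u ^^ ((i - 1) + Suc j)) a = (u ^^ (i - 1)) ((u ^^ Suc j) a)" by (simp only: funpow_add o_apply)
    finally show ?thesis using X_pow[OF u(1) top[OF u(1,2)]] by simp
  qed
  have "b x x = b a ((u ^^ j) x)" using S_pow_sym[OF V_S[OF u(1)], of a j x] by (simp add: x_def)
  then have "b x x = 0" using perpD(2)[OF u(2) ux[OF j1]] by simp
  then have c: "cand X x" using xp u(3) RX by (simp add: cand_def x_def)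
  have "b x (v x) = 0" if v: "v \<in> V" for v
  proof -
    obtain p where p: "\<And>t. poly p t = b x (((\<lambda>z. u z + t *s v z) ^^ Suc j) a)"
      "coeff p 1 = (\<Sum>i<Suc j. b x ((u ^^ i) (v ((u ^^ (Suc j - 1 - i)) a))))"
      using pencil_power_poly[OF V_S[OF u(1)] V_S[OF v], of x "Suc j" a] by blast
    have "poly p t = 0" for t
    proof -
      have "(\<lambda>z. u z + t *s v z) = u + fun_scale scale t v" by (auto simp: fun_scale_def)
      then have "(\<lambda>z. u z + t *s v z) \<in> V"
        using E.subspace_add[OF V_sub u(1) E.subspace_scale[OF V_sub v]] by simp
      then have "((\<lambda>z. u z + t *s v z) ^^ Suc j) a \<in> X" using top u(2) by blast
      then show ?thesis unfolding p(1) by (rule perpD(2)[OF xp])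
    qed
    then have "p = 0" using poly_roots_finite[of p] inf by auto
    define s where "s i = b x ((u ^^ i) (v ((u ^^ (Suc j - 1 - i)) a)))" for i
    have "s i = 0" if "1 \<le> i" for i
    proof -
      have "s i = b ((u ^^ i) x) (v ((u ^^ (Suc j - 1 - i)) a))"
        unfolding s_def by (rule S_pow_sym[OF V_S[OF u(1)]])
      then show ?thesis using perpD(1)[OF level_apply(4)[OF V v] ux[OF that]] by simp
    qed
    then have "(\<Sum>i<Suc j. s i) = s 0" unfolding sum.lessThan_Suc_shift by simp
    moreover have "(\<Sum>i<Suc j. s i) = 0" using p(2) \<open>p = 0\<close> unfolding s_def by simp
    ultimately show ?thesis by (simp add: s_def x_def)
  qed
  then have "iso x" using c by (simp add: iso_def)
  then show ?thesis by (rule that)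
qed

text \<open>
  The operators \<open>v\<close> with \<open>b x (v x) = 0\<close> and those with \<open>b y (v y) = 0\<close> are two subspaces covering \<open>V\<close>.
\<close>

lemma iso_exists_if_reach_small:
  assumes c: "cand X x" and RX: "R \<subseteq> X" and small: "reach V x \<noteq> perp X"
  obtains z where "iso z"
proof -
  have Xr: "X \<subseteq> reach V x" using ext_subset_reach[OF V candD(1,2)[OF c]] ext_superset(1) by blast
  have pp: "perp (perp (reach V x)) = reach V x" using perp_perp[OF subspace_reach] Xr RX by blast
  \<comment> \<open>Otherwise applying \<open>perp\<close> once more would put \<open>perp X\<close>
    inside \<open>reach V x\<close>.\<close>
  have "\<not> perp (reach V x) \<subseteq> X"
    using perp_antimono[of "perp (reach V x)" X] pp reach_perp[OF c] small by blast
  then obtain y where y: "y \<in> perp (reach V x)" "y \<notin> X" by blast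
  have yp: "y \<in> perp X" using y(1) perp_antimono[OF Xr] by blast
  have xR: "x \<notin> R" using candD(2)[OF c] RX by blast
  have ann: "b y \<in> ann (reach V x)" using form_linear perpD(2)[OF y(1)] by (auto simp: ann_def)
  then obtain T where T: "T \<in> V" "is_T x (b y) T" using tens_reach[OF c] by (auto simp: tens_def)
  have dich: "(\<forall>k. b x ((v ^^ k) x) = 0) \<or> (\<forall>k. b y ((v ^^ k) y) = 0)" if "v \<in> V" for v
    using tensor_annihilates(2)[OF V T form_linear(1) that refl xR] .
  \<comment> \<open>Only the powers 0 and 1 matter: if \<open>b y y \<noteq> 0\<close>, the second
    alternative fails at power 0 for every \<open>v\<close>.\<close>
  have dich1: "b x (v x) = 0 \<or> b y (v y) = 0" "b y y \<noteq> 0 \<Longrightarrow> b x (v x) = 0" if v: "v \<in> V" for v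
  proof -
    have "(\<forall>k. b x ((v ^^ k) x) = 0) \<or> b y ((v ^^ 0) y) = 0 \<and> b y ((v ^^ 1) y) = 0" using dich[OF v] by blast
    moreover have "b x ((v ^^ 1) x) = 0" if "\<forall>k. b x ((v ^^ k) x) = 0" using that by blast
    ultimately show "b x (v x) = 0 \<or> b y (v y) = 0" "b y y \<noteq> 0 \<Longrightarrow> b x (v x) = 0" by auto
  qed
  show ?thesis
  proof (cases "b y y = 0")
    case False
    then have "iso x" using c dich1(2) by (simp add: iso_def)
    then show ?thesis by (rule that)
  next
    case True
    then have cy: "cand X y" using y yp RX by (simp add: cand_def)
    have "iso x \<or> iso y"
    proof (rule ccontr)
      assume "\<not> (iso x \<or> iso y)"
      then obtain v w where vw: "v \<in> V" "b x (v x) \<noteq> 0" "w \<in> V" "b y (w y) \<noteq> 0"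
        using c cy by (auto simp: iso_def)
      then have "b y (v y) = 0" "b x (w x) = 0" using dich1(1) by blast+
      then show False using dich1(1)[OF E.subspace_add[OF V_sub vw(1,3)]] vw by simp
    qed
    then show ?thesis using that by blast
  qed
qed

text \<open>
  Otherwise count the pairs of a candidate \<open>x\<close> and an operator \<open>u\<close> in \<open>V\<close>, not in \<open>ZS X\<close>, with \<open>u x \<in> X\<close>:
  every such \<open>u\<close> occurs, but a quadric has too few points for the small spaces attached to each \<open>x\<close>.
\<close>

lemma reach_small_finite:
  assumes fin: "finite (UNIV :: 'k set)" and RX: "R \<subseteq> X" and ZV: "\<not> V \<subseteq> ZS X" and x1: "cand X x1"
  obtains x where "cand X x" "reach V x \<noteq> perp X"
proof (rule ccontr)
  assume "\<not> thesis"
  \<comment> \<open>All candidates then have orbits of the same dimension \<open>?N - 1\<close>,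
    which makes the count uniform in \<open>x\<close>.\<close>
  with that have full_reach: "reach V x = perp X" if "cand X x" for x using that by blast
  let ?q = "card (UNIV :: 'k set)" and ?k = "dim X" and ?N = "dim (perp X)"
  have q3: "3 \<le> ?q"
  proof -
    have "(2::'k) \<noteq> 1" by (metis add_cancel_right_right one_add_one zero_neq_one)
    then have "card {0, 1, 2 :: 'k} = 3" using char by (auto simp: card_insert_if)
    then show ?thesis using card_mono[OF fin subset_UNIV, of "{0, 1, 2}"] by simp
  qed
  note cardV = subspace_card[OF fin _ fin_dim] and cardE = E.subspace_card[OF fin]
  have pX: "finite (perp X)" "card (perp X) = ?q ^ ?N" using cardV[OF subspace_perp] by auto
  have cX: "finite X" "card X = ?q ^ ?k" using cardV[OF sX] by auto
  have cV: "finite V" "card V = ?q ^ E.dim V" using cardE[OF V_sub fin_dim_S[OF levelD(7)[OF V]]] by auto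
  have sZ: "E.subspace (ZS X)" using subspace_ZS[OF sX] .
  have ZinV: "ZS X \<subseteq> V" using levelD(3)[OF V] .
  then have ZinS: "ZS X \<subseteq> S" using levelD(7)[OF V] by blast
  have cZ: "finite (ZS X)" "card (ZS X) = ?q ^ E.dim (ZS X)" using cardE[OF sZ fin_dim_S[OF ZinS]] by auto
  have Xp: "X \<subseteq> perp X" using ts_perp[OF levelD(6)[OF V]] .

  define J where "J = {x \<in> perp X. b x x = 0}"
  define I where "I = J - X"
  have candI: "cand X x \<longleftrightarrow> x \<in> I" for x using RX by (auto simp: I_def J_def cand_def)
  have XJ: "X \<subseteq> J" using Xp tsD[OF levelD(6)[OF V]] by (auto simp: J_def)
  have fJ: "finite J" using pX(1) by (simp add: J_def)
  have kN: "Suc ?k \<le> ?N"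
  proof -
    have "ext X x1 \<subseteq> perp X" using ext_least[OF subspace_perp Xp candD(1)[OF x1]] .
    then show ?thesis using dim_subset[of "ext X x1" "perp X"] dim_ext[OF sX candD(2)[OF x1]] by simp
  qed

  have "\<exists>e\<in>perp X. b e e \<noteq> 0"
  proof (rule ccontr)
    assume "\<not> (\<exists>e\<in>perp X. b e e \<noteq> 0)"
    then have z: "b e e = 0" if "e \<in> perp X" for e using that by blast
    have "b e x1 = 0" if e: "e \<in> perp X" for e
    proof -
      have "b (e + x1) (e + x1) = 0" using z subspace_add[OF subspace_perp e candD(1)[OF x1]] by blast
      then have "b e x1 + b e x1 = 0" using z[OF e] candD(3)[OF x1] form_commute[of x1 e] by simp
      then show ?thesis by (rule double_eq_zero)
    qed
    then have "x1 \<in> perp (perp X)" by (simp add: perp_def)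
    then show False using perp_perp[OF sX RX] candD(2)[OF x1] by simp
  qed
  then obtain e where e: "e \<in> perp X" "b e e \<noteq> 0" by blast
  define G where "G = {z \<in> perp X. b e z = 0}"
  have sG: "subspace G"
    using subspace_perp[of X] by (auto simp: G_def subspace_def)
  have eG: "e \<notin> G" using e by (simp add: G_def)
  have proj: "z - (b e z / b e e) *s e \<in> G" if "z \<in> perp X" for z
    using that e subspace_diff[OF subspace_perp that subspace_scale[OF subspace_perp e(1)]] by (simp add: G_def)
  have "ext G e = perp X"
  proof
    show "ext G e \<subseteq> perp X" by (rule ext_least[OF subspace_perp _ e(1)]) (auto simp: G_def)
    show "perp X \<subseteq> ext G e" using proj ext_mem[OF sG] by blast
  qed
  then have dG: "?N = Suc (dim G)" using dim_ext[OF sG eG] by simp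
  have cG: "finite G" "card G = ?q ^ dim G" using cardV[OF sG] by auto
  \<comment> \<open>A line parallel to \<open>e\<close> meets the quadric in at most two points,
    since \<open>h\<close> determines the square of the coordinate along \<open>e\<close>.\<close>
  have cardJ: "card J \<le> 2 * ?q ^ (?N - 1)"
  proof -
    \<comment> \<open>An arbitrary value if the line through \<open>h\<close> misses
      \<open>J\<close>; it is used only for \<open>h\<close> coming from a point of
      \<open>J\<close>.\<close>
    define t where "t h = (SOME t. h + t *s e \<in> J)" for h
    have "J \<subseteq> (\<lambda>(h, s). h + (s * t h) *s e) ` (G \<times> {1, - 1})"
    proof
      fix z assume z: "z \<in> J"
      define \<tau> where "\<tau> = b e z / b e e"
      define h where "h = z - \<tau> *s e"
      have h: "h \<in> G" using proj z by (simp add: h_def \<tau>_def J_def)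
      have zh: "z = h + \<tau> *s e" by (simp add: h_def)
      have eh: "b e h = 0" "b h e = 0" using h form_commute[of h e] by (auto simp: G_def)
      have iso: "b h h + s * s * b e e = 0" if "h + s *s e \<in> J" for s
        using that eh by (simp add: J_def mult.assoc)
      have "h + t h *s e \<in> J" unfolding t_def by (rule someI[of _ \<tau>]) (use z zh in simp)
      then have "t h * t h * b e e = \<tau> * \<tau> * b e e" using iso[of "t h"] iso[of \<tau>] z zh
        by (metis add_left_cancel)
      then have "(\<tau> - t h) * (\<tau> + t h) = 0" using e(2) by (simp add: algebra_simps)
      then have "\<tau> = t h \<or> \<tau> = - t h" by (auto simp: eq_neg_iff_add_eq_0)
      then have "z = h + (1 * t h) *s e \<or> z = h + (- 1 * t h) *s e" using zh by auto
      then show "z \<in> (\<lambda>(h, s). h + (s * t h) *s e) ` (G \<times> {1, - 1})" using h by force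
    qed
    then have "card J \<le> card ((\<lambda>(h, s). h + (s * t h) *s e) ` (G \<times> {1, - 1}))"
      using cG(1) by (intro card_mono) auto
    also have "\<dots> \<le> card (G \<times> {1, - 1 :: 'k})" using cG(1) by (intro card_image_le) auto
    also have "\<dots> \<le> card G * 2" by (auto simp: card_cartesian_product card_insert_if)
    finally show ?thesis using cG(2) dG by simp
  qed

  \<comment> \<open>\<open>W x\<close> is the preimage of \<open>X\<close> under evaluation at
    \<open>x\<close>, so its size depends only on \<open>dim X\<close> and on the dimension of the
    orbit.\<close>
  define W where "W x = {u \<in> V. u x \<in> X}" for x
  have cW: "card (W x) * ?q ^ (?N - 1) = card V * ?q ^ ?k" if x: "cand X x" for x
  proof -
    have sW: "E.subspace (W x)"
      using V_sub sX unfolding W_def E.subspace_def subspace_def by (auto simp: fun_scale_def)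
    have WS: "W x \<subseteq> S" using V_S by (auto simp: W_def)
    have "orb (W x) x = X"
    proof
      show "orb (W x) x \<subseteq> X" by (auto simp: orb_def W_def)
      show "X \<subseteq> orb (W x) x"
      proof
        fix w assume w: "w \<in> X"
        obtain t where "t \<in> ZS X" "t x = w" using ZS_reach[OF levelD(1)[OF V] candD(1,2)[OF x] w] .
        then show "w \<in> orb (W x) x" using ZinV w by (auto simp: orb_def W_def)
      qed
    qed
    moreover have "stab (W x) x = stab V x" using subspace_0[OF sX] by (auto simp: stab_def W_def)
    ultimately have "E.dim (W x) = ?k + E.dim (stab V x)" using dim_orb_stab[OF sW WS, of x] by simp
    moreover have "E.dim V = dim (orb V x) + E.dim (stab V x)" using dim_orb_stab[OF V_sub levelD(7)[OF V]] .
    moreover have "?N = Suc (dim (orb V x))" using dim_reach[OF V candD(2)[OF x]] full_reach[OF x] by simp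
    ultimately have "E.dim (W x) + (?N - 1) = E.dim V + ?k" by simp
    then show ?thesis using cardE(2)[OF sW fin_dim_S[OF WS]] cV(2) by (simp flip: power_add)
  qed
  have qk: "0 < ?q ^ n" for n using q3 by simp
  define w where "w = card (W x1)"
  have w: "card (W x) = w" if "cand X x" for x
    using cW[OF that] cW[OF x1] qk[of "?N - 1"] unfolding w_def by (metis mult_right_cancel less_numeral_extra(3))
  \<comment> \<open>A last power of \<open>u\<close> outside \<open>X\<close> is a candidate sent
    into \<open>X\<close>, and every vector of its \<open>ext\<close> outside \<open>X\<close>
    shares this property.\<close>
  have lower: "?q ^ Suc ?k - ?q ^ ?k \<le> card {x \<in> I. u x \<in> X}" if u: "u \<in> V - ZS X" for u
  proof -
    have uV: "u \<in> V" using u by blast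
    obtain a where a: "a \<in> perp X" "u a \<notin> X"
      using u V_S level_apply(3)[OF V] by (auto simp: ZS_def)
    have uN: "u \<in> NS X" using uV levelD(4)[OF V] by blast
    obtain j where j: "(u ^^ j) a \<notin> X" "u ((u ^^ j) a) \<in> X" "b ((u ^^ j) a) ((u ^^ j) a) = 0" "(u ^^ j) a \<in> perp X"
      using last_power[OF sX uN a] by blast
    define x where "x = (u ^^ j) a"
    have x: "cand X x" "u x \<in> X" using j RX by (auto simp: x_def cand_def)
    have "ext X x - X \<subseteq> {x \<in> I. u x \<in> X}"
    proof
      fix z assume z: "z \<in> ext X x - X"
      have "ts (ext X x)" using adm_D(2)[OF adm_ext[OF levelD(1)[OF V] x(1)]] .
      then have "z \<in> J" using z ext_least[OF subspace_perp Xp candD(1)[OF x(1)]] tsD by (auto simp: J_def)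
      moreover obtain c v where "z = c *s x + v" "v \<in> X" using ext_elim[OF sX] z by blast
      then have "u z = c *s u x" using uV level_apply(3)[OF V uV] by (simp add: V_apply)
      then have "u z \<in> X" using subspace_scale[OF sX x(2)] by simp
      ultimately show "z \<in> {x \<in> I. u x \<in> X}" using z by (simp add: I_def)
    qed
    then have "card (ext X x - X) \<le> card {x \<in> I. u x \<in> X}"
      using fJ by (intro card_mono) (auto simp: I_def)
    moreover have "card (ext X x - X) = ?q ^ Suc ?k - ?q ^ ?k"
      using card_Diff_subset[OF cX(1) ext_superset(1)[of X x]] cardV(2)[OF subspace_ext, of X x]
        dim_ext[OF sX candD(2)[OF x(1)]] cX(2) by simp
    ultimately show ?thesis by simp
  qed
  have "card (V - ZS X) * (?q ^ Suc ?k - ?q ^ ?k) \<le> (\<Sum>u\<in>V - ZS X. card {x \<in> I. u x \<in> X})"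
    using sum_bounded_below[of "V - ZS X" "?q ^ Suc ?k - ?q ^ ?k" "\<lambda>u. card {x \<in> I. u x \<in> X}"] lower by simp
  also have "\<dots> = (\<Sum>x\<in>I. card {u \<in> V - ZS X. u x \<in> X})"
    using cV(1) fJ by (intro sum_multicount_gen) (auto simp: I_def)
  also have "\<dots> = (\<Sum>x\<in>I. w - card (ZS X))"
  proof (rule sum.cong[OF refl])
    fix x assume "x \<in> I"
    then have x: "cand X x" using candI by blast
    have "ZS X \<subseteq> W x" using ZinV ZS_D(3) candD(1)[OF x] by (auto simp: W_def)
    moreover have "{u \<in> V - ZS X. u x \<in> X} = W x - ZS X" by (auto simp: W_def)
    ultimately show "card {u \<in> V - ZS X. u x \<in> X} = w - card (ZS X)"
      using card_Diff_subset[OF cZ(1)] w[OF x] by simp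
  qed
  also have "\<dots> = card I * (w - card (ZS X))" by simp
  finally have count: "card (V - ZS X) * (?q ^ Suc ?k - ?q ^ ?k) \<le> card I * (w - card (ZS X))" .
  \<comment> \<open>Over the integers the count reads
    \<open>(A - Z) (Q - 1) K \<le> |I| (w - Z)\<close>, while \<open>w M = A K\<close>. As
    \<open>Q \<ge> 3\<close>, the quadric bound \<open>|I| \<le> 2 M - K\<close> is below
    \<open>(Q - 1) M\<close>, and this forces \<open>M Z < K Z\<close> against
    \<open>K \<le> M\<close>.\<close>
  define A Z M K Q where "A = int (card V)" and "Z = int (card (ZS X))" and "M = int (?q ^ (?N - 1))"
    and "K = int (?q ^ ?k)" and "Q = int ?q"
  have ZA: "Z < A" unfolding Z_def A_def
    using psubset_card_mono[OF cV(1), of "ZS X"] ZinV ZV by auto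
  have Zpos: "0 < Z" unfolding Z_def cZ(2) using qk[of "E.dim (ZS X)"] by linarith
  have Kpos: "0 < K" unfolding K_def using qk[of ?k] by linarith
  have KM: "K \<le> M" unfolding K_def M_def using kN q3 by (simp add: power_increasing)
  have Q3: "3 \<le> Q" unfolding Q_def using q3 by simp
  have WM: "int w * M = A * K"
    using cW[OF x1] unfolding w_def M_def A_def K_def by (metis of_nat_mult)
  have l1: "int (card (V - ZS X)) = A - Z" unfolding A_def Z_def
    using card_Diff_subset[OF cZ(1) ZinV] card_mono[OF cV(1) ZinV] by simp
  have l2: "int (?q ^ Suc ?k - ?q ^ ?k) = (Q - 1) * K" unfolding Q_def K_def
    using q3 by (simp add: algebra_simps)
  have "card I + ?q ^ ?k \<le> 2 * ?q ^ (?N - 1)" unfolding I_def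
    using card_Diff_subset[OF cX(1) XJ] cardJ card_mono[OF fJ XJ] cX(2) by linarith
  then have "int (card I + ?q ^ ?k) \<le> int (2 * ?q ^ (?N - 1))" by (simp only: of_nat_le_iff)
  then have I_le: "int (card I) \<le> 2 * M - K" unfolding M_def K_def by simp
  have cnt: "(A - Z) * ((Q - 1) * K) \<le> int (card I) * int (w - card (ZS X))"
    using count unfolding l1[symmetric] l2[symmetric] by (metis of_nat_le_iff of_nat_mult)
  have pos: "0 < (A - Z) * ((Q - 1) * K)" using ZA Q3 Kpos by simp
  have wz: "card (ZS X) < w"
  proof (rule ccontr)
    assume "\<not> card (ZS X) < w"
    then have "w - card (ZS X) = 0" by simp
    then show False using cnt pos by simp
  qed
  then have wz': "int (w - card (ZS X)) = int w - Z" "0 < int w - Z" by (simp_all add: Z_def)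
  have "int (card I) < (Q - 1) * M"
  proof -
    have "2 * M \<le> (Q - 1) * M" using Q3 KM Kpos by (intro mult_right_mono) auto
    then show ?thesis using I_le Kpos by linarith
  qed
  then have less: "int (card I) * (int w - Z) < (Q - 1) * M * (int w - Z)" using wz'(2) by (rule mult_strict_right_mono)
  have "(Q - 1) * ((A - Z) * K) = (A - Z) * ((Q - 1) * K)" by (rule mult.left_commute)
  also have "\<dots> \<le> int (card I) * (int w - Z)" using cnt unfolding wz'(1) .
  also note less
  also have "(Q - 1) * M * (int w - Z) = (Q - 1) * (A * K - M * Z)"
    unfolding mult.assoc right_diff_distrib[of M] using WM by (simp add: mult.commute)
  finally have "(Q - 1) * ((A - Z) * K) < (Q - 1) * (A * K - M * Z)" .
  then have "(A - Z) * K < A * K - M * Z" using Q3 by simp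
  then have "M * Z < K * Z" by (simp add: algebra_simps)
  then show False using KM Zpos by simp
qed

text \<open>Before the radical is exhausted a candidate lies in \<open>R\<close> and is
  \<open>iso\<close> at once, so only \<open>R \<subseteq> X\<close> needs the two existence
  arguments.\<close>

lemma iso_or_good:
  assumes x1: "cand X x1"
  shows "(\<exists>x. cand X x \<and> orb V x \<subseteq> X) \<or> (\<exists>x. iso x)"
proof (cases "R \<subseteq> X")
  case False
  then have "x1 \<in> R" using candD(4)[OF x1] by blast
  then have "iso x1" using x1 by (simp add: iso_def R_form)
  then show ?thesis by blast
next
  case RX: True
  show ?thesis
  proof (cases "V \<subseteq> ZS X")
    case True
    then have "orb V x1 \<subseteq> X" using ZS_D(3) candD(1)[OF x1] by (auto simp: orb_def)
    then show ?thesis using x1 by blast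
  next
    case ZV: False
    show ?thesis
    proof (cases "finite (UNIV :: 'k set)")
      case True
      then show ?thesis using reach_small_finite[OF True RX ZV x1] iso_exists_if_reach_small[OF _ RX] by metis
    next
      case False
      then show ?thesis using iso_exists_infinite[OF False RX ZV] by blast
    qed
  qed
qed

lemma good_candidate_exists:
  assumes x1: "cand X x1"
  obtains x where "cand X x" "orb V x \<subseteq> X"
  using iso_or_good[OF x1] good_candidate that by blast

end

section \<open>The induction over levels and the theorem\<close>

context sym_form
begin

lemma level_is_full:
  assumes "level X V" "inv_dim X" "tight X V"
  shows "\<exists>F. flag_from X F \<and> V = full X F"
  using assms
proof (induction "\<nu> - dim X" arbitrary: X V)
  case 0
  note X = levelD(1)[OF 0(2)]
  have d: "dim X = \<nu>" using 0(1) dim_le_witt[OF levelD(5,6)[OF 0(2)]] by simp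
  have V: "V = NS X" using maximal_NS[OF X d] levelD(3,4)[OF 0(2)] by blast
  have "u w \<in> X" if "u \<in> NS X" "w \<in> X" for u w
    using NS_D(3)[OF that] subspace_0[OF adm_D(1)[OF X]] by simp
  \<comment> \<open>Only the index \<open>dim X = \<nu>\<close> is constrained, so a constant family
    serves as flag.\<close>
  then have full: "full X (\<lambda>_. X) = NS X" by (auto simp: full_def image_subset_iff)
  have "flag_from X (\<lambda>_. X)"
    using d levelD(5,6)[OF 0(2)] maximal_ts(1)[OF X d] by (auto simp: flag_from_def)
  then show ?case using V full by blast
next
  case (Suc i)
  note V = Suc.prems(1)
  have "dim X < \<nu>" using Suc.hyps(2) by simp
  then obtain x1 where x1: "cand X x1" using cand_exists[OF levelD(1)[OF V]] by blast
  have nf: "\<exists>F. flag_from (ext X x) F \<and> nxt X V x = full (ext X x) F" if x: "cand X x" for x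
  proof (rule Suc.hyps(1))
    show "i = \<nu> - dim (ext X x)" using Suc.hyps(2) dim_ext[OF levelD(5)[OF V] candD(2)[OF x]] by simp
    show "level (ext X x) (nxt X V x)" by (rule level_nxt[OF V x])
    show "inv_dim (ext X x)" by (rule inv_dim_ext[OF levelD(1)[OF V] x Suc.prems(2)])
    show "tight (ext X x) (nxt X V x)" by (rule tight_step(1)[OF Suc.prems x])
  qed
  interpret tight_level scale Basis b X V
    by unfold_locales (use V tight_step(2)[OF Suc.prems] nf in auto)
  obtain x where x: "cand X x" "orb V x \<subseteq> X" using good_candidate_exists[OF x1] .
  obtain F where "flag_from (ext X x) F" "nxt X V x = full (ext X x) F" using nf[OF x(1)] by blast
  then show ?case using full_from_next[OF V x tight_step(2)[OF Suc.prems x(1)]] by blast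
qed

text \<open>With \<open>m = dim R\<close>, \<open>\<nu> = m + k\<close> and
  \<open>dim UNIV = \<nu> + l\<close> the given dimension is
  \<open>(m choose 2) + m (k + l) + k l\<close>. Expanding \<open>(m + k) choose 2\<close> shows
  that this is exactly the upper bound.\<close>

lemma tight_zero:
  assumes V: "E.dim V = (dim R choose 2) + (dim UNIV - dim R) * dim R + (\<nu> - dim R) * (dim UNIV - \<nu>)"
  shows "tight {0} V"
proof -
  obtain k where k: "\<nu> = dim R + k" using dim_R_le le_Suc_ex by blast
  obtain l where l: "dim UNIV = \<nu> + l" using witt_le le_Suc_ex by blast
  have "\<nu> - dim R = k" "dim UNIV - \<nu> = l" "dim UNIV - dim R = k + l" using k l by auto
  then show ?thesis
    unfolding tight_def V dim_zero by (simp add: k choose_two_add algebra_simps)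
qed

lemma max_nilpotent_is_full:
  assumes sub: "E.subspace V" and inS: "V \<subseteq> S" and nil: "\<forall>u\<in>V. nilpotent_endo u"
    and dimV: "E.dim V = (dim R choose 2) + (dim UNIV - dim R) * dim R + (\<nu> - dim R) * (dim UNIV - \<nu>)"
  shows "\<exists>F. partially_complete_flag scale F \<nu> \<and> singular_flag scale b F \<nu> \<and> F (dim R) = R
    \<and> V = {u \<in> S. nilpotent_endo u \<and> stabilizes_flag u F \<nu>}"
proof -
  \<comment> \<open>At \<open>{0}\<close> the space \<open>ZS\<close> is zero, so a level is just a
    linear space of nilpotent symmetric operators.\<close>
  have "adm {0}" using subspace_0[OF subspace_R] by (auto simp: adm_def totally_singular_def)
  moreover have "ZS {0} \<subseteq> {0}" by (auto simp: ZS_def perp_def fun_eq_iff)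
  then have "ZS {0} \<subseteq> V" using E.subspace_0[OF sub] by blast
  moreover have NS0: "NS {0} = {u \<in> S. nilpotent_endo u}" by (auto simp: NS_def S_zero)
  then have "V \<subseteq> NS {0}" using inS nil by blast
  ultimately have "level {0} V" using sub by (simp add: level_def)
  from level_is_full[OF this inv_dim_zero tight_zero[OF dimV]]
  obtain F where F: "flag_from {0} F" "V = full {0} F" by blast
  have flag: "is_flag scale F \<nu>" using F(1) by (auto simp: is_flag_def flag_from_def)
  have "F (dim R) = R"
  proof (cases "R \<subseteq> {0}")
    case True
    then have "R = {0}" using subspace_0[OF subspace_R] by blast
    then show ?thesis using flagD(1)[OF F(1)] by simp
  qed (use flagD(4)[OF F(1)] in blast)
  moreover have "partially_complete_flag scale F \<nu>"
    using flag flagD(6)[OF F(1)] by (simp add: partially_complete_flag_def)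
  moreover have "singular_flag scale b F \<nu>" using flag flagD(3)[OF F(1)] by (simp add: singular_flag_def)
  moreover have "V = {u \<in> S. nilpotent_endo u \<and> stabilizes_flag u F \<nu>}"
    unfolding F(2) by (auto simp: full_def NS0 stabilizes_flag_def)
  ultimately show ?thesis by blast
qed

end

theorem mainTheorem5:
  fixes scale :: "'k::field \<Rightarrow> 'v::ab_group_add \<Rightarrow> 'v"
    and b :: "'v \<Rightarrow> 'v \<Rightarrow> 'k"
    and \<V> :: "('v \<Rightarrow> 'v) set"
    and n r \<nu> :: nat
  assumes vs: "vector_space scale"
    and findim: "finite_dimensional_vector_space scale B"
    and char: "(2::'k) \<noteq> 0"
    and bil: "bilinear_form scale b"
    and sym: "symmetric_form b"
    and n_def: "n = vector_space.dim scale (UNIV :: 'v set)"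
    and r_def: "r = form_rank scale b"
    and nu_def: "\<nu> = witt_index scale b"
    and sub: "Modules.module.subspace (fun_scale scale) \<V>"
    and inSb: "\<V> \<subseteq> S_b scale b"
    and nil: "\<forall>u\<in>\<V>. nilpotent_endo u"
    and dimV: "vector_space.dim (fun_scale scale) \<V>
               = ((n - r) choose 2) + r * (n - r) + (\<nu> + r - n) * (n - \<nu>)"
  shows "\<exists>F. partially_complete_flag scale F \<nu> \<and> singular_flag scale b F \<nu>
           \<and> F (n - r) = Rad b
           \<and> \<V> = {u \<in> S_b scale b. nilpotent_endo u \<and> stabilizes_flag u F \<nu>}"
proof -
  interpret sym_form scale B b
    using findim bil sym char by (simp add: sym_form_def fd_space_def sym_form_axioms_def)
  have "dim (Rad b) \<le> n" unfolding n_def by (rule dim_subset[OF subset_UNIV])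
  then have nr: "n - r = dim (Rad b)" and r: "r = n - dim (Rad b)"
    by (auto simp: r_def form_rank_def n_def)
  have "\<nu> + r - n = \<nu> - dim (Rad b)" using r \<open>dim (Rad b) \<le> n\<close> by linarith
  then have "E.dim \<V> = (dim (Rad b) choose 2) + (dim UNIV - dim (Rad b)) * dim (Rad b)
      + (witt_index scale b - dim (Rad b)) * (dim UNIV - witt_index scale b)"
    using dimV nr r nu_def n_def by simp
  from max_nilpotent_is_full[OF sub inSb nil this] show ?thesis unfolding nr nu_def .
qed

end
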